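(* Let $K$ be a field of characteristic zero and let $A_1$ be the first Weyl algebra over $K$. Assume that $P,Q\in A_1$ satisfy $[P,Q]=1$. If $P$ is a sum of not more than $4$ homogeneous elements of $A_1$ (with respect to the $\mathbb{Z}$-grading of $A_1$ described in the context), then $P$ and $Q$ generate $A_1$ as a $K$-algebra.
   Context: The first Weyl algebra $A_1$ is the associative unital $K$-algebra generated by $X,Y$ with the relation $YX-XY=1$. Here $[P,Q]=PQ-QP$. The $\mathbb{Z}$-grading on $A_1$ is the one whose $i$-th homogeneous component is $K[YX]X^i$ if $i\ge 0$ and $K[YX]Y^{-i}$ if $i<0$; "homogeneous" means homogeneous for this grading. *)

theory Defs
  imports "HOL-Library.Poly_Mapping" "HOL-Computational_Algebra.Polynomial"
begin

section \<open>The free associative algebra on two generators\<close>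

datatype weyl_gen = GenX | GenY

text \<open>The free monoid, written additively: the convolution product of \<^type>\<open>poly_mapping\<close>
  is formed with respect to the addition of the index type.\<close>

datatype 'g free_monoid = Word (letters: "'g list")

instantiation free_monoid :: (type) monoid_add
begin

definition zero_free_monoid :: "'a free_monoid"
  where "0 = Word []"

definition plus_free_monoid :: "'a free_monoid \<Rightarrow> 'a free_monoid \<Rightarrow> 'a free_monoid"
  where "u + v = Word (letters u @ letters v)"

instance
  by standard (simp_all add: zero_free_monoid_def plus_free_monoid_def)

end

type_synonym 'k free_alg = "weyl_gen free_monoid \<Rightarrow>\<^sub>0 'k"

definition free_gen :: "weyl_gen \<Rightarrow> 'k::field free_alg"
  where "free_gen g = Poly_Mapping.single (Word [g]) 1"

inductive_set two_sided_ideal :: "'r::ring_1 set \<Rightarrow> 'r set" for S :: "'r set" where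
  zero: "0 \<in> two_sided_ideal S"
| step: "s \<in> S \<Longrightarrow> p \<in> two_sided_ideal S \<Longrightarrow> a * s * b + p \<in> two_sided_ideal S"

lemma two_sided_ideal_add:
  assumes "p \<in> two_sided_ideal S" "q \<in> two_sided_ideal S"
  shows "p + q \<in> two_sided_ideal S"
  using assms by induction (simp_all add: add.assoc two_sided_ideal.step)

lemma two_sided_ideal_mult_left:
  assumes "p \<in> two_sided_ideal S"
  shows "c * p \<in> two_sided_ideal S"
  using assms
proof induction
  case (step s p a b)
  have "c * (a * s * b + p) = (c * a) * s * b + c * p"
    by (simp add: algebra_simps)
  then show ?case
    using step two_sided_ideal.step by metis
qed (simp add: two_sided_ideal.zero)

lemma two_sided_ideal_mult_right:
  assumes "p \<in> two_sided_ideal S"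
  shows "p * c \<in> two_sided_ideal S"
  using assms
proof induction
  case (step s p a b)
  have "(a * s * b + p) * c = a * s * (b * c) + p * c"
    by (simp add: algebra_simps)
  then show ?case
    using step two_sided_ideal.step by metis
qed (simp add: two_sided_ideal.zero)

lemma two_sided_ideal_uminus:
  assumes "p \<in> two_sided_ideal S"
  shows "- p \<in> two_sided_ideal S"
  using two_sided_ideal_mult_left[OF assms, of "-1"] by simp

lemma two_sided_ideal_base:
  assumes "s \<in> S"
  shows "s \<in> two_sided_ideal S"
  using two_sided_ideal.step[OF assms two_sided_ideal.zero, of 1 1] by simp

abbreviation weyl_relator :: "'k::field free_alg"
  where "weyl_relator \<equiv> free_gen GenY * free_gen GenX - free_gen GenX * free_gen GenY - 1"

definition weyl_rel :: "'k::field free_alg \<Rightarrow> 'k free_alg \<Rightarrow> bool"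
  where "weyl_rel p q \<longleftrightarrow> p - q \<in> two_sided_ideal {weyl_relator}"


section \<open>Properness of the ideal\<close>

text \<open>The free algebra acts on polynomials, \<open>X\<close> by multiplication with the variable and \<open>Y\<close>
  by differentiation; the relator acts as zero whereas \<open>1\<close> does not.\<close>

primrec gen_act :: "weyl_gen \<Rightarrow> 'k::field poly \<Rightarrow> 'k poly" where
  "gen_act GenX = pCons 0"
| "gen_act GenY = pderiv"

definition word_act :: "weyl_gen free_monoid \<Rightarrow> 'k::field poly \<Rightarrow> 'k poly"
  where "word_act w = foldr gen_act (letters w)"

definition free_act :: "'k::field free_alg \<Rightarrow> 'k poly \<Rightarrow> 'k poly"
  where "free_act p f = (\<Sum>w\<in>Poly_Mapping.keys p. smult (Poly_Mapping.lookup p w) (word_act w f))"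

lemma gen_act_add: "gen_act g (f + h) = gen_act g f + gen_act g h"
  by (cases g) (simp_all add: pderiv_add)

lemma gen_act_smult: "gen_act g (smult c f) = smult c (gen_act g f)"
  by (cases g) (simp_all add: pderiv_smult)

lemma word_act_add: "word_act w (f + h) = word_act w f + word_act w h"
proof -
  have "foldr gen_act gs (f + h) = foldr gen_act gs f + foldr gen_act gs h" for gs
    by (induction gs) (simp_all add: gen_act_add)
  then show ?thesis
    by (simp add: word_act_def)
qed

lemma word_act_smult: "word_act w (smult c f) = smult c (word_act w f)"
proof -
  have "foldr gen_act gs (smult c f) = smult c (foldr gen_act gs f)" for gs
    by (induction gs) (simp_all add: gen_act_smult)
  then show ?thesis
    by (simp add: word_act_def)
qed

lemma word_act_mult: "word_act (u + v) f = word_act u (word_act v f)"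
  by (simp add: word_act_def plus_free_monoid_def)

lemma free_act_superset:
  assumes "finite A" "Poly_Mapping.keys p \<subseteq> A"
  shows "free_act p f = (\<Sum>w\<in>A. smult (Poly_Mapping.lookup p w) (word_act w f))"
  unfolding free_act_def
  by (rule sum.mono_neutral_left) (use assms in \<open>auto simp: in_keys_iff\<close>)

lemma free_act_zero [simp]: "free_act 0 f = 0"
  by (simp add: free_act_def)

lemma free_act_single: "free_act (Poly_Mapping.single w c) f = smult c (word_act w f)"
  by (cases "c = 0") (simp_all add: free_act_def)

lemma free_act_one: "free_act 1 f = f"
proof -
  have "free_act (Poly_Mapping.single 0 1) f = f"
    by (simp add: free_act_single word_act_def zero_free_monoid_def)
  then show ?thesis by simp
qed

lemma free_act_add: "free_act (p + q) f = free_act p f + free_act q f"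
proof -
  let ?A = "Poly_Mapping.keys p \<union> Poly_Mapping.keys q"
  have "free_act (p + q) f
      = (\<Sum>w\<in>?A. smult (Poly_Mapping.lookup (p + q) w) (word_act w f))"
    by (rule free_act_superset) (use Poly_Mapping.keys_add[of p q] in auto)
  also have "\<dots> = free_act p f + free_act q f"
    by (simp add: free_act_superset[of ?A] lookup_add smult_add_left sum.distrib)
  finally show ?thesis .
qed

lemma free_act_uminus: "free_act (- p) f = - free_act p f"
  using free_act_add[of p "- p" f] by (simp add: minus_unique)

lemma free_act_diff: "free_act (p - q) f = free_act p f - free_act q f"
  using free_act_add[of p "- q" f] by (simp add: free_act_uminus)

lemma free_act_arg_add: "free_act p (f + h) = free_act p f + free_act p h"
  by (simp add: free_act_def word_act_add smult_add_right sum.distrib)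

lemma free_act_arg_zero [simp]: "free_act p 0 = 0"
  by (metis add_cancel_right_right add_0_right free_act_arg_add)

lemma free_alg_induct [case_names zero add]:
  fixes p :: "'k::field free_alg"
  assumes "Q 0" and "\<And>w c p. Q p \<Longrightarrow> Q (Poly_Mapping.single w c + p)"
  shows "Q p"
proof (induction p rule: update_induct)
  case const
  then show ?case by (rule assms(1))
next
  case (update p w c)
  have "Poly_Mapping.update w c p = Poly_Mapping.single w c + p"
    using update by (intro poly_mapping_eqI)
      (auto simp: lookup_update lookup_add lookup_single in_keys_iff)
  then show ?case
    using assms(2) update by metis
qed

lemma free_act_single_mult:
  "free_act (Poly_Mapping.single u c * q) f = free_act (Poly_Mapping.single u c) (free_act q f)"
  by (induction q rule: free_alg_induct)
    (simp_all add: distrib_left free_act_add free_act_arg_add mult_single free_act_single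
      word_act_mult word_act_smult)

lemma free_act_mult: "free_act (p * q) f = free_act p (free_act q f)"
  by (induction p rule: free_alg_induct)
    (simp_all add: distrib_right free_act_add free_act_single_mult)

lemma free_act_relator: "free_act weyl_relator f = 0"
  by (simp add: free_act_diff free_act_mult free_act_one free_gen_def free_act_single
      word_act_def pderiv_pCons)

lemma free_act_ideal:
  assumes "p \<in> two_sided_ideal {weyl_relator}"
  shows "free_act p f = 0"
  using assms
  by induction (auto simp only: free_act_zero free_act_add free_act_mult free_act_relator
      free_act_arg_zero singleton_iff add_0_left)

lemma one_notin_weyl_ideal: "(1 :: 'k::field free_alg) \<notin> two_sided_ideal {weyl_relator}"
  using free_act_ideal[of 1 "1 :: 'k poly"] by (auto simp: free_act_one)


section \<open>The first Weyl algebra\<close>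

lemma equivp_weyl_rel: "equivp weyl_rel"
proof (rule equivpI)
  show "reflp weyl_rel"
    by (simp add: reflp_def weyl_rel_def two_sided_ideal.zero)
  show "symp weyl_rel"
    unfolding symp_def weyl_rel_def using two_sided_ideal_uminus by fastforce
  show "transp weyl_rel"
    unfolding transp_def weyl_rel_def using two_sided_ideal_add by fastforce
qed

quotient_type (overloaded) 'k weyl = "'k::field free_alg" / weyl_rel
  by (rule equivp_weyl_rel)

instantiation weyl :: (field) ring_1
begin

lift_definition zero_weyl :: "'a weyl" is 0 .

lift_definition one_weyl :: "'a weyl" is 1 .

lift_definition plus_weyl :: "'a weyl \<Rightarrow> 'a weyl \<Rightarrow> 'a weyl" is "(+)"
  unfolding weyl_rel_def using two_sided_ideal_add by (metis add_diff_add)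

lift_definition uminus_weyl :: "'a weyl \<Rightarrow> 'a weyl" is uminus
  unfolding weyl_rel_def using two_sided_ideal_uminus by (metis minus_diff_minus)

lift_definition minus_weyl :: "'a weyl \<Rightarrow> 'a weyl \<Rightarrow> 'a weyl" is "(-)"
proof -
  fix p p' q q' :: "'a free_alg"
  assume "weyl_rel p p'" "weyl_rel q q'"
  then have "(p - p') + - (q - q') \<in> two_sided_ideal {weyl_relator}"
    unfolding weyl_rel_def by (intro two_sided_ideal_add two_sided_ideal_uminus)
  then show "weyl_rel (p - q) (p' - q')"
    by (simp add: weyl_rel_def algebra_simps)
qed

lift_definition times_weyl :: "'a weyl \<Rightarrow> 'a weyl \<Rightarrow> 'a weyl" is "(*)"
proof -
  fix p p' q q' :: "'a free_alg"
  assume "weyl_rel p p'" "weyl_rel q q'"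
  then have "(p - p') * q + p' * (q - q') \<in> two_sided_ideal {weyl_relator}"
    unfolding weyl_rel_def
    by (intro two_sided_ideal_add two_sided_ideal_mult_left two_sided_ideal_mult_right)
  then show "weyl_rel (p * q) (p' * q')"
    by (simp add: weyl_rel_def algebra_simps)
qed

instance
proof
  show "(0 :: 'a weyl) \<noteq> 1"
  proof transfer
    show "\<not> weyl_rel (0 :: 'a free_alg) 1"
      using two_sided_ideal_uminus[of "-1 :: 'a free_alg"] one_notin_weyl_ideal
      by (auto simp: weyl_rel_def)
  qed
qed (transfer; simp add: weyl_rel_def algebra_simps two_sided_ideal.zero)+

end

lift_definition weyl_X :: "'k::field weyl" is "free_gen GenX" .

lift_definition weyl_Y :: "'k::field weyl" is "free_gen GenY" .

text \<open>The structure map from the field of scalars; scalar multiplication by \<open>c\<close> is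
  multiplication by \<open>weyl_const c\<close>.\<close>

lift_definition weyl_const :: "'k::field \<Rightarrow> 'k weyl" is "Poly_Mapping.single 0" .

lemma weyl_commutation_relation: "weyl_Y * weyl_X - weyl_X * weyl_Y = (1 :: 'k::field weyl)"
  by transfer (simp add: weyl_rel_def two_sided_ideal_base)

lemma weyl_const_hom:
  "weyl_const 0 = (0 :: 'k::field weyl)"
  "weyl_const 1 = (1 :: 'k weyl)"
  "weyl_const (a + b) = weyl_const a + (weyl_const b :: 'k weyl)"
  "weyl_const (a * b) = weyl_const a * (weyl_const b :: 'k weyl)"
  by (transfer; simp add: weyl_rel_def single_add mult_single two_sided_ideal.zero)+

lemma free_scalar_central:
  fixes p :: "'k::field free_alg"
  shows "Poly_Mapping.single 0 c * p = p * Poly_Mapping.single 0 c"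
  by (induction p rule: free_alg_induct)
    (simp_all add: distrib_left distrib_right mult_single mult.commute)

lemma weyl_const_central: "weyl_const c * P = P * weyl_const c"
  by transfer (simp add: weyl_rel_def free_scalar_central two_sided_ideal.zero)

definition commutator :: "'k::field weyl \<Rightarrow> 'k weyl \<Rightarrow> 'k weyl"
  where "commutator P Q = P * Q - Q * P"

inductive_set weyl_subalgebra :: "'k::field weyl set \<Rightarrow> 'k weyl set" for S :: "'k weyl set" where
  gen: "s \<in> S \<Longrightarrow> s \<in> weyl_subalgebra S"
| const: "weyl_const c \<in> weyl_subalgebra S"
| add: "p \<in> weyl_subalgebra S \<Longrightarrow> q \<in> weyl_subalgebra S \<Longrightarrow> p + q \<in> weyl_subalgebra S"
| mult: "p \<in> weyl_subalgebra S \<Longrightarrow> q \<in> weyl_subalgebra S \<Longrightarrow> p * q \<in> weyl_subalgebra S"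

definition weyl_component :: "int \<Rightarrow> 'k::field weyl set" where
  "weyl_component i =
    (if i \<ge> 0 then {f * weyl_X ^ nat i | f. f \<in> weyl_subalgebra {weyl_Y * weyl_X}}
     else {f * weyl_Y ^ nat (- i) | f. f \<in> weyl_subalgebra {weyl_Y * weyl_X}})"

definition weyl_homogeneous :: "'k::field weyl \<Rightarrow> bool"
  where "weyl_homogeneous p \<longleftrightarrow> (\<exists>i. p \<in> weyl_component i)"

end

theory Submission
  imports Defs "HOL-Computational_Algebra.Formal_Laurent_Series" "HOL-Algebra.Algebraic_Closure_Type"
begin

text \<open>
  Put \<open>h = Y X\<close>. The Weyl algebra embeds into the ring of skew Laurent polynomials
  \<open>\<Sum> f\<^sub>i(h) X\<^sup>i\<close>, where \<open>X f(h) = f(h - 1) X\<close> and \<open>Y = h X\<^sup>-\<^sup>1\<close>; the homogeneous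
  components of an element become its summands. Let \<open>h\<^sup>d X\<^sup>i\<close> have weight \<open>N d + A i\<close>, for integers
  \<open>N > 0\<close> and \<open>A\<close>. The leading coefficients of the terms of greatest weight form the symbol, a
  Laurent polynomial in one variable \<open>u\<close>. Symbols are multiplicative, and for symbols \<open>p\<close>, \<open>q\<close>
  of weights \<open>v\<close>, \<open>w\<close> the part of weight \<open>v + w - N\<close> of the commutator is, up to the factor
  \<open>N\<close>, the bracket \<open>v p u q' - w q u p'\<close> (\<open>symb_commutator\<close>). If \<open>[P, Q] = 1\<close>, then
  \<open>v + w \<ge> N\<close>, and \<open>v + w > N\<close> forces the bracket to vanish, that is, \<open>q\<^sup>v\<close> and \<open>p\<^sup>w\<close> are
  proportional. The proof compares the Newton polygons of \<open>P\<close> and \<open>Q\<close> by means of all these weights.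

  If \<open>P\<close> or \<open>Q\<close> lacks components of positive or of negative degree, then, up to exchanging the
  roles of \<open>P\<close>, \<open>Q\<close> and of \<open>X\<close>, \<open>Y\<close>, the element \<open>Q\<close> turns out to be \<open>c Y + g(X)\<close>. Its
  centralizer is \<open>K[Q]\<close>, whence \<open>X\<close> lies in the subalgebra of \<open>P\<close> and \<open>Q\<close>
  (\<open>generate_one_sided\<close>). If all signs occur but \<open>v + w = N\<close> for some weight, then \<open>P\<close>
  is linear in \<open>X\<close> and \<open>Y\<close> (\<open>generate_minimal_weight\<close>).

  Otherwise choose the weight of the edge of the Newton polygon of \<open>P\<close> that starts at the component
  of lowest degree, and write \<open>v : w = a : b\<close> in lowest terms. If \<open>a = 1\<close>, then \<open>q = c p\<^sup>b\<close>, and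
  replacing \<open>Q\<close> by \<open>Q - c P\<^sup>b\<close> lowers its weight while \<open>P\<close> stays the same; this is an induction
  (\<open>generate_four_terms\<close>). If \<open>a \<ge> 2\<close>, all nonzero roots of \<open>p\<close> have multiplicity divisible by \<open>a\<close>.
  A polynomial with \<open>n\<close> terms has nonzero roots of multiplicity less than \<open>n\<close> only, so four
  components leave \<open>a \<le> 3\<close>, all multiplicities equal to \<open>a\<close>, and at least three components on the
  edge. A second edge would be a binomial, with simple roots, yet with the same ratio \<open>a : b\<close>
  because it shares a vertex with the first; hence the edge reaches the component of highest degree.

  From \<open>P\<close> and \<open>Q\<close> one builds an element \<open>H\<close> whose symbol has a nonzero bracket with \<open>p\<close>
  (\<open>noncommuting_symbol_exists\<close>). The multiplicities of that symbol at the roots of \<open>p\<close>, compared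
  with its degree, give \<open>v < a N\<close> (\<open>weight_bound\<close>). The end points of the edge being \<open>a\<close> times
  lattice points, only edges from \<open>Y\<^sup>a\<close> to \<open>X\<^sup>a\<^sup>n\<close> or from \<open>Y\<^sup>a\<^sup>n\<close> to \<open>X\<^sup>a\<close> remain
  (\<open>generate_unless_divisible\<close>). Up to symmetry, \<open>P = c Y\<^sup>a + \<dots>\<close> and \<open>Q = c' Y\<^sup>b + \<dots>\<close> with
  lower terms in \<open>Y\<close> and \<open>a\<close>, \<open>b\<close> coprime. For \<open>b = 1\<close> this is \<open>Q = c' Y + g(X)\<close> again, and
  \<open>b \<ge> 2\<close> is impossible: a substitution \<open>Y \<mapsto> Y - g(X)\<close> removes the terms of degree \<open>a - 1\<close> in
  \<open>Y\<close> from \<open>P\<close>, whereas the next edge would have to be an \<open>a\<close>-th power with such a term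
  (\<open>coprime_monic_pair_impossible\<close>).
\<close>

hide_const (open) Polynomials.degree Polynomials.lead_coeff Coset.order module.smult up_ring.coeff up_ring.monom

section \<open>The universal property of the Weyl algebra\<close>

lemma weyl_induct [case_names const X Y add mult]:
  fixes P :: "'k::field weyl"
  assumes const: "\<And>c. Q (weyl_const c)" and X: "Q weyl_X" and Y: "Q weyl_Y"
    and add: "\<And>A B. Q A \<Longrightarrow> Q B \<Longrightarrow> Q (A + B)" and mult: "\<And>A B. Q A \<Longrightarrow> Q B \<Longrightarrow> Q (A * B)"
  shows "Q P"
proof -
  have gen: "Q (abs_weyl (free_gen g))" for g
    using X Y by (cases g) (simp_all add: weyl_X_def weyl_Y_def)
  have word: "Q (abs_weyl (Poly_Mapping.single (Word gs) c))" for gs :: "weyl_gen list" and c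
  proof (induction gs)
    case Nil
    then show ?case using const[of c] by (simp add: weyl_const_def zero_free_monoid_def)
  next
    case (Cons g gs)
    have "Poly_Mapping.single (Word (g # gs)) c = free_gen g * Poly_Mapping.single (Word gs) c"
      by (simp add: free_gen_def mult_single plus_free_monoid_def)
    then show ?case
      using mult[OF gen Cons] by (simp add: times_weyl.abs_eq)
  qed
  have "Q (abs_weyl p)" for p :: "'k free_alg"
  proof (induction p rule: free_alg_induct)
    case zero
    then show ?case using const[of 0] by (simp add: weyl_const_def)
  next
    case (add w c p)
    have "Q (abs_weyl (Poly_Mapping.single w c))"
      using word[of "letters w" c] by simp
    then show ?case using assms(4) add by (metis plus_weyl.abs_eq)
  qed
  then show ?thesis
    by (metis Quotient_weyl Quotient_abs_rep)
qed

text \<open>Every pair \<open>x\<close>, \<open>y\<close> with \<open>y x - x y = 1\<close> in a ring with a central copy of the scalars is the image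
  of \<open>X\<close>, \<open>Y\<close> under a homomorphism. It is used for the embedding into skew Laurent polynomials, for the
  rotation exchanging \<open>X\<close> and \<open>Y\<close>, and for the substitution \<open>Y \<mapsto> Y - g(X)\<close>.\<close>

locale weyl_target =
  fixes \<kappa> :: "'k::field \<Rightarrow> 'b::ring_1" and x y :: 'b
  assumes \<kappa>_add: "\<kappa> (a + b) = \<kappa> a + \<kappa> b"
    and \<kappa>_mult: "\<kappa> (a * b) = \<kappa> a * \<kappa> b"
    and \<kappa>_one: "\<kappa> 1 = 1"
    and \<kappa>_central: "\<kappa> a * z = z * \<kappa> a"
    and relation: "y * x - x * y = 1"
begin

primrec gen_img :: "weyl_gen \<Rightarrow> 'b" where
  "gen_img GenX = x"
| "gen_img GenY = y"

definition word_img :: "weyl_gen free_monoid \<Rightarrow> 'b"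
  where "word_img w = prod_list (map gen_img (letters w))"

definition free_img :: "'k free_alg \<Rightarrow> 'b"
  where "free_img p = (\<Sum>w\<in>Poly_Mapping.keys p. \<kappa> (Poly_Mapping.lookup p w) * word_img w)"

definition weyl_img :: "'k weyl \<Rightarrow> 'b"
  where "weyl_img P = free_img (rep_weyl P)"

lemma \<kappa>_zero: "\<kappa> 0 = 0"
  using \<kappa>_add[of 0 0] by simp

lemma word_img_plus: "word_img (u + v) = word_img u * word_img v"
  by (simp add: word_img_def plus_free_monoid_def)

lemma free_img_superset:
  assumes "finite A" "Poly_Mapping.keys p \<subseteq> A"
  shows "free_img p = (\<Sum>w\<in>A. \<kappa> (Poly_Mapping.lookup p w) * word_img w)"
  unfolding free_img_def
  by (rule sum.mono_neutral_left) (use assms in \<open>auto simp: in_keys_iff \<kappa>_zero\<close>)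

lemma free_img_zero [simp]: "free_img 0 = 0"
  by (simp add: free_img_def)

lemma free_img_single: "free_img (Poly_Mapping.single w c) = \<kappa> c * word_img w"
  by (cases "c = 0") (simp_all add: free_img_def \<kappa>_zero)

lemma free_img_add: "free_img (p + q) = free_img p + free_img q"
proof -
  let ?A = "Poly_Mapping.keys p \<union> Poly_Mapping.keys q"
  have "free_img (p + q) = (\<Sum>w\<in>?A. \<kappa> (Poly_Mapping.lookup (p + q) w) * word_img w)"
    by (rule free_img_superset) (use Poly_Mapping.keys_add[of p q] in auto)
  also have "\<dots> = free_img p + free_img q"
    by (simp add: free_img_superset[of ?A] lookup_add \<kappa>_add distrib_right sum.distrib)
  finally show ?thesis .
qed

lemma free_img_uminus: "free_img (- p) = - free_img p"
  using free_img_add[of p "- p"] by (simp add: minus_unique)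

lemma free_img_diff: "free_img (p - q) = free_img p - free_img q"
  using free_img_add[of p "- q"] by (simp add: free_img_uminus)

lemma free_img_single_mult:
  "free_img (Poly_Mapping.single u c * q) = free_img (Poly_Mapping.single u c) * free_img q"
proof (induction q rule: free_alg_induct)
  case (add w d p)
  have "\<kappa> c * \<kappa> d * (word_img u * word_img w) = \<kappa> c * word_img u * (\<kappa> d * word_img w)"
    using \<kappa>_central by (metis mult.assoc)
  then show ?case using add
    by (simp add: distrib_left free_img_add mult_single free_img_single \<kappa>_mult word_img_plus)
qed simp

lemma free_img_mult: "free_img (p * q) = free_img p * free_img q"
  by (induction p rule: free_alg_induct)
    (simp_all add: distrib_right free_img_add free_img_single_mult)

lemma free_img_const: "free_img (Poly_Mapping.single 0 c) = \<kappa> c"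
  by (simp add: free_img_single word_img_def zero_free_monoid_def)

lemma free_img_gen: "free_img (free_gen g) = gen_img g"
  by (simp add: free_gen_def free_img_single word_img_def \<kappa>_one)

lemma free_img_one: "free_img 1 = 1"
  using free_img_const[of 1] by (simp add: \<kappa>_one)

lemma free_img_ideal:
  assumes "p \<in> two_sided_ideal {weyl_relator}"
  shows "free_img p = 0"
  using assms
  by induction (auto simp: free_img_add free_img_mult free_img_diff free_img_gen free_img_one relation)

lemma weyl_img_abs: "weyl_img (abs_weyl p) = free_img p"
proof -
  have "weyl_rel (rep_weyl (abs_weyl p)) p"
    using Quotient_weyl by (metis Quotient_rep_abs equivp_weyl_rel equivp_reflp)
  then have "free_img (rep_weyl (abs_weyl p) - p) = 0"
    unfolding weyl_rel_def by (rule free_img_ideal)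
  then show ?thesis by (simp add: weyl_img_def free_img_diff)
qed

lemma abs_weyl_cases: obtains p where "P = abs_weyl p"
  by (metis Quotient_weyl Quotient_abs_rep)

lemma weyl_img_add: "weyl_img (P + Q) = weyl_img P + weyl_img Q"
  by (rule abs_weyl_cases[of P], rule abs_weyl_cases[of Q])
    (simp add: plus_weyl.abs_eq weyl_img_abs free_img_add)

lemma weyl_img_mult: "weyl_img (P * Q) = weyl_img P * weyl_img Q"
  by (rule abs_weyl_cases[of P], rule abs_weyl_cases[of Q])
    (simp add: times_weyl.abs_eq weyl_img_abs free_img_mult)

lemma weyl_img_const: "weyl_img (weyl_const c) = \<kappa> c"
  by (simp add: weyl_const_def weyl_img_abs free_img_const)

lemma weyl_img_X: "weyl_img weyl_X = x"
  by (simp add: weyl_X_def weyl_img_abs free_img_gen)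

lemma weyl_img_Y: "weyl_img weyl_Y = y"
  by (simp add: weyl_Y_def weyl_img_abs free_img_gen)

lemma weyl_img_zero: "weyl_img 0 = 0"
  using weyl_img_add[of 0 0] by simp

lemma weyl_img_one: "weyl_img 1 = 1"
  using weyl_img_const[of 1] by (simp add: weyl_const_hom \<kappa>_one)

lemma weyl_img_uminus: "weyl_img (- P) = - weyl_img P"
  using weyl_img_add[of P "- P"] by (simp add: weyl_img_zero minus_unique)

lemma weyl_img_diff: "weyl_img (P - Q) = weyl_img P - weyl_img Q"
  using weyl_img_add[of P "- Q"] by (simp add: weyl_img_uminus)

lemma weyl_img_power: "weyl_img (P ^ n) = weyl_img P ^ n"
  by (induction n) (simp_all add: weyl_img_one weyl_img_mult)

lemma weyl_img_sum: "weyl_img (sum f S) = (\<Sum>s\<in>S. weyl_img (f s))"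
  by (induction S rule: infinite_finite_induct) (simp_all add: weyl_img_zero weyl_img_add)

lemma weyl_img_commutator:
  "commutator P Q = 1 \<Longrightarrow> weyl_img P * weyl_img Q - weyl_img Q * weyl_img P = 1"
  by (metis commutator_def weyl_img_diff weyl_img_mult weyl_img_one)

lemmas weyl_img_simps = weyl_img_add weyl_img_mult weyl_img_const weyl_img_X weyl_img_Y
  weyl_img_zero weyl_img_one weyl_img_uminus weyl_img_diff weyl_img_power weyl_img_sum

end

section \<open>Skew Laurent polynomials\<close>

text \<open>Conjugation by \<open>X\<^sup>i\<close>: \<open>X\<^sup>i f(h) = f(h - i) X\<^sup>i\<close>.\<close>

definition shift :: "int \<Rightarrow> 'k::field_char_0 poly \<Rightarrow> 'k poly"
  where "shift i p = pcompose p [:- of_int i, 1:]"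

lemma shift_simps [simp]:
  "shift i 0 = 0" "shift i 1 = 1" "shift i [:c:] = [:c:]"
  "shift i (p + q) = shift i p + shift i q"
  "shift i (p - q) = shift i p - shift i q"
  "shift i (p * q) = shift i p * shift i q"
  "shift 0 p = p"
  by (simp_all add: shift_def pcompose_add pcompose_diff pcompose_mult pcompose_1 pcompose_const)

lemma shift_shift [simp]: "shift i (shift j p) = shift (i + j) p"
  unfolding shift_def pcompose_assoc[symmetric]
  by (simp add: pcompose_pCons add.commute)

lemma shift_var: "shift i [:0, 1:] = [:- of_int i, 1:]"
  by (simp add: shift_def pcompose_pCons)

lemma poly_shift: "poly (shift i p) z = poly p (z - of_int i)"
  by (simp add: shift_def poly_pcompose)

lemma degree_shift [simp]: "degree (shift i p) = degree p"
  by (simp add: shift_def degree_pcompose)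

text \<open>The element \<open>\<Sum> f\<^sub>i(h) X\<^sup>i\<close> is stored as the family of its coefficients, which stand to the left of
  the powers of \<open>X\<close>. The type is a copy, since the product of finitely supported families is already
  taken by the untwisted convolution.\<close>

typedef (overloaded) 'k skew = "UNIV :: (int \<Rightarrow>\<^sub>0 'k::field_char_0 poly) set" ..

setup_lifting type_definition_skew

definition comp :: "'k::field_char_0 skew \<Rightarrow> int \<Rightarrow> 'k poly"
  where "comp f i = Poly_Mapping.lookup (Rep_skew f) i"

definition supp :: "'k::field_char_0 skew \<Rightarrow> int set"
  where "supp f = Poly_Mapping.keys (Rep_skew f)"

definition homog :: "'k::field_char_0 poly \<Rightarrow> int \<Rightarrow> 'k skew"
  where "homog p i = Abs_skew (Poly_Mapping.single i p)"

lemma skew_eqI: "(\<And>i. comp f i = comp g i) \<Longrightarrow> f = g"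
  by (metis Rep_skew_inject comp_def poly_mapping_eqI)

lemma finite_supp [simp]: "finite (supp f)"
  by (simp add: supp_def)

lemma in_supp: "i \<in> supp f \<longleftrightarrow> comp f i \<noteq> 0"
  by (simp add: supp_def comp_def in_keys_iff)

lemma comp_homog: "comp (homog p i) j = (if i = j then p else 0)"
  by (simp add: comp_def homog_def Abs_skew_inverse lookup_single when_def)

instantiation skew :: (field_char_0) ab_group_add
begin
lift_definition zero_skew :: "'a skew" is 0 .
lift_definition plus_skew :: "'a skew \<Rightarrow> 'a skew \<Rightarrow> 'a skew" is "(+)" .
lift_definition minus_skew :: "'a skew \<Rightarrow> 'a skew \<Rightarrow> 'a skew" is "(-)" .
lift_definition uminus_skew :: "'a skew \<Rightarrow> 'a skew" is uminus .
instance by standard (transfer; simp)+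
end

lemma comp_simps [simp]:
  "comp 0 i = 0" "comp (f + g) i = comp f i + comp g i"
  "comp (f - g) i = comp f i - comp g i" "comp (- f) i = - comp f i"
  by (simp_all add: comp_def zero_skew.rep_eq plus_skew.rep_eq minus_skew.rep_eq uminus_skew.rep_eq
      lookup_add lookup_minus)

lemma comp_sum: "comp (sum F S) i = (\<Sum>s\<in>S. comp (F s) i)"
  by (induction S rule: infinite_finite_induct) simp_all

lemma homog_add: "homog (p + q) i = homog p i + homog q i"
  and homog_0 [simp]: "homog 0 i = 0"
  by (auto intro!: skew_eqI simp: comp_homog)

lemma skew_expand: "f = (\<Sum>i\<in>supp f. homog (comp f i) i)"
  by (rule skew_eqI) (auto simp: comp_sum comp_homog in_supp if_distrib cong: if_cong)

lemma skew_induct [case_names zero add]: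
  assumes "Q 0" and "\<And>p i f. Q f \<Longrightarrow> Q (homog p i + f)"
  shows "Q f"
proof -
  have "Q (\<Sum>i\<in>S. homog (comp f i) i)" if "finite S" for S
    using that by induction (use assms in auto)
  then show ?thesis using skew_expand[of f] by (metis finite_supp)
qed

instantiation skew :: (field_char_0) times
begin
definition times_skew :: "'a skew \<Rightarrow> 'a skew \<Rightarrow> 'a skew" where
  "f * g = (\<Sum>i\<in>supp f. \<Sum>j\<in>supp g. homog (comp f i * shift i (comp g j)) (i + j))"
instance ..
end

lemma times_superset:
  assumes "finite A" "supp f \<subseteq> A" "finite B" "supp g \<subseteq> B"
  shows "f * g = (\<Sum>i\<in>A. \<Sum>j\<in>B. homog (comp f i * shift i (comp g j)) (i + j))"
proof -
  have "f * g = (\<Sum>i\<in>supp f. \<Sum>j\<in>B. homog (comp f i * shift i (comp g j)) (i + j))"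
    unfolding times_skew_def
    by (intro sum.cong sum.mono_neutral_left) (use assms in \<open>auto simp: in_supp\<close>)
  also have "\<dots> = (\<Sum>i\<in>A. \<Sum>j\<in>B. homog (comp f i * shift i (comp g j)) (i + j))"
    by (intro sum.mono_neutral_left) (use assms in \<open>auto simp: in_supp\<close>)
  finally show ?thesis .
qed

lemma supp_add: "supp (f + g) \<subseteq> supp f \<union> supp g"
  by (auto simp: in_supp)

lemma skew_distrib_right: "(f + g) * h = f * h + g * (h :: 'k::field_char_0 skew)"
  using supp_add[of f g]
  by (simp add: times_superset[of "supp f \<union> supp g" _ "supp h"] distrib_right homog_add sum.distrib)

lemma skew_distrib_left: "h * (f + g) = h * f + h * (g :: 'k::field_char_0 skew)"
  using supp_add[of f g]
  by (simp add: times_superset[of "supp h" _ "supp f \<union> supp g"] distrib_left homog_add sum.distrib)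

lemma homog_times_homog [simp]: "homog p i * homog q j = homog (p * shift i q) (i + j)"
proof -
  have "supp (homog p i) \<subseteq> {i}" "supp (homog q j) \<subseteq> {j}"
    by (auto simp: in_supp comp_homog split: if_splits)
  then show ?thesis by (simp add: times_superset[of "{i}" _ "{j}"] comp_homog)
qed

lemma skew_zero_times [simp]: "(0 :: 'k::field_char_0 skew) * f = 0" "f * (0 :: 'k skew) = 0"
  by (simp_all add: times_skew_def supp_def zero_skew.rep_eq)

instantiation skew :: (field_char_0) ring_1
begin
definition one_skew :: "'a skew" where "1 = homog 1 0"
instance
proof
  fix f g h :: "'a skew"
  show "f * g * h = f * (g * h)"
  proof (induction f rule: skew_induct)
    case (add p i f)
    have "homog p i * g * h = homog p i * (g * h)"
    proof (induction g rule: skew_induct)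
      case (add q j g)
      have "homog p i * homog q j * h = homog p i * (homog q j * h)"
        by (induction h rule: skew_induct) (simp_all add: skew_distrib_left mult.assoc add.assoc)
      with add show ?case by (simp add: skew_distrib_left skew_distrib_right)
    qed simp
    with add show ?case by (simp add: skew_distrib_right)
  qed simp
  show "1 * f = f"
    unfolding one_skew_def by (induction f rule: skew_induct) (simp_all add: skew_distrib_left)
  show "f * 1 = f"
    unfolding one_skew_def by (induction f rule: skew_induct) (simp_all add: skew_distrib_right)
  show "(0 :: 'a skew) \<noteq> 1"
  proof
    assume "(0 :: 'a skew) = 1"
    then have "comp (0 :: 'a skew) 0 = comp 1 0" by simp
    then show False by (simp add: one_skew_def comp_homog)
  qed
qed (simp_all add: skew_distrib_left skew_distrib_right)
end

lemma comp_one: "comp 1 i = (if i = 0 then 1 else 0)"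
  by (simp add: one_skew_def comp_homog)

lemma comp_times: "comp (f * g) n = (\<Sum>i\<in>supp f. comp f i * shift i (comp g (n - i)))"
proof -
  have "(\<Sum>j\<in>supp g. comp (homog (comp f i * shift i (comp g j)) (i + j)) n)
      = comp f i * shift i (comp g (n - i))" for i
  proof -
    have "(\<Sum>j\<in>supp g. comp (homog (comp f i * shift i (comp g j)) (i + j)) n)
        = (\<Sum>j\<in>supp g. if j = n - i then comp f i * shift i (comp g j) else 0)"
      by (intro sum.cong) (auto simp: comp_homog)
    also have "\<dots> = comp f i * shift i (comp g (n - i))"
      by (auto simp: in_supp)
    finally show ?thesis .
  qed
  then show ?thesis by (simp add: times_skew_def comp_sum)
qed

definition sconst :: "'k::field_char_0 \<Rightarrow> 'k skew" where "sconst c = homog [:c:] 0"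

lemma sconst_central: "sconst c * f = f * sconst c"
  unfolding sconst_def
  by (induction f rule: skew_induct) (simp_all add: skew_distrib_left skew_distrib_right mult.commute)

lemma sconst_simps: "sconst 0 = 0" "sconst 1 = 1" "sconst (a + b) = sconst a + sconst b"
  "sconst (a * b) = sconst a * sconst b"
  by (auto intro!: skew_eqI simp: sconst_def comp_homog comp_one one_pCons)

lemma comp_sconst_times: "comp (sconst c * f) i = smult c (comp f i)"
  unfolding sconst_def
  by (induction f rule: skew_induct) (auto simp: skew_distrib_left comp_homog smult_add_right)

definition sX :: "'k::field_char_0 skew" where "sX = homog 1 1"
definition sY :: "'k::field_char_0 skew" where "sY = homog [:0, 1:] (-1)"

lemma sYX: "sY * sX = homog [:0, 1:] 0" and sXY: "sX * sY = homog [:-1, 1:] 0"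
  by (simp_all add: sX_def sY_def shift_var)

lemma skew_relation: "sY * sX - sX * sY = (1 :: 'k::field_char_0 skew)"
  by (rule skew_eqI) (auto simp: sYX sXY comp_homog comp_one one_pCons)

unbundle fps_syntax

section \<open>Weights and symbols\<close>

text \<open>Bounds the weights of the monomials \<open>h\<^sup>d X\<^sup>i\<close> in \<open>f\<close>. In terms of the monomials \<open>X\<^sup>j Y\<^sup>k\<close> this is a
  weighted degree in which \<open>X\<close> has weight \<open>A\<close> and \<open>Y\<close> has weight \<open>N - A\<close>.\<close>

definition wle :: "int \<Rightarrow> int \<Rightarrow> int \<Rightarrow> 'k::field_char_0 skew \<Rightarrow> bool"
  where "wle N A w f \<longleftrightarrow> (\<forall>i d. coeff (comp f i) d \<noteq> 0 \<longrightarrow> N * int d + A * i \<le> w)"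

definition lmono :: "'k::field_char_0 \<Rightarrow> int \<Rightarrow> 'k fls"
  where "lmono c i = fls_shift (- i) (fls_const c)"

text \<open>The part of weight \<open>w\<close> is determined by one coefficient for each \<open>i\<close>, so that \<open>h\<close> can be dropped and
  \<open>X\<close> replaced by a variable \<open>u\<close>. The values are Laurent polynomials; they are placed in the field of
  formal Laurent series because quotients of symbols are useful. The weight \<open>w\<close> is a parameter, which
  makes the map linear.\<close>

definition symb :: "int \<Rightarrow> int \<Rightarrow> int \<Rightarrow> 'k::field_char_0 skew \<Rightarrow> 'k fls" where
  "symb N A w f = (\<Sum>i\<in>supp f.
     if N dvd w - A * i \<and> 0 \<le> w - A * i
     then lmono (coeff (comp f i) (nat ((w - A * i) div N))) i else 0)"

text \<open>The derivation \<open>u d/du\<close>.\<close>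

definition euler :: "'k::field_char_0 fls \<Rightarrow> 'k fls"
  where "euler p = fls_X * fls_deriv p"

lemma lmono_nth: "lmono c i $$ n = (if n = i then c else 0)"
  by (simp add: lmono_def)

lemma lmono_simps [simp]: "lmono 0 i = 0" "lmono c i = 0 \<longleftrightarrow> c = 0"
proof -
  show zero: "lmono 0 i = 0" by (rule fls_eqI) (simp add: lmono_nth)
  show "lmono c i = 0 \<longleftrightarrow> c = 0" using lmono_nth[of c i i] zero by auto
qed

lemma lmono_mult: "lmono c i * lmono d j = lmono (c * d) (i + j)"
  by (simp add: lmono_def fls_shifted_times_simps algebra_simps fls_const_mult_const)

lemma euler_nth: "euler p $$ n = of_int n * p $$ n"
  by (simp add: euler_def fls_X_times_conv_shift)

lemma euler_simps: "euler 0 = 0" "euler (p + q) = euler p + euler q" "euler (p - q) = euler p - euler q"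
  "euler (p * q) = p * euler q + euler p * q"
  "euler (fls_const c) = 0" "euler 1 = 0"
  by (simp_all add: euler_def algebra_simps)

lemma euler_lmono: "euler (lmono c i) = of_int i * lmono c i"
  by (rule fls_eqI) (simp add: euler_nth lmono_nth fls_of_int)

lemma fls_sum_nth: "(\<Sum>s\<in>S. F s) $$ n = (\<Sum>s\<in>S. F s $$ n)"
  by (induction S rule: infinite_finite_induct) simp_all

lemma symb_nth:
  "symb N A w f $$ i = (if N dvd w - A * i \<and> 0 \<le> w - A * i
     then coeff (comp f i) (nat ((w - A * i) div N)) else 0)"
proof -
  have "symb N A w f $$ i = (\<Sum>j\<in>supp f. if j = i then (if N dvd w - A * i \<and> 0 \<le> w - A * i
     then coeff (comp f i) (nat ((w - A * i) div N)) else 0) else 0)"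
    unfolding symb_def fls_sum_nth by (intro sum.cong) (auto simp: lmono_nth)
  then show ?thesis by (auto simp: in_supp)
qed

lemma symb_nth_coeff:
  assumes "N > 0" "w = N * int d + A * i"
  shows "symb N A w f $$ i = coeff (comp f i) d"
  using assms by (simp add: symb_nth)

lemma symb_nth_nonzeroE:
  assumes "N > 0" "symb N A w f $$ i \<noteq> 0"
  obtains d where "w = N * int d + A * i" "coeff (comp f i) d \<noteq> 0" "symb N A w f $$ i = coeff (comp f i) d"
proof -
  have *: "N dvd w - A * i" "0 \<le> w - A * i"
    using assms by (auto simp: symb_nth split: if_splits)
  then have "w = N * int (nat ((w - A * i) div N)) + A * i"
    using assms(1) by (simp add: pos_imp_zdiv_nonneg_iff)
  then show ?thesis using that assms symb_nth_coeff by metis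
qed

lemma symb_simps [simp]: "symb N A w 0 = 0" "symb N A w (f + g) = symb N A w f + symb N A w g"
  "symb N A w (f - g) = symb N A w f - symb N A w g"
  by (auto intro!: fls_eqI simp: symb_nth)

lemma symb_uminus [simp]: "symb N A w (- f) = - symb N A w f"
  using symb_simps(3)[of N A w 0 f] by simp

lemma symb_sconst_times: "symb N A w (sconst c * f) = fls_const c * symb N A w f"
  by (auto intro!: fls_eqI simp: symb_nth comp_sconst_times)

lemma symb_homog: "symb N A w (homog p i) =
   (if N dvd w - A * i \<and> 0 \<le> w - A * i then lmono (coeff p (nat ((w - A * i) div N))) i else 0)"
  by (auto intro!: fls_eqI simp: symb_nth lmono_nth comp_homog)

lemma symb_monomial: "N > 0 \<Longrightarrow>
   symb N A w (homog (monom c d) i) = (if w = N * int d + A * i then lmono c i else 0)"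
proof (rule fls_eqI, goal_cases)
  case (1 n)
  show ?case
  proof (cases "symb N A w (homog (monom c d) i) $$ n = 0")
    case True
    then show ?thesis using 1 symb_nth_coeff[OF 1, of w d A n "homog (monom c d) i"]
      by (auto simp: lmono_nth comp_homog)
  next
    case False
    then show ?thesis using 1
      by (elim symb_nth_nonzeroE) (auto simp: lmono_nth comp_homog split: if_splits)
  qed
qed

lemma wle_0 [simp]: "wle N A w 0"
  and wle_add: "wle N A w f \<Longrightarrow> wle N A w g \<Longrightarrow> wle N A w (f + g)"
  and wle_uminus: "wle N A w f \<Longrightarrow> wle N A w (- f)"
  and wle_mono: "wle N A w f \<Longrightarrow> w \<le> w' \<Longrightarrow> wle N A w' f"
  unfolding wle_def by (simp, metis add.right_neutral coeff_add comp_simps(2), simp, force)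

lemma wle_diff: "wle N A w f \<Longrightarrow> wle N A w g \<Longrightarrow> wle N A w (f - g)"
  using wle_add[of N A w f "- g"] wle_uminus[of N A w g] by simp

lemma wle_homog:
  "(\<And>n. coeff p n \<noteq> 0 \<Longrightarrow> N * int n + A * i \<le> w) \<Longrightarrow> wle N A w (homog p i)"
  by (auto simp: wle_def comp_homog)

lemma homog_sum: "homog (sum F S) i = (\<Sum>s\<in>S. homog (F s) i)"
  by (rule skew_eqI) (auto simp: comp_sum comp_homog)

lemma wle_induct [consumes 1, case_names zero add]:
  assumes "wle N A w f" and "Q 0"
    and "\<And>c d i g. N * int d + A * i \<le> w \<Longrightarrow> wle N A w g \<Longrightarrow> Q g \<Longrightarrow> Q (homog (monom c d) i + g)"
  shows "Q f"
proof -
  define S where "S = Sigma (supp f) (\<lambda>i. {d. coeff (comp f i) d \<noteq> 0})"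
  have fin: "finite {d. coeff (comp f i) d \<noteq> 0}" for i
    using MOST_coeff_eq_0[of "comp f i"] by (simp add: eventually_cofinite)
  have finS: "finite S" unfolding S_def using fin by auto
  have "comp f i = (\<Sum>d\<in>{d. coeff (comp f i) d \<noteq> 0}. monom (coeff (comp f i) d) d)" for i
    by (rule poly_eqI) (use fin[of i] in \<open>auto simp: coeff_sum\<close>)
  then have "f = (\<Sum>i\<in>supp f. \<Sum>d\<in>{d. coeff (comp f i) d \<noteq> 0}. homog (monom (coeff (comp f i) d) d) i)"
    using skew_expand[of f] by (metis (no_types, lifting) homog_sum sum.cong)
  also have "\<dots> = (\<Sum>(i, d)\<in>S. homog (monom (coeff (comp f i) d) d) i)"
    unfolding S_def by (subst sum.Sigma) (use fin in auto)
  finally have f: "f = (\<Sum>(i, d)\<in>S. homog (monom (coeff (comp f i) d) d) i)" .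
  have "T \<subseteq> S \<Longrightarrow> Q (\<Sum>(i, d)\<in>T. homog (monom (coeff (comp f i) d) d) i)
      \<and> wle N A w (\<Sum>(i, d)\<in>T. homog (monom (coeff (comp f i) d) d) i)" if "finite T" for T
    using that
  proof induction
    case (insert x T)
    obtain i d where x: "x = (i, d)" by force
    have le: "N * int d + A * i \<le> w"
      using insert.prems x assms(1) by (auto simp: S_def wle_def)
    then have "wle N A w (homog (monom (coeff (comp f i) d) d) i)"
      by (intro wle_homog) (auto split: if_splits)
    then show ?case using insert le assms(3) x by (auto intro!: wle_add)
  qed (use assms(2) in auto)
  from this[OF finS] f show ?thesis by simp
qed

lemma coeff_linear_power:
  fixes b :: "'k::field_char_0"
  shows "coeff ([:b, 1:] ^ e) e = 1" "e < n \<Longrightarrow> coeff ([:b, 1:] ^ e) n = 0"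
    "coeff ([:b, 1:] ^ Suc e) e = of_nat (Suc e) * b"
proof -
  have step: "coeff ([:b, 1:] ^ Suc m) (Suc k) = b * coeff ([:b, 1:] ^ m) (Suc k) + coeff ([:b, 1:] ^ m) k" for m k
    by simp
  have *: "coeff ([:b, 1:] ^ m) m = 1 \<and> (\<forall>n>m. coeff ([:b, 1:] ^ m) n = 0)" for m
  proof (induction m)
    case (Suc m)
    have "coeff ([:b, 1:] ^ Suc m) n = 0" if "n > Suc m" for n
      using that Suc step[of m "n - 1"] by (cases n) auto
    then show ?case using Suc step[of m m] by simp
  qed simp
  show "coeff ([:b, 1:] ^ e) e = 1" "e < n \<Longrightarrow> coeff ([:b, 1:] ^ e) n = 0"
    using * by auto
  show "coeff ([:b, 1:] ^ Suc e) e = of_nat (Suc e) * b"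
  proof (induction e)
    case (Suc e)
    have "coeff ([:b, 1:] ^ Suc (Suc e)) (Suc e) = b * 1 + of_nat (Suc e) * b"
      using step[of "Suc e" e] Suc *[of "Suc e"] by presburger
    then show ?case by (simp add: algebra_simps)
  qed simp
qed

lemma shift_monom: "shift i (monom c e) = smult c ([:- of_int i, 1:] ^ e)"
proof -
  have "shift i (monom c e) = shift i ([:c:] * [:0, 1:] ^ e)"
    by (simp add: monom_altdef)
  also have "\<dots> = [:c:] * shift i ([:0, 1:] ^ e)"
    by (simp only: shift_simps)
  also have "shift i ([:0, 1:] ^ e) = shift i [:0, 1:] ^ e" for e
    by (induction e) (simp_all only: shift_simps power_0 power_Suc)
  finally show ?thesis by (simp add: shift_var)
qed

text \<open>The leading two coefficients of \<open>h\<^sup>d (h - i)\<^sup>e\<close>: the first yields multiplicativity of symbols, and the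
  second, \<open>- i e\<close>, is all that survives in a commutator.\<close>

lemma coeff_monomial_product:
  fixes c c' :: "'k::field_char_0"
  defines "p \<equiv> \<lambda>i c d c' e. monom c d * shift i (monom c' e) :: 'k poly"
  shows "coeff (p i c d c' e) (d + e) = c * c'"
    and "d + e < n \<Longrightarrow> coeff (p i c d c' e) n = 0"
    and "d + e = Suc n \<Longrightarrow> coeff (p i c d c' e) n = - of_int (i * int e) * (c * c')"
proof -
  have co: "coeff (p i c d c' e) n = (if n < d then 0 else c * c' * coeff ([:- of_int i, 1:] ^ e) (n - d))" for n
    by (simp add: p_def shift_monom coeff_monom_mult)
  show "coeff (p i c d c' e) (d + e) = c * c'"
    unfolding co using coeff_linear_power(1)[of "- of_int i :: 'k" e] by simp
  show "coeff (p i c d c' e) n = 0" if "d + e < n"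
    unfolding co using coeff_linear_power(2)[of e "n - d" "- of_int i :: 'k"] that by simp
  show "coeff (p i c d c' e) n = - of_int (i * int e) * (c * c')" if "d + e = Suc n"
  proof (cases e)
    case 0
    then show ?thesis unfolding co using that by simp
  next
    case (Suc m)
    then have "n - d = m" "\<not> n < d" using that by auto
    moreover have "coeff ([:- of_int i, 1:] ^ Suc m) m = - (of_nat (Suc m) * of_int i :: 'k)"
      using coeff_linear_power(3)[of "- of_int i :: 'k" m] by simp
    ultimately have "coeff (p i c d c' e) n = c * c' * - (of_nat (Suc m) * of_int i)"
      unfolding co by (simp add: Suc del: power_Suc)
    then show ?thesis by (simp add: Suc)
  qed
qed

lemma symb_monomial_product:
  assumes N: "N > 0" and v: "N * int d + A * i \<le> v" and w: "N * int e + A * j \<le> w"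
  shows "symb N A (v + w) (homog (monom c d) i * homog (monom c' e) j)
       = symb N A v (homog (monom c d) i) * symb N A w (homog (monom c' e) j)"
    and "wle N A (v + w) (homog (monom c d) i * homog (monom c' e) j)"
proof -
  define p where "p = monom c d * shift i (monom c' e)"
  have prod: "homog (monom c d) i * homog (monom c' e) j = homog p (i + j)"
    by (simp add: p_def)
  have p0: "coeff p n = 0" if "d + e < n" for n
    using that by (simp add: p_def coeff_monomial_product)
  show "wle N A (v + w) (homog (monom c d) i * homog (monom c' e) j)"
    unfolding prod
  proof (rule wle_homog)
    fix n assume "coeff p n \<noteq> 0"
    then have "int n \<le> int d + int e" using p0[of n] by linarith
    then have "N * int n \<le> N * (int d + int e)" using N by simp
    then show "N * int n + A * (i + j) \<le> v + w" using v w by (simp add: algebra_simps)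
  qed
  show "symb N A (v + w) (homog (monom c d) i * homog (monom c' e) j)
       = symb N A v (homog (monom c d) i) * symb N A w (homog (monom c' e) j)"
  proof (cases "v = N * int d + A * i \<and> w = N * int e + A * j")
    case True
    then have "v + w - A * (i + j) = N * (int d + int e)" by (simp add: algebra_simps)
    moreover have "nat (int d + int e) = d + e" by simp
    ultimately have "symb N A (v + w) (homog p (i + j)) = lmono (coeff p (d + e)) (i + j)"
      using N by (simp add: symb_homog)
    then show ?thesis using True N
      by (simp add: prod symb_monomial lmono_mult p_def coeff_monomial_product)
  next
    case False
    have "symb N A (v + w) (homog p (i + j)) = 0"
    proof (rule ccontr)
      assume "symb N A (v + w) (homog p (i + j)) \<noteq> 0"
      then obtain n where "symb N A (v + w) (homog p (i + j)) $$ n \<noteq> 0"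
        using fls_eqI fls_zero_nth by metis
      then obtain m where "v + w = N * int m + A * n" "coeff (comp (homog p (i + j)) n) m \<noteq> 0"
        using N by (elim symb_nth_nonzeroE)
      then have m: "v + w = N * int m + A * (i + j)" "coeff p m \<noteq> 0"
        by (auto simp: comp_homog split: if_splits)
      have "N * int m > N * (int d + int e)" using m(1) v w False by (auto simp: algebra_simps)
      then have "m > d + e" using N by simp
      then show False using p0 m(2) by simp
    qed
    then show ?thesis using False N unfolding prod by (auto simp: symb_monomial)
  qed
qed

lemma symb_mult:
  assumes "N > 0" "wle N A v f" "wle N A w g"
  shows "symb N A (v + w) (f * g) = symb N A v f * symb N A w g \<and> wle N A (v + w) (f * g)"
  using assms(2)
proof (induction f rule: wle_induct)
  case (add c d i f)
  have "symb N A (v + w) (homog (monom c d) i * g) = symb N A v (homog (monom c d) i) * symb N A w g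
      \<and> wle N A (v + w) (homog (monom c d) i * g)"
    using assms(3)
  proof (induction g rule: wle_induct)
    case (add c' e j g)
    then show ?case using symb_monomial_product[OF assms(1), where c = c and c' = c'] add.hyps assms \<open>N * int d + A * i \<le> v\<close>
      by (simp add: distrib_left wle_add)
  qed simp
  with add show ?case by (simp add: distrib_right wle_add)
qed simp

lemma symb_monomial_commutator:
  fixes c c' :: "'k::field_char_0"
  assumes N: "N > 0" and v: "N * int d + A * i \<le> v" and w: "N * int e + A * j \<le> w"
  defines "f \<equiv> homog (monom c d) i" and "g \<equiv> homog (monom c' e) j"
  shows "of_int N * symb N A (v + w - N) (f * g - g * f)
       = of_int v * symb N A v f * euler (symb N A w g) - of_int w * symb N A w g * euler (symb N A v f)"
    and "wle N A (v + w - N) (f * g - g * f)"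
proof -
  define p where "p = monom c d * shift i (monom c' e)"
  define q where "q = monom c' e * shift j (monom c d)"
  have prod: "f * g - g * f = homog (p - q) (i + j)"
    by (rule skew_eqI) (simp add: f_def g_def p_def q_def comp_homog)
  have p0: "coeff (p - q) n = 0" if "d + e \<le> n" for n
  proof (cases "n = d + e")
    case True
    then show ?thesis using coeff_monomial_product(1)[of c d i c' e] coeff_monomial_product(1)[of c' e j c d]
      by (simp add: p_def q_def add.commute mult.commute)
  next
    case False
    with that have "d + e < n" "e + d < n" by auto
    then show ?thesis by (simp add: p_def q_def coeff_monomial_product)
  qed
  have key: "N * int n + A * (i + j) \<le> N * int d + A * i + (N * int e + A * j) - N" if "coeff (p - q) n \<noteq> 0" for n
  proof -
    have "int n \<le> int d + int e - 1" using p0[of n] that by linarith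
    then have "N * int n \<le> N * (int d + int e - 1)" using N by simp
    then show ?thesis by (simp add: algebra_simps)
  qed
  show "wle N A (v + w - N) (f * g - g * f)"
    unfolding prod using key v w by (intro wle_homog) force
  show "of_int N * symb N A (v + w - N) (f * g - g * f)
       = of_int v * symb N A v f * euler (symb N A w g) - of_int w * symb N A w g * euler (symb N A v f)"
  proof (cases "v = N * int d + A * i \<and> w = N * int e + A * j")
    case True
    have rhs: "of_int v * symb N A v f * euler (symb N A w g) - of_int w * symb N A w g * euler (symb N A v f)
        = of_int (v * j - w * i) * lmono (c * c') (i + j)"
      using True N by (simp add: f_def g_def symb_monomial euler_lmono lmono_mult[symmetric] algebra_simps)
    have vw: "v * j - w * i = N * (int d * j - int e * i)" using True by (simp add: algebra_simps)
    show ?thesis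
    proof (cases "d + e")
      case 0
      then have "d = 0" "e = 0" by auto
      then have "v + w - N - A * (i + j) < 0" using True N by (simp add: algebra_simps)
      then show ?thesis unfolding rhs vw using \<open>d = 0\<close> \<open>e = 0\<close> by (simp add: prod symb_homog)
    next
      case (Suc n)
      then have "int d + int e = int n + 1" by linarith
      then have "N * (int d + int e) = N * (int n + 1)" by simp
      then have "v + w - N - A * (i + j) = N * int n" using True by (simp add: algebra_simps)
      then have "symb N A (v + w - N) (f * g - g * f) = lmono (coeff (p - q) n) (i + j)"
        using N by (simp add: prod symb_homog)
      also have "coeff (p - q) n = of_int (int d * j - int e * i) * (c * c')"
        using coeff_monomial_product(3)[where d = d and e = e and n = n and i = i and c = c and c' = c']
          coeff_monomial_product(3)[where d = e and e = d and n = n and i = j and c = c' and c' = c] Suc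
        by (simp add: p_def q_def algebra_simps)
      also have "lmono \<dots> (i + j) = of_int (int d * j - int e * i) * lmono (c * c') (i + j)"
        by (rule fls_eqI) (simp add: lmono_nth fls_of_int)
      finally show ?thesis unfolding rhs vw by simp
    qed
  next
    case False
    have "symb N A (v + w - N) (homog (p - q) (i + j)) = 0"
    proof (rule ccontr)
      assume "symb N A (v + w - N) (homog (p - q) (i + j)) \<noteq> 0"
      then obtain n where "symb N A (v + w - N) (homog (p - q) (i + j)) $$ n \<noteq> 0"
        using fls_eqI fls_zero_nth by metis
      then obtain m where "v + w - N = N * int m + A * n" "coeff (comp (homog (p - q) (i + j)) n) m \<noteq> 0"
        using N by (elim symb_nth_nonzeroE)
      then have m: "v + w - N = N * int m + A * (i + j)" "coeff (p - q) m \<noteq> 0"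
        by (auto simp: comp_homog split: if_splits)
      then show False using key[OF m(2)] v w False by linarith
    qed
    then show ?thesis using False N unfolding prod by (auto simp: f_def g_def symb_monomial euler_simps)
  qed
qed

text \<open>For monomials of weights \<open>v\<close> and \<open>w\<close>, the coefficient \<open>d j - i e\<close> of the commutator satisfies
  \<open>N (d j - i e) = v j - w i\<close>; this identity turns the Poisson bracket of the leading parts into an
  expression that involves the two symbols and their weights only.\<close>

lemma symb_commutator:
  assumes "N > 0" "wle N A v f" "wle N A w g"
  shows "of_int N * symb N A (v + w - N) (f * g - g * f)
       = of_int v * symb N A v f * euler (symb N A w g) - of_int w * symb N A w g * euler (symb N A v f)
      \<and> wle N A (v + w - N) (f * g - g * f)"
  using assms(2)
proof (induction f rule: wle_induct)
  case (add c d i f)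
  let ?m = "homog (monom c d) i"
  have "of_int N * symb N A (v + w - N) (?m * g - g * ?m)
       = of_int v * symb N A v ?m * euler (symb N A w g) - of_int w * symb N A w g * euler (symb N A v ?m)
      \<and> wle N A (v + w - N) (?m * g - g * ?m)"
    using assms(3)
  proof (induction g rule: wle_induct)
    case (add c' e j g)
    define m where "m = ?m"
    define m' where "m' = homog (monom c' e) j"
    have split: "m * (m' + g) - (m' + g) * m = (m * m' - m' * m) + (m * g - g * m)"
      by (simp add: algebra_simps)
    show ?case unfolding m_def[symmetric] m'_def[symmetric] split
      using symb_monomial_commutator[OF assms(1) \<open>N * int d + A * i \<le> v\<close> add.hyps(1), of c c'] add.IH
      unfolding m_def[symmetric] m'_def[symmetric] symb_simps(2) euler_simps distrib_left distrib_right
      by (intro conjI wle_add) (simp_all add: algebra_simps)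
  qed (simp add: euler_simps)
  moreover have "(?m + f) * g - g * (?m + f) = (?m * g - g * ?m) + (f * g - g * f)"
    by (simp add: algebra_simps)
  ultimately show ?case using add.IH
    unfolding symb_simps(2) euler_simps distrib_left distrib_right
    by (simp only: wle_add) (simp add: algebra_simps)
qed (simp add: euler_simps)

section \<open>Laurent polynomials in one variable\<close>

lemma fls_times_nth_single:
  fixes p q :: "'k::field_char_0 fls"
  assumes "\<And>k. p $$ k \<noteq> 0 \<Longrightarrow> q $$ (n - k) \<noteq> 0 \<Longrightarrow> k = i"
  shows "(p * q) $$ n = p $$ i * q $$ (n - i)"
proof -
  let ?I = "{fls_subdegree p..n - fls_subdegree q}"
  have "(p * q) $$ n = (\<Sum>k\<in>?I. p $$ k * q $$ (n - k))"
    by (rule fls_times_nth(2))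
  also have "\<dots> = (\<Sum>k\<in>?I. if k = i then p $$ i * q $$ (n - i) else 0)"
    using assms by (intro sum.cong) auto
  also have "\<dots> = p $$ i * q $$ (n - i)"
    by (auto simp: fls_eq0_below_subdegree)
  finally show ?thesis .
qed

text \<open>Vanishing of the bracket means that \<open>q\<^sup>v\<close> and \<open>p\<^sup>w\<close> have the same logarithmic derivative.\<close>

definition bracket :: "int \<Rightarrow> int \<Rightarrow> 'k::field_char_0 fls \<Rightarrow> 'k fls \<Rightarrow> 'k fls"
  where "bracket v w p q = of_int v * p * euler q - of_int w * q * euler p"

lemma fls_times_top:
  fixes p q :: "'k::field_char_0 fls"
  assumes "\<And>n. n > i \<Longrightarrow> p $$ n = 0" "\<And>n. n > j \<Longrightarrow> q $$ n = 0"
  shows "(p * q) $$ (i + j) = p $$ i * q $$ j"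
proof -
  have "k = i" if "p $$ k \<noteq> 0" "q $$ (i + j - k) \<noteq> 0" for k
    using assms(1)[of k] assms(2)[of "i + j - k"] that by (metis diff_less_eq not_less_iff_gr_or_eq add.commute less_diff_eq)
  then show ?thesis using fls_times_nth_single[of p q "i + j" i] by simp
qed

lemma fls_times_bottom:
  fixes p q :: "'k::field_char_0 fls"
  assumes "\<And>n. n < i \<Longrightarrow> p $$ n = 0" "\<And>n. n < j \<Longrightarrow> q $$ n = 0"
  shows "(p * q) $$ (i + j) = p $$ i * q $$ j"
proof -
  have "k = i" if "p $$ k \<noteq> 0" "q $$ (i + j - k) \<noteq> 0" for k
    using assms(1)[of k] assms(2)[of "i + j - k"] that by (metis diff_less_eq not_less_iff_gr_or_eq add.commute less_diff_eq)
  then show ?thesis using fls_times_nth_single[of p q "i + j" i] by simp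
qed

lemma bracket_nth:
  assumes "(p * euler q) $$ (i + j) = p $$ i * euler q $$ j" "(q * euler p) $$ (j + i) = q $$ j * euler p $$ i"
  shows "bracket v w p q $$ (i + j) = of_int (v * j - w * i) * (p $$ i * q $$ j)"
  using assms by (simp add: bracket_def mult.assoc) (simp add: euler_nth algebra_simps)

lemma bracket_top:
  assumes "\<And>n. n > i \<Longrightarrow> p $$ n = 0" "\<And>n. n > j \<Longrightarrow> q $$ n = 0"
  shows "bracket v w p q $$ (i + j) = of_int (v * j - w * i) * (p $$ i * q $$ j)"
  by (intro bracket_nth fls_times_top) (simp_all add: assms euler_nth)

lemma bracket_bottom:
  assumes "\<And>n. n < i \<Longrightarrow> p $$ n = 0" "\<And>n. n < j \<Longrightarrow> q $$ n = 0"
  shows "bracket v w p q $$ (i + j) = of_int (v * j - w * i) * (p $$ i * q $$ j)"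
  by (intro bracket_nth fls_times_bottom) (simp_all add: assms euler_nth)

lemma euler_eq_0: "euler w = 0 \<Longrightarrow> \<exists>c. w = fls_const c"
  by (metis euler_def fls_deriv_eq_0_iff fls_X_nonzero mult_eq_0_iff)

text \<open>The quotient has derivative zero, and the characteristic is zero.\<close>

lemma proportional_if_log_derivatives_agree:
  fixes p q :: "'k::field_char_0 fls"
  assumes "p * euler q = q * euler p" "q \<noteq> 0"
  shows "\<exists>c. p = fls_const c * q"
proof -
  define w where "w = p / q"
  have p: "p = w * q" using assms(2) by (simp add: w_def)
  have "q * q * euler w = 0"
    using assms(1) unfolding p by (simp add: euler_simps algebra_simps)
  then show ?thesis using p assms(2) euler_eq_0[of w] by auto
qed

lemma bracket_power:
  assumes "bracket v w p q = 0"
  shows "bracket v (int n * w) p (q ^ n) = 0"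
proof (cases n)
  case (Suc m)
  have "euler (q ^ Suc m) = of_nat (Suc m) * q ^ m * euler q"
    by (induction m) (simp_all add: euler_simps algebra_simps)
  then have "bracket v (int n * w) p (q ^ n) = of_nat (Suc m) * q ^ m * bracket v w p q"
    by (simp add: Suc bracket_def algebra_simps)
  then show ?thesis using assms by simp
qed (simp add: bracket_def euler_simps)

lemma bracket_mult:
  assumes "bracket v w p q = 0" "bracket v w' p q' = 0"
  shows "bracket v (w + w') p (q * q') = 0"
proof -
  have "bracket v (w + w') p (q * q') = q' * bracket v w p q + q * bracket v w' p q'"
    by (simp add: bracket_def euler_simps algebra_simps)
  then show ?thesis using assms by simp
qed

lemma bracket_proportional:
  assumes "bracket v w p q = 0" "bracket v w p q' = 0" "v \<noteq> 0" "p \<noteq> 0" "q' \<noteq> 0"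
  shows "\<exists>c. q = fls_const c * q'"
proof (rule proportional_if_log_derivatives_agree)
  have "of_int v * p * (q * euler q' - q' * euler q) = q * bracket v w p q' - q' * bracket v w p q"
    by (simp add: bracket_def algebra_simps)
  then show "q * euler q' = q' * euler q" using assms by simp
qed (use assms in auto)

text \<open>The Laurent polynomial \<open>u\<^sup>i p(u)\<close>. Splitting off a power of \<open>u\<close> gives access to roots and multiplicities.\<close>

definition lau :: "int \<Rightarrow> 'k::field_char_0 poly \<Rightarrow> 'k fls"
  where "lau i p = fls_X_intpow i * fps_to_fls (fps_of_poly p)"

lemma lau_nth: "lau i p $$ n = (if n < i then 0 else coeff p (nat (n - i)))"
  by (simp add: lau_def fls_X_intpow_times_conv_shift)

lemma lau_eq_iff [simp]: "lau i p = lau i q \<longleftrightarrow> p = q"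
  by (auto simp: lau_def)

lemma lau_mult: "lau i p * lau j q = lau (i + j) (p * q)"
proof -
  have "lau i p * lau j q = (fls_X_intpow i * fls_X_intpow j) * (fps_to_fls (fps_of_poly p) * fps_to_fls (fps_of_poly q))"
    by (simp add: lau_def algebra_simps)
  then show ?thesis
    by (simp add: lau_def fls_X_intpow_times_fls_X_intpow fls_times_fps_to_fls fps_of_poly_mult)
qed

lemma lau_diff: "lau i p - lau i q = lau i (p - q)"
  by (rule fls_eqI) (simp add: lau_nth)

lemma lau_of_int: "of_int c * lau i p = lau i (smult (of_int c) p)"
  by (rule fls_eqI) (simp add: lau_nth)

text \<open>The effect of \<open>u d/du\<close> on \<open>p\<close> in \<open>u\<^sup>i p(u)\<close>.\<close>

definition peuler :: "int \<Rightarrow> 'k::field_char_0 poly \<Rightarrow> 'k poly"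
  where "peuler i p = smult (of_int i) p + pCons 0 (pderiv p)"

lemma coeff_peuler: "coeff (peuler i p) n = of_int (i + int n) * coeff p n"
  by (cases n) (simp_all add: peuler_def coeff_pderiv algebra_simps)

lemma euler_lau: "euler (lau i p) = lau i (peuler i p)"
  by (rule fls_eqI) (auto simp: lau_nth euler_nth coeff_peuler)

lemma lau_exists:
  fixes p :: "'k::field_char_0 fls"
  assumes "p \<noteq> 0" "finite {n. p $$ n \<noteq> 0}"
  obtains i b where "p = lau i b" "coeff b 0 \<noteq> 0"
proof -
  define i where "i = fls_subdegree p"
  define b where "b = Abs_poly (\<lambda>k. p $$ (i + int k))"
  have "finite {k. p $$ (i + int k) \<noteq> 0}"
    by (rule finite_subset[OF _ finite_vimageI[OF assms(2), of "\<lambda>k. i + int k"]])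
      (auto simp: inj_on_def)
  then have b: "coeff b k = p $$ (i + int k)" for k
    by (simp add: b_def Abs_poly_inverse MOST_iff_cofinite)
  have "p = lau i b"
    by (rule fls_eqI) (auto simp: lau_nth b i_def)
  moreover have "coeff b 0 \<noteq> 0" using assms(1) by (simp add: b i_def nth_fls_subdegree_nonzero)
  ultimately show ?thesis using that by blast
qed

lemma lau_support_card:
  "card {n. lau i b $$ n \<noteq> 0} = card {n. coeff b n \<noteq> 0}"
proof -
  have "{n. lau i b $$ n \<noteq> 0} = (\<lambda>n. i + int n) ` {n. coeff b n \<noteq> 0}"
  proof (intro equalityI subsetI)
    fix n assume "n \<in> {n. lau i b $$ n \<noteq> 0}"
    then have "coeff b (nat (n - i)) \<noteq> 0" "n = i + int (nat (n - i))"
      by (auto simp: lau_nth split: if_splits)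
    then show "n \<in> (\<lambda>n. i + int n) ` {n. coeff b n \<noteq> 0}" by blast
  qed (auto simp: lau_nth)
  then show ?thesis by (simp add: card_image inj_on_def)
qed

section \<open>Multiplicities of roots\<close>

text \<open>Dividing by a power of the variable and differentiating removes one term and lowers the multiplicity of a
  nonzero root by one.\<close>

lemma order_less_terms:
  fixes p :: "'k::field_char_0 poly"
  assumes "p \<noteq> 0" "x \<noteq> 0"
  shows "order x p < card {n. coeff p n \<noteq> 0}"
  using assms(1)
proof (induction "degree p" arbitrary: p rule: less_induct)
  case less
  have fin: "finite {n. coeff q n \<noteq> 0}" for q :: "'k poly"
    using MOST_coeff_eq_0[of q] by (simp add: eventually_cofinite)
  show ?case
  proof (cases "coeff p 0 = 0")
    case True
    then obtain q where p: "p = pCons 0 q" by (cases p) auto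
    then have q: "q \<noteq> 0" "degree q < degree p" using less.prems by auto
    have "p = [:0, 1:] * q" by (simp add: p)
    then have "order x p = order x [:0, 1:] + order x q"
      using less.prems order_mult by metis
    moreover have "order x [:0, 1:] = 0" using assms(2) by (intro order_0I) simp
    moreover have "{n. coeff p n \<noteq> 0} = Suc ` {n. coeff q n \<noteq> 0}"
    proof (intro equalityI subsetI)
      fix n assume "n \<in> {n. coeff p n \<noteq> 0}"
      then show "n \<in> Suc ` {n. coeff q n \<noteq> 0}" by (cases n) (auto simp: p)
    qed (auto simp: p)
    ultimately show ?thesis using less.hyps[OF q(2,1)] by (simp add: card_image)
  next
    case False
    show ?thesis
    proof (cases "order x p = 0 \<or> pderiv p = 0")
      case True
      have "order x p = 0"
      proof (rule ccontr)
        assume *: "order x p \<noteq> 0"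
        with True have "degree p = 0" by (simp add: pderiv_eq_0_iff)
        then show False using * order_degree[OF less.prems, of x] by simp
      qed
      moreover have "card {n. coeff p n \<noteq> 0} > 0" using False fin by (auto simp: card_gt_0_iff)
      ultimately show ?thesis by simp
    next
      case False': False
      have deg: "degree (pderiv p) < degree p"
        using False' by (metis degree_pderiv pderiv_eq_0_iff diff_less zero_less_one bot_nat_0.not_eq_extremum)
      have "{n. coeff p n \<noteq> 0} = insert 0 (Suc ` {n. coeff (pderiv p) n \<noteq> 0})"
      proof (intro equalityI subsetI)
        fix n assume "n \<in> {n. coeff p n \<noteq> 0}"
        then show "n \<in> insert 0 (Suc ` {n. coeff (pderiv p) n \<noteq> 0})"
          by (cases n) (auto simp: coeff_pderiv simp del: of_nat_Suc)
      qed (use False in \<open>auto simp: coeff_pderiv\<close>)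
      then have "card {n. coeff p n \<noteq> 0} = Suc (card {n. coeff (pderiv p) n \<noteq> 0})"
        using fin by (simp add: card_image)
      moreover have "order x p = Suc (order x (pderiv p))"
        using False' less.prems by (intro order_pderiv) (auto simp: order_root)
      ultimately show ?thesis using less.hyps[OF deg] False' by simp
    qed
  qed
qed

lemma degree_le_if_orders_le:
  fixes p q :: "'k::alg_closed_field poly"
  assumes "q \<noteq> 0" "p \<noteq> 0" "\<And>x. order x p \<le> order x q"
  shows "degree p \<le> degree q"
  using assms
proof (induction "degree p" arbitrary: p q)
  case (Suc n)
  obtain x where x: "poly p x = 0"
    using alg_closed_imp_poly_has_root[of p] Suc.hyps(2) by auto
  then have "order x p \<noteq> 0" using Suc.prems(2) by (simp add: order_root)
  then have "order x q \<noteq> 0" using Suc.prems(3)[of x] by linarith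
  then have "poly q x = 0" by (simp add: order_root)
  with x obtain p1 q1 where pq: "p = [:-x, 1:] * p1" "q = [:-x, 1:] * q1"
    by (metis poly_eq_0_iff_dvd dvdE)
  then have nz: "p1 \<noteq> 0" "q1 \<noteq> 0" using Suc.prems by auto
  have deg: "degree p = Suc (degree p1)" "degree q = Suc (degree q1)"
    using degree_mult_eq[of "[:-x, 1:]" p1] degree_mult_eq[of "[:-x, 1:]" q1] nz
    unfolding pq by simp_all
  have "order y p1 \<le> order y q1" for y
    using Suc.prems(3)[of y] order_mult[of "[:-x, 1:]" p1 y] order_mult[of "[:-x, 1:]" q1 y] nz pq
    by (auto simp del: mult_pCons_left)
  from Suc.hyps(1)[OF _ nz(2,1) this] deg Suc.hyps(2) show ?case by simp
qed simp

text \<open>Multiplying by the linear factor avoids the exponent \<open>m - 1\<close>, and with it the case \<open>m = 0\<close>.\<close>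

lemma peuler_at_root:
  fixes p1 :: "'k::field_char_0 poly"
  assumes "p = [:-x, 1:] ^ m * p1"
  obtains E where "[:-x, 1:] * peuler i p = [:-x, 1:] ^ m * E" "poly E x = x * of_nat m * poly p1 x"
proof -
  define l where "l = [:-x, 1:]"
  define E where "E = [:0, of_nat m:] * p1 + l * peuler i p1"
  have deriv: "l * pderiv (l ^ m) = of_nat m * l ^ m"
  proof (cases m)
    case (Suc n)
    have "pderiv l = 1" by (simp add: l_def pderiv_pCons)
    then show ?thesis unfolding Suc pderiv_power_Suc by (simp add: of_nat_poly)
  qed simp
  define u where "u = [:0, 1 :: 'k:]"
  have pe: "peuler i q = smult (of_int i) q + u * pderiv q" for q
    by (simp add: peuler_def u_def)
  have n: "[:0, of_nat m:] = u * of_nat m" by (simp add: u_def of_nat_poly)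
  have "l * peuler i p = smult (of_int i) (l * l ^ m * p1)
     + u * (l * pderiv (l ^ m) * p1 + l * l ^ m * pderiv p1)"
    unfolding pe assms l_def[symmetric] pderiv_mult by (simp add: algebra_simps)
  also have "\<dots> = l ^ m * E"
    unfolding E_def pe n deriv by (simp add: algebra_simps)
  finally have "l * peuler i p = l ^ m * E" .
  moreover have "poly E x = x * of_nat m * poly p1 x" by (simp add: E_def l_def)
  ultimately show ?thesis using that unfolding l_def by blast
qed

lemma root_decomp:
  fixes p :: "'k::field_char_0 poly"
  assumes "p \<noteq> 0"
  obtains p1 where "p = [:-x, 1:] ^ order x p * p1" "poly p1 x \<noteq> 0"
  using order_decomp[OF assms, of x] by (auto simp: poly_eq_0_iff_dvd)

text \<open>Logarithmic derivatives have simple poles with the multiplicities as residues.\<close>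

lemma order_relation:
  fixes p q :: "'k::field_char_0 poly"
  assumes "smult (of_int v) (p * peuler j q) = smult (of_int w) (q * peuler i p)"
    and "p \<noteq> 0" "q \<noteq> 0" "x \<noteq> 0"
  shows "v * int (order x q) = w * int (order x p)"
proof -
  define l where "l = [:-x, 1:]"
  let ?m = "order x p" and ?n = "order x q"
  obtain p1 where p1: "p = l ^ ?m * p1" "poly p1 x \<noteq> 0" using root_decomp assms(2) unfolding l_def by metis
  obtain q1 where q1: "q = l ^ ?n * q1" "poly q1 x \<noteq> 0" using root_decomp assms(3) unfolding l_def by metis
  obtain E where E: "l * peuler i p = l ^ ?m * E" "poly E x = x * of_nat ?m * poly p1 x"
    using peuler_at_root[OF p1(1)[unfolded l_def]] unfolding l_def by metis
  obtain F where F: "l * peuler j q = l ^ ?n * F" "poly F x = x * of_nat ?n * poly q1 x"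
    using peuler_at_root[OF q1(1)[unfolded l_def]] unfolding l_def by metis
  have "l ^ (?m + ?n) * smult (of_int v) (p1 * F) = smult (of_int v) ((l ^ ?m * p1) * (l ^ ?n * F))"
    by (simp add: power_add algebra_simps)
  also have "\<dots> = l * smult (of_int v) (p * peuler j q)"
    unfolding p1(1)[symmetric] F(1)[symmetric] by (simp add: algebra_simps)
  also have "\<dots> = smult (of_int w) ((l ^ ?n * q1) * (l ^ ?m * E))"
    unfolding assms(1) q1(1)[symmetric] E(1)[symmetric] by (simp add: algebra_simps)
  also have "\<dots> = l ^ (?m + ?n) * smult (of_int w) (q1 * E)"
    by (simp add: power_add algebra_simps)
  finally have eq: "l ^ (?m + ?n) * smult (of_int v) (p1 * F) = l ^ (?m + ?n) * smult (of_int w) (q1 * E)" .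
  have l0: "l ^ (?m + ?n) \<noteq> 0" by (simp add: l_def)
  from eq have "smult (of_int v) (p1 * F) = smult (of_int w) (q1 * E)"
    using l0 unfolding mult_smult_right by (metis mult_left_cancel mult_smult_right)
  then have "poly (smult (of_int v) (p1 * F)) x = poly (smult (of_int w) (q1 * E)) x" by simp
  then have "(x * poly p1 x * poly q1 x) * of_int (v * int ?n) = (x * poly p1 x * poly q1 x) * of_int (w * int ?m)"
    by (simp add: E F algebra_simps)
  then have "(of_int (v * int ?n) :: 'k) = of_int (w * int ?m)" using p1 q1 assms(4) by simp
  then show ?thesis by (simp only: of_int_eq_iff)
qed

text \<open>The derivative lowers the sum of the multiplicities of \<open>p\<close> and \<open>T\<close> by one, unless the leading coefficients
  at the root cancel, which happens exactly if \<open>v n = t m\<close>.\<close>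

lemma order_inhomogeneous:
  fixes p T G :: "'k::field_char_0 poly"
  assumes eq: "smult (of_int v) (p * peuler e T) - smult (of_int t) (T * peuler f p) = smult (of_int N) G"
    and "p \<noteq> 0" "T \<noteq> 0" "G \<noteq> 0" "x \<noteq> 0" "N \<noteq> 0"
  defines "m \<equiv> order x p" and "n \<equiv> order x T"
  shows "v * int n \<noteq> t * int m \<Longrightarrow> Suc (order x G) = m + n"
    and "v * int n = t * int m \<Longrightarrow> m + n \<le> order x G"
proof -
  define l where "l = [:-x, 1:]"
  obtain p1 where p1: "p = l ^ m * p1" "poly p1 x \<noteq> 0" using root_decomp assms(2) unfolding l_def m_def by metis
  obtain T1 where T1: "T = l ^ n * T1" "poly T1 x \<noteq> 0" using root_decomp assms(3) unfolding l_def n_def by metis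
  obtain E where E: "l * peuler f p = l ^ m * E" "poly E x = x * of_nat m * poly p1 x"
    using peuler_at_root[OF p1(1)[unfolded l_def]] unfolding l_def by metis
  obtain F where F: "l * peuler e T = l ^ n * F" "poly F x = x * of_nat n * poly T1 x"
    using peuler_at_root[OF T1(1)[unfolded l_def]] unfolding l_def by metis
  define K where "K = smult (of_int v) (p1 * F) - smult (of_int t) (T1 * E)"
  have "l ^ (m + n) * K = smult (of_int v) ((l ^ m * p1) * (l ^ n * F)) - smult (of_int t) ((l ^ n * T1) * (l ^ m * E))"
    by (simp add: K_def power_add algebra_simps)
  also have "\<dots> = l * (smult (of_int v) (p * peuler e T) - smult (of_int t) (T * peuler f p))"
    unfolding p1(1)[symmetric] T1(1)[symmetric] E(1)[symmetric] F(1)[symmetric] by (simp add: algebra_simps)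
  finally have K: "l ^ (m + n) * K = l * smult (of_int N) G" unfolding eq .
  have l0: "l \<noteq> 0" by (simp add: l_def)
  have NG: "smult (of_int N) G \<noteq> 0" using \<open>G \<noteq> 0\<close> \<open>N \<noteq> 0\<close> by simp
  have ordl: "order x l = 1" "order x (l ^ k) = k" for k
    using order_power_n_n[of x 1] order_power_n_n[of x k] by (simp_all add: l_def)
  have ordG: "order x (smult (of_int N) G) = order x G"
    using \<open>N \<noteq> 0\<close> by (simp add: order_smult)
  have Kx: "poly K x = x * poly p1 x * poly T1 x * of_int (v * int n - t * int m)"
    by (simp add: K_def E F algebra_simps)
  show "Suc (order x G) = m + n" if "v * int n \<noteq> t * int m"
  proof -
    have "of_int (v * int n - t * int m) \<noteq> (0 :: 'k)" using that by (simp only: of_int_eq_0_iff)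
    then have "poly K x \<noteq> 0" unfolding Kx using p1(2) T1(2) \<open>x \<noteq> 0\<close> by simp
    then have "K \<noteq> 0" "order x K = 0" by (auto simp: order_0I)
    then have "order x (l ^ (m + n) * K) = m + n"
      using l0 ordl by (subst order_mult) auto
    moreover have "order x (l * smult (of_int N) G) = Suc (order x G)"
      using l0 NG ordl ordG by (subst order_mult) auto
    ultimately show ?thesis using K by simp
  qed
  show "m + n \<le> order x G" if "v * int n = t * int m"
  proof -
    have "poly K x = 0" unfolding Kx using that by simp
    then obtain K' where "K = l * K'" unfolding l_def by (metis poly_eq_0_iff_dvd dvdE)
    then have "l * (l ^ (m + n) * K') = l * smult (of_int N) G" using K by (simp add: algebra_simps)
    then have "l ^ (m + n) * K' = smult (of_int N) G" using l0 by (metis mult_left_cancel)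
    then have "l ^ (m + n) dvd smult (of_int N) G" by (metis dvd_triv_left)
    then show ?thesis using NG ordG order_divides[of x "m + n" "smult (of_int N) G"] by (simp add: l_def)
  qed
qed

lemma order_power:
  fixes p :: "'k::idom poly"
  shows "p \<noteq> 0 \<Longrightarrow> order x (p ^ n) = n * order x p"
  by (induction n) (simp_all add: order_mult)

lemma coeff_top:
  fixes p T :: "'k::field_char_0 poly"
  shows "coeff (p * peuler e T) (degree p + degree T)
    = of_int (e + int (degree T)) * (lead_coeff p * lead_coeff T)"
    and "degree (p * peuler e T) \<le> degree p + degree T"
proof -
  have "degree (peuler e T) \<le> degree T"
    by (rule degree_le) (simp add: coeff_peuler coeff_eq_0)
  then show "degree (p * peuler e T) \<le> degree p + degree T"
    by (meson add_left_mono degree_mult_le order_trans)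
  show "coeff (p * peuler e T) (degree p + degree T)
    = of_int (e + int (degree T)) * (lead_coeff p * lead_coeff T)"
    using coeff_mult_degree_sum[of p "peuler e T"] \<open>degree (peuler e T) \<le> degree T\<close>
  proof (cases "degree (peuler e T) = degree T")
    case False
    then have "degree (peuler e T) < degree T" using \<open>degree (peuler e T) \<le> degree T\<close> by simp
    then have z: "coeff (peuler e T) (degree T) = 0" by (rule coeff_eq_0)
    have "degree (p * peuler e T) < degree p + degree T \<or> degree p + degree T = 0"
      using \<open>degree (peuler e T) < degree T\<close> by (metis add_less_cancel_left degree_mult_le le_less_trans)
    then have "coeff (p * peuler e T) (degree p + degree T) = 0"
      using \<open>degree (peuler e T) < degree T\<close> by (auto simp: coeff_eq_0)
    then show ?thesis using z by (auto simp: coeff_peuler)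
  qed (simp add: coeff_peuler algebra_simps)
qed

text \<open>At a root of \<open>p\<close> the case \<open>v n = t a\<close> is impossible, since it makes the multiplicity of \<open>G\<close> larger than
  the relation between \<open>G\<close> and \<open>p\<close> permits; therefore \<open>v n = v + a (t - N)\<close> and in particular \<open>v \<noteq> a N\<close>.
  Summation over the roots of \<open>p\<close> bounds the degree of \<open>T\<close> from below. The relations at the highest and at
  the lowest exponents bound it from above by \<open>t deg p / v\<close>, because these exponents of \<open>p\<close> have
  opposite signs. Together the bounds give \<open>v \<le> a N\<close>.\<close>

lemma weight_bound_core:
  fixes p T G :: "'k::{alg_closed_field,field_char_0} poly" and v t N e f :: int
  assumes N: "N > 0" and v: "v > 0"
    and i: "smult (of_int v) (p * peuler e T) - smult (of_int t) (T * peuler f p) = smult (of_int N) G"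
    and ii: "smult (of_int v) (p * peuler (e + f) G) = smult (of_int (v + t - N)) (G * peuler f p)"
    and p0: "coeff p 0 \<noteq> 0" and T0: "coeff T 0 \<noteq> 0" and G: "G \<noteq> 0"
    and f: "f < 0" "f + int (degree p) > 0"
    and roots: "\<And>x. poly p x = 0 \<Longrightarrow> order x p = a"
  shows "v < int a * N"
proof -
  have nz: "p \<noteq> 0" "T \<noteq> 0" using p0 T0 by auto
  have xnz: "x \<noteq> 0" if "poly p x = 0" for x using that p0 by (auto simp: poly_0_coeff_0)
  have local: "v * int (order x T) = v + int a * (t - N) \<and> v \<noteq> int a * N \<and> a > 0"
    if x: "poly p x = 0" for x
  proof -
    let ?n = "order x T" and ?g = "order x G"
    have g: "v * int ?g = (v + t - N) * int a"
      using order_relation[OF ii nz(1) G xnz[OF x]] roots[OF x] by simp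
    have a: "a > 0" using roots[OF x] x nz order_root by (metis gr0I)
    have ne: "v * int ?n \<noteq> t * int a"
    proof
      assume *: "v * int ?n = t * int a"
      then have "a + ?n \<le> ?g"
        using order_inhomogeneous(2)[OF i nz G xnz[OF x]] N roots[OF x] by simp
      then have "v * (int a + int ?n) \<le> v * int ?g" using v by (intro mult_left_mono) auto
      then have "N * int a \<le> 0" using * g by (simp add: algebra_simps)
      then show False using N a by (simp add: mult_le_0_iff)
    qed
    then have "Suc ?g = a + ?n"
      using order_inhomogeneous(1)[OF i nz G xnz[OF x]] N roots[OF x] by simp
    then have "v * (int ?g + 1) = v * (int a + int ?n)" by (metis of_nat_Suc of_nat_add add.commute)
    then have n: "v * int ?n = v + int a * (t - N)" using g by (simp add: algebra_simps)
    have "v \<noteq> int a * N"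
    proof
      assume "v = int a * N"
      then have "v * int ?n = int a * t" using n by (simp add: algebra_simps)
      then show False using ne by simp
    qed
    then show ?thesis using n a by blast
  qed
  obtain x0 where x0: "poly p x0 = 0"
    using alg_closed_imp_poly_has_root[of p] f by auto
  define \<tau> where "\<tau> = order x0 T"
  have \<tau>: "order x T = \<tau>" if "poly p x = 0" for x
  proof -
    have "v * int (order x T) = v * int \<tau>" using local[OF that] local[OF x0] by (simp add: \<tau>_def)
    then show ?thesis using v by simp
  qed
  have "degree (p ^ \<tau>) \<le> degree (T ^ a)"
  proof (rule degree_le_if_orders_le)
    fix x show "order x (p ^ \<tau>) \<le> order x (T ^ a)"
    proof (cases "poly p x = 0")
      case True
      then show ?thesis using roots \<tau> nz by (simp add: order_power)
    next
      case False
      then show ?thesis using nz by (simp add: order_power order_0I)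
    qed
  qed (use nz in auto)
  then have "\<tau> * degree p \<le> a * degree T" using nz by (simp add: degree_power_eq)
  then have "int \<tau> * int (degree p) \<le> int a * int (degree T)" by (metis of_nat_le_iff of_nat_mult)
  then have 1: "v * (int \<tau> * int (degree p)) \<le> v * (int a * int (degree T))" using v by (simp add: mult_left_mono)
  define s where "s = f + int (degree p)"
  have top: "v * (e + int (degree T)) \<le> s * t"
  proof (cases "v * (e + int (degree T)) = t * s")
    case False
    have "of_int N * coeff G (degree p + degree T)
        = of_int (v * (e + int (degree T)) - t * s) * (lead_coeff p * lead_coeff T)"
      using arg_cong[OF i, of "\<lambda>q. coeff q (degree p + degree T)"] coeff_top(1)[of p e T] coeff_top(1)[of T f p]
      by (simp add: s_def algebra_simps)
    moreover have "of_int (v * (e + int (degree T)) - t * s) \<noteq> (0 :: 'k)"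
      using False by (simp only: of_int_eq_0_iff)
    ultimately have c: "coeff G (degree p + degree T) \<noteq> 0" using nz by auto
    have "degree (smult (of_int N) G) \<le> degree p + degree T"
      unfolding i[symmetric] using coeff_top(2)[of p e T] coeff_top(2)[of T f p]
      by (intro degree_diff_le) (auto simp: add.commute intro: order_trans[OF degree_smult_le])
    then have dG: "degree G = degree p + degree T"
      using c N by (simp add: le_degree le_antisym)
    have "of_int (v * (e + f + int (degree G))) * (lead_coeff p * lead_coeff G)
        = of_int ((v + t - N) * s) * (lead_coeff p * lead_coeff G)"
      using arg_cong[OF ii, of "\<lambda>q. coeff q (degree p + degree G)"] coeff_top(1)[of p "e + f" G] coeff_top(1)[of G f p]
      by (simp add: s_def algebra_simps)
    then have "(of_int (v * (e + f + int (degree G))) :: 'k) = of_int ((v + t - N) * s)"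
      using nz G by simp
    then have "v * (e + f + int (degree G)) = (v + t - N) * s" by (simp only: of_int_eq_iff)
    then have "v * (e + int (degree T)) = (t - N) * s" by (simp add: dG s_def algebra_simps)
    moreover have "N * s \<ge> 0" using N f by (simp add: s_def)
    ultimately show ?thesis by (simp add: algebra_simps)
  qed (simp add: mult.commute)
  have bottom: "v * e \<ge> f * t"
  proof (cases "v * e = t * f")
    case False
    have "of_int N * coeff G 0 = of_int (v * e - t * f) * (coeff p 0 * coeff T 0)"
      using arg_cong[OF i, of "\<lambda>q. coeff q 0"]
      by (simp add: coeff_mult_0 coeff_peuler algebra_simps)
    moreover have "of_int (v * e - t * f) \<noteq> (0 :: 'k)" using False by (simp only: of_int_eq_0_iff)
    ultimately have c: "coeff G 0 \<noteq> 0" using p0 T0 by auto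
    have "of_int (v * (e + f)) * (coeff p 0 * coeff G 0) = of_int ((v + t - N) * f) * (coeff p 0 * coeff G 0)"
      using arg_cong[OF ii, of "\<lambda>q. coeff q 0"]
      by (simp add: coeff_mult_0 coeff_peuler algebra_simps)
    then have "(of_int (v * (e + f)) :: 'k) = of_int ((v + t - N) * f)" using c p0 by simp
    then have "v * (e + f) = (v + t - N) * f" by (simp only: of_int_eq_iff)
    moreover have "N * f \<le> 0" using N f by (simp add: mult_le_0_iff)
    ultimately show ?thesis by (simp add: algebra_simps)
  qed (simp add: mult.commute)
  have "v * int (degree T) \<le> t * int (degree p)" using top bottom by (simp add: s_def algebra_simps)
  then have "int a * (v * int (degree T)) \<le> int a * (t * int (degree p))" by (simp add: mult_left_mono)
  with 1 have "(v * int \<tau>) * int (degree p) \<le> (int a * t) * int (degree p)" by (simp add: algebra_simps)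
  moreover have "degree p > 0" using f by simp
  ultimately have "v * int \<tau> \<le> int a * t" by simp
  then have "v \<le> int a * N" using local[OF x0] by (simp add: \<tau>_def algebra_simps)
  then show ?thesis using local[OF x0] by simp
qed

section \<open>Passing to the algebraic closure\<close>

abbreviation acp :: "'k::field_char_0 poly \<Rightarrow> 'k alg_closure poly"
  where "acp \<equiv> map_poly to_ac"

lemma acp_simps: fixes p q :: "'k::field_char_0 poly" shows "coeff (acp p) n = to_ac (coeff p n)" "acp (p + q) = acp p + acp q"
  "acp (p - q) = acp p - acp q" "acp (p * q) = acp p * acp q" "acp (smult c p) = smult (to_ac c) (acp p)"
  "acp p = 0 \<longleftrightarrow> p = 0" "acp (peuler i p) = peuler i (acp p)" "degree (acp p) = degree p"
proof -
  have c: "coeff (acp p) n = to_ac (coeff p n)" for p :: "'k poly" and n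
    by (simp add: coeff_map_poly)
  show "coeff (acp p) n = to_ac (coeff p n)" by (rule c)
  show "acp (p + q) = acp p + acp q" "acp (p - q) = acp p - acp q" "acp (smult c p) = smult (to_ac c) (acp p)"
    "acp (peuler i p) = peuler i (acp p)" "acp (p * q) = acp p * acp q"
    by (rule poly_eqI, simp add: c coeff_peuler coeff_mult to_ac_sum)+
  show "acp p = 0 \<longleftrightarrow> p = 0" by (simp add: poly_eq_iff c)
  show "degree (acp p) = degree p" by (rule degree_map_poly) simp
qed

lemma bracket_lau: "bracket v w (lau i p) (lau j q)
    = lau (i + j) (smult (of_int v) (p * peuler j q) - smult (of_int w) (q * peuler i p))"
proof -
  have "bracket v w (lau i p) (lau j q)
      = of_int v * lau (i + j) (p * peuler j q) - of_int w * lau (j + i) (q * peuler i p)"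
    by (simp add: bracket_def euler_lau lau_mult mult.assoc)
  then show ?thesis by (simp add: lau_of_int lau_diff add.commute)
qed

lemma root_orders_proportional:
  assumes "bracket v w (lau i p) (lau j q) = 0" "p \<noteq> 0" "q \<noteq> 0" "x \<noteq> 0"
  shows "v * int (order x (acp q)) = w * int (order x (acp p))"
proof (rule order_relation)
  have "lau (i + j) (smult (of_int v) (p * peuler j q) - smult (of_int w) (q * peuler i p)) = lau (i + j) 0"
    using assms(1) unfolding bracket_lau by (simp add: lau_def)
  then have "smult (of_int v) (p * peuler j q) = smult (of_int w) (q * peuler i p)" by simp
  then have "acp (smult (of_int v) (p * peuler j q)) = acp (smult (of_int w) (q * peuler i p))" by simp
  then show "smult (of_int v) (acp p * peuler j (acp q)) = smult (of_int w) (acp q * peuler i (acp p))"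
    by (simp add: acp_simps)
qed (use assms in \<open>auto simp: acp_simps\<close>)

lemma weight_bound:
  fixes p T :: "'k::field_char_0 poly"
  assumes "N > 0" "v > 0"
    and eq: "bracket v t (lau f p) (lau e T) = of_int N * G" and rel: "bracket v (v + t - N) (lau f p) G = 0"
    and "G \<noteq> 0" "coeff p 0 \<noteq> 0" "coeff T 0 \<noteq> 0" "f < 0" "f + int (degree p) > 0"
    and roots: "\<And>x. poly (acp p) x = 0 \<Longrightarrow> order x (acp p) = a"
  shows "v < int a * N"
proof -
  define H where "H = smult (inverse (of_int N)) (smult (of_int v) (p * peuler e T) - smult (of_int t) (T * peuler f p))"
  have H: "smult (of_int N) H = smult (of_int v) (p * peuler e T) - smult (of_int t) (T * peuler f p)"
    using assms(1) by (simp add: H_def)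
  have "of_int N * G = of_int N * lau (f + e) H"
    using eq unfolding bracket_lau lau_of_int H by simp
  then have GH: "G = lau (f + e) H" using assms(1) by simp
  have "lau (f + (f + e)) (smult (of_int v) (p * peuler (f + e) H) - smult (of_int (v + t - N)) (H * peuler f p)) = lau (f + (f + e)) 0"
    using rel unfolding bracket_lau GH by (simp add: lau_def)
  then have rel': "smult (of_int v) (p * peuler (e + f) H) = smult (of_int (v + t - N)) (H * peuler f p)"
    by (simp add: add.commute)
  show ?thesis
  proof (rule weight_bound_core[of N v "acp p" e "acp T" t f "acp H" a])
    show "smult (of_int v) (acp p * peuler e (acp T)) - smult (of_int t) (acp T * peuler f (acp p)) = smult (of_int N) (acp H)"
      using arg_cong[OF H, of acp] by (simp add: acp_simps)
    show "smult (of_int v) (acp p * peuler (e + f) (acp H)) = smult (of_int (v + t - N)) (acp H * peuler f (acp p))"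
      using arg_cong[OF rel', of acp] by (simp add: acp_simps)
    show "acp H \<noteq> 0" using assms(5) GH by (auto simp: acp_simps lau_def)
  qed (use assms in \<open>auto simp: acp_simps\<close>)
qed

section \<open>Embedding the Weyl algebra into skew Laurent polynomials\<close>

interpretation emb: weyl_target "sconst :: 'k::field_char_0 \<Rightarrow> 'k skew" sX sY
  by standard (rule sconst_simps sconst_central skew_relation)+

abbreviation emb :: "'k::field_char_0 weyl \<Rightarrow> 'k skew"
  where "emb \<equiv> emb.weyl_img"

text \<open>The automorphism \<open>X \<mapsto> Y\<close>, \<open>Y \<mapsto> - X\<close> reverses the grading; it transports each statement about
  negative components to one about positive components.\<close>

interpretation rot: weyl_target "weyl_const :: 'k::field_char_0 \<Rightarrow> 'k weyl" weyl_Y "- weyl_X"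
  by standard (rule weyl_const_hom weyl_const_central | simp add: weyl_commutation_relation)+

interpretation rot': weyl_target "weyl_const :: 'k::field_char_0 \<Rightarrow> 'k weyl" "- weyl_Y" weyl_X
  by standard (rule weyl_const_hom weyl_const_central | simp add: weyl_commutation_relation)+

abbreviation rot :: "'k::field_char_0 weyl \<Rightarrow> 'k weyl" where "rot \<equiv> rot.weyl_img"
abbreviation rot' :: "'k::field_char_0 weyl \<Rightarrow> 'k weyl" where "rot' \<equiv> rot'.weyl_img"

lemma rot'_rot: "rot' (rot P) = P"
  by (induction P rule: weyl_induct) (simp_all add: rot.weyl_img_simps rot'.weyl_img_simps)

lemma weyl_const_minus: "weyl_const (- c) = - (weyl_const c :: 'k::field weyl)"
  using weyl_const_hom(3)[of c "- c"] by (simp add: weyl_const_hom(1) minus_unique)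

subsection \<open>Spanning by homogeneous elements\<close>

definition wH :: "'k::field_char_0 weyl" where "wH = weyl_Y * weyl_X"

text \<open>The polynomial \<open>p\<close> evaluated at \<open>Y X\<close>.\<close>

definition hp :: "'k::field_char_0 poly \<Rightarrow> 'k weyl"
  where "hp p = fold_coeffs (\<lambda>c r. weyl_const c + wH * r) p 0"

lemma hp_0 [simp]: "hp 0 = 0"
  by (simp add: hp_def)

lemma hp_pCons: "hp (pCons c p) = weyl_const c + wH * hp p"
  by (cases "c = 0 \<and> p = 0") (auto simp: hp_def weyl_const_hom)

lemma hp_add: "hp (p + q) = hp p + hp q"
  by (induction p q rule: poly_induct2) (simp_all add: hp_pCons weyl_const_hom algebra_simps)

lemma hp_smult: "hp (smult c p) = weyl_const c * hp p"
proof (induction p)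
  case (pCons a p)
  have "weyl_const c * (wH * hp p) = wH * (weyl_const c * hp p)"
    by (metis mult.assoc weyl_const_central)
  then show ?case using pCons by (simp add: hp_pCons weyl_const_hom distrib_left)
qed simp

lemma hp_mult: "hp (p * q) = hp p * hp q"
  by (induction p) (simp_all add: hp_pCons hp_add hp_smult weyl_const_hom algebra_simps)

lemma hp_simps: "hp 1 = 1" "hp [:c:] = weyl_const c" "hp [:0, 1:] = wH"
  by (simp_all add: hp_pCons weyl_const_hom one_pCons)

lemma subalgebra_wH: "f \<in> weyl_subalgebra {weyl_Y * weyl_X} \<Longrightarrow> \<exists>p. f = hp p"
proof (induction rule: weyl_subalgebra.induct)
  case (gen s)
  then show ?case using hp_simps(3) by (metis singletonD wH_def)
qed (metis hp_simps hp_add hp_mult)+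

lemma XY: "weyl_X * weyl_Y = wH - (1 :: 'k::field_char_0 weyl)"
proof -
  have "weyl_Y * weyl_X = 1 + weyl_X * (weyl_Y :: 'k weyl)"
    using weyl_commutation_relation[where 'k = 'k] by (metis diff_add_cancel)
  then show ?thesis by (simp add: wH_def)
qed

lemma X_wH: "weyl_X * wH = (wH - 1) * (weyl_X :: 'k::field_char_0 weyl)"
  unfolding XY[symmetric] by (simp add: wH_def mult.assoc)

lemma Y_wH: "weyl_Y * wH = (wH + 1) * (weyl_Y :: 'k::field_char_0 weyl)"
proof -
  have "weyl_Y * wH = weyl_Y * (weyl_X * weyl_Y + 1 :: 'k weyl)" unfolding XY by simp
  also have "\<dots> = (wH + 1) * weyl_Y" by (simp add: wH_def algebra_simps)
  finally show ?thesis .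
qed

lemma X_hp: "weyl_X * hp p = hp (shift 1 p) * weyl_X"
proof (induction p)
  case (pCons c p)
  have sh: "shift 1 (pCons c p) = [:c:] + [:-1, 1:] * shift 1 p"
    by (simp add: shift_def pcompose_pCons)
  have "weyl_X * hp (pCons c p) = weyl_const c * weyl_X + (weyl_X * wH) * hp p"
    by (simp add: hp_pCons distrib_left mult.assoc weyl_const_central[of c weyl_X])
  also have "\<dots> = weyl_const c * weyl_X + (wH - 1) * (weyl_X * hp p)"
    by (simp add: X_wH mult.assoc)
  also have "\<dots> = hp (shift 1 (pCons c p)) * weyl_X"
    unfolding sh pCons hp_add hp_mult
    by (simp add: hp_pCons weyl_const_hom weyl_const_minus algebra_simps)
  finally show ?case .
qed simp

lemma Y_hp: "weyl_Y * hp p = hp (shift (- 1) p) * weyl_Y"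
proof (induction p)
  case (pCons c p)
  have sh: "shift (- 1) (pCons c p) = [:c:] + [:1, 1:] * shift (- 1) p"
    by (simp add: shift_def pcompose_pCons)
  have "weyl_Y * hp (pCons c p) = weyl_const c * weyl_Y + (weyl_Y * wH) * hp p"
    by (simp add: hp_pCons distrib_left mult.assoc weyl_const_central[of c weyl_Y])
  also have "\<dots> = weyl_const c * weyl_Y + (wH + 1) * (weyl_Y * hp p)"
    by (simp add: Y_wH mult.assoc)
  also have "\<dots> = hp (shift (- 1) (pCons c p)) * weyl_Y"
    unfolding sh pCons hp_add hp_mult
    by (simp add: hp_pCons weyl_const_hom algebra_simps)
  finally show ?case .
qed simp

definition homogeneous :: "'k::field_char_0 poly \<Rightarrow> int \<Rightarrow> 'k weyl"
  where "homogeneous p i = hp p * (if i \<ge> 0 then weyl_X ^ nat i else weyl_Y ^ nat (- i))"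

lemma homogeneous_add: "homogeneous (p + q) i = homogeneous p i + homogeneous q i"
  and homogeneous_0 [simp]: "homogeneous 0 i = 0"
  by (simp_all add: homogeneous_def hp_add distrib_right)

lemma X_homogeneous: "\<exists>q. weyl_X * homogeneous p i = homogeneous q (i + 1)"
proof (cases "i \<ge> 0")
  case True
  have "weyl_X * homogeneous p i = (weyl_X * hp p) * weyl_X ^ nat i"
    using True by (simp add: homogeneous_def mult.assoc)
  also have "\<dots> = hp (shift 1 p) * weyl_X ^ Suc (nat i)"
    by (simp add: X_hp mult.assoc)
  also have "\<dots> = homogeneous (shift 1 p) (i + 1)"
    using True by (simp add: homogeneous_def Suc_nat_eq_nat_zadd1 add.commute)
  finally show ?thesis by blast
next
  case False
  define k where "k = nat (- i - 1)"
  then have i: "i = - 1 - int k" using False by simp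
  then have k: "nat (- i) = Suc k" by simp
  have "weyl_X * homogeneous p i = (weyl_X * hp p) * weyl_Y ^ Suc k"
    using False by (simp add: homogeneous_def k mult.assoc)
  also have "\<dots> = hp (shift 1 p) * (weyl_X * weyl_Y) * weyl_Y ^ k"
    by (simp add: X_hp mult.assoc)
  also have "\<dots> = hp (shift 1 p * [:-1, 1:]) * weyl_Y ^ k"
    unfolding XY hp_mult by (simp add: hp_pCons weyl_const_hom weyl_const_minus)
  also have "\<dots> = homogeneous (shift 1 p * [:-1, 1:]) (i + 1)"
    using i by (auto simp: homogeneous_def)
  finally show ?thesis by blast
qed

lemma Y_homogeneous: "\<exists>q. weyl_Y * homogeneous p i = homogeneous q (i - 1)"
proof (cases "i > 0")
  case False
  have "weyl_Y * homogeneous p i = (weyl_Y * hp p) * weyl_Y ^ nat (- i)"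
    using False by (cases "i = 0") (simp_all add: homogeneous_def mult.assoc)
  also have "\<dots> = hp (shift (- 1) p) * weyl_Y ^ Suc (nat (- i))"
    by (simp add: Y_hp mult.assoc)
  also have "Suc (nat (- i)) = nat (- (i - 1))" using False by simp
  also have "hp (shift (- 1) p) * weyl_Y ^ nat (- (i - 1)) = homogeneous (shift (- 1) p) (i - 1)"
    using False by (simp add: homogeneous_def)
  finally show ?thesis by blast
next
  case True
  define k where "k = nat (i - 1)"
  then have i: "i = 1 + int k" using True by simp
  then have k: "nat i = Suc k" by simp
  have "weyl_Y * homogeneous p i = (weyl_Y * hp p) * weyl_X ^ Suc k"
    using True by (simp add: homogeneous_def k mult.assoc)
  also have "\<dots> = hp (shift (- 1) p) * (weyl_Y * weyl_X) * weyl_X ^ k"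
    by (simp add: Y_hp mult.assoc)
  also have "\<dots> = hp (shift (- 1) p * [:0, 1:]) * weyl_X ^ k"
    unfolding hp_mult hp_simps wH_def ..
  also have "\<dots> = homogeneous (shift (- 1) p * [:0, 1:]) (i - 1)"
    using i by (auto simp: homogeneous_def)
  finally show ?thesis by blast
qed

definition homsum :: "'k::field_char_0 weyl \<Rightarrow> bool"
  where "homsum P \<longleftrightarrow> (\<exists>p I. finite I \<and> P = (\<Sum>i\<in>I. homogeneous (p i) i))"

lemma homsum_add:
  assumes "homsum P" "homsum Q"
  shows "homsum (P + Q)"
proof -
  obtain p I where P: "finite I" "P = (\<Sum>i\<in>I. homogeneous (p i) i)" using assms(1) unfolding homsum_def by blast
  obtain q J where Q: "finite J" "Q = (\<Sum>i\<in>J. homogeneous (q i) i)" using assms(2) unfolding homsum_def by blast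
  have "P = (\<Sum>i\<in>I \<union> J. homogeneous (if i \<in> I then p i else 0) i)"
    unfolding P(2) by (intro sum.mono_neutral_cong_left) (use P Q in auto)
  moreover have "Q = (\<Sum>i\<in>I \<union> J. homogeneous (if i \<in> J then q i else 0) i)"
    unfolding Q(2) by (intro sum.mono_neutral_cong_left) (use P Q in auto)
  ultimately have "P + Q = (\<Sum>i\<in>I \<union> J. homogeneous ((if i \<in> I then p i else 0) + (if i \<in> J then q i else 0)) i)"
    by (simp only: homogeneous_add sum.distrib)
  then show ?thesis unfolding homsum_def using P(1) Q(1)
    by (intro exI[of _ "\<lambda>i. (if i \<in> I then p i else 0) + (if i \<in> J then q i else 0)"] exI[of _ "I \<union> J"]) simp
qed

lemma homsum_homogeneous: "homsum (homogeneous p i)"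
  unfolding homsum_def by (intro exI[of _ "\<lambda>_. p"] exI[of _ "{i}"]) simp

lemma homsum_induct [consumes 1, case_names zero add]:
  assumes "homsum P" "Q 0" "\<And>p i R. homsum R \<Longrightarrow> Q R \<Longrightarrow> Q (homogeneous p i + R)"
  shows "Q P"
proof -
  obtain p I where P: "finite I" "P = (\<Sum>i\<in>I. homogeneous (p i) i)" using assms(1) unfolding homsum_def by blast
  have "Q (\<Sum>i\<in>I. homogeneous (p i) i) \<and> homsum (\<Sum>i\<in>I. homogeneous (p i) i)"
    using P(1)
  proof induction
    case empty
    show ?case using assms(2) homsum_homogeneous[of 0 0] by simp
  next
    case (insert x F)
    then show ?case
      using assms(3)[of "\<Sum>i\<in>F. homogeneous (p i) i" "p x" x]
        homsum_add[OF homsum_homogeneous[of "p x" x], of "\<Sum>i\<in>F. homogeneous (p i) i"] by simp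
  qed
  then show ?thesis using P by simp
qed

text \<open>It suffices to multiply by the generators, which map homogeneous elements to homogeneous elements.\<close>

lemma homsum_mult: "homsum Q \<Longrightarrow> homsum (P * Q)"
proof (induction P arbitrary: Q rule: weyl_induct)
  case (const c)
  then show ?case
  proof (induction rule: homsum_induct)
    case (add p i R)
    have "weyl_const c * homogeneous p i = homogeneous (smult c p) i"
      by (simp add: homogeneous_def hp_smult mult.assoc)
    then show ?case using add by (simp add: distrib_left homsum_add homsum_homogeneous)
  qed (use homsum_homogeneous[of 0 0] in simp)
next
  case X
  then show ?case
  proof (induction rule: homsum_induct)
    case (add p i R)
    then show ?case using X_homogeneous[of p i] by (auto simp: distrib_left intro!: homsum_add homsum_homogeneous)
  qed (use homsum_homogeneous[of 0 0] in simp)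
next
  case Y
  then show ?case
  proof (induction rule: homsum_induct)
    case (add p i R)
    then show ?case using Y_homogeneous[of p i] by (auto simp: distrib_left intro!: homsum_add homsum_homogeneous)
  qed (use homsum_homogeneous[of 0 0] in simp)
qed (simp_all add: distrib_right mult.assoc homsum_add)

lemma homsum_all: "homsum (P :: 'k::field_char_0 weyl)"
proof -
  have "homogeneous 1 0 = (1 :: 'k weyl)" by (simp add: homogeneous_def hp_simps)
  then show ?thesis using homsum_mult[OF homsum_homogeneous[of 1 0], of P] by simp
qed

text \<open>The coefficient \<open>h (h + 1) \<dots> (h + k - 1)\<close> of \<open>Y\<^sup>k = (h X\<^sup>-\<^sup>1)\<^sup>k\<close>, for \<open>k = - i\<close>.\<close>

definition cofactor :: "int \<Rightarrow> 'k::field_char_0 poly"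
  where "cofactor i = (\<Prod>j<nat (- i). [:of_nat j, 1:])"

lemma cofactor_nonzero [simp]: "cofactor i \<noteq> 0"
  and degree_cofactor: "degree (cofactor i :: 'k::field_char_0 poly) = nat (- i)"
proof -
  show "cofactor i \<noteq> 0" by (simp add: cofactor_def prod_zero_iff)
  show "degree (cofactor i :: 'k poly) = nat (- i)"
    unfolding cofactor_def by (subst degree_prod_eq_sum_degree) simp_all
qed

lemma emb_hp: "emb (hp p) = homog p 0"
proof (induction p)
  case (pCons c p)
  have "pCons c p = [:c:] + [:0, 1:] * p" by simp
  then have "homog (pCons c p) 0 = homog [:c:] 0 + homog [:0, 1:] 0 * homog p 0"
    by (metis homog_add homog_times_homog shift_simps(7) add_0)
  moreover have "emb (hp (pCons c p)) = sconst c + sY * sX * homog p 0"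
    using pCons by (simp add: hp_pCons emb.weyl_img_simps wH_def)
  ultimately show ?case unfolding sYX sconst_def by simp
qed (simp add: emb.weyl_img_simps)

lemma sX_power: "sX ^ n = homog 1 (int n)"
  by (induction n) (simp_all add: one_skew_def sX_def add.commute)

lemma sY_power: "(sY :: 'k::field_char_0 skew) ^ n = homog (cofactor (- int n)) (- int n)"
proof (induction n)
  case (Suc n)
  have sh: "shift (- int n) [:0, 1:] = [:of_nat n, 1 :: 'k:]" by (simp add: shift_var)
  have "(sY :: 'k skew) ^ Suc n = sY ^ n * sY" by (simp only: power_Suc2)
  also have "\<dots> = homog (cofactor (- int n) * [:of_nat n, 1:]) (- int n - 1)"
    by (simp only: Suc) (simp only: sY_def homog_times_homog sh add_uminus_conv_diff)
  also have "cofactor (- int n) * [:of_nat n, 1:] = cofactor (- int (Suc n))"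
    by (simp add: cofactor_def nat_add_distrib mult.commute)
  also have "- int n - 1 = - int (Suc n)" by simp
  finally show ?case .
qed (simp add: one_skew_def cofactor_def)

lemma emb_homogeneous: "emb (homogeneous p i) = homog (p * cofactor i) i"
proof (cases "i \<ge> 0")
  case True
  then show ?thesis by (simp add: homogeneous_def emb.weyl_img_simps emb_hp sX_power cofactor_def)
next
  case False
  then show ?thesis by (simp add: homogeneous_def emb.weyl_img_simps emb_hp sY_power)
qed

text \<open>The component of degree \<open>i\<close> of the image is a nonzero multiple of the coefficient of the homogeneous element
  of degree \<open>i\<close>.\<close>

lemma emb_zero_imp:
  assumes "emb P = 0"
  shows "P = 0"
proof -
  obtain p I where P: "finite I" "P = (\<Sum>i\<in>I. homogeneous (p i) i)" using homsum_all[of P] unfolding homsum_def by blast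
  have "comp (emb P) i = p i * cofactor i" if "i \<in> I" for i
    using P(1) that by (simp add: P(2) emb.weyl_img_simps emb_homogeneous comp_sum comp_homog)
  then have "p i = 0" if "i \<in> I" for i using that assms by simp
  then show ?thesis by (simp add: P(2))
qed

lemma emb_inject: "emb P = emb Q \<Longrightarrow> P = Q"
  using emb_zero_imp[of "P - Q"] by (simp add: emb.weyl_img_simps)

lemma emb_component:
  assumes "c \<in> weyl_component i"
  shows "supp (emb c) \<subseteq> {i}"
proof -
  have "\<exists>p. c = homogeneous p i"
    using assms subalgebra_wH by (fastforce simp: weyl_component_def homogeneous_def split: if_splits)
  then show ?thesis by (auto simp: emb_homogeneous in_supp comp_homog split: if_splits)
qed

subsection \<open>The effect of the rotation on components\<close>

lemma rot_hp: "rot (hp (p :: 'k::field_char_0 poly)) = hp (pcompose p [:1, -1:])"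
proof (induction p)
  case (pCons c p)
  have rw: "rot wH = 1 - (wH :: 'k weyl)"
    by (simp add: wH_def rot.weyl_img_simps) (simp add: XY wH_def)
  then show ?case using pCons
    unfolding hp_pCons rot.weyl_img_simps pcompose_pCons hp_add hp_mult rw
    by (simp add: hp_pCons weyl_const_hom weyl_const_minus algebra_simps)
qed (simp add: rot.weyl_img_simps)

lemma rot_homogeneous:
  fixes p :: "'k::field_char_0 poly"
  shows "\<exists>c\<in>{1, - 1}. rot (homogeneous p i) = homogeneous (smult c (pcompose p [:1, -1:])) (- i)"
proof (cases "i \<ge> 0")
  case True
  then have "rot (homogeneous p i) = homogeneous (pcompose p [:1, -1:]) (- i)"
    by (cases "i = 0") (simp_all add: homogeneous_def rot.weyl_img_simps rot_hp)
  then show ?thesis by simp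
next
  case False
  have "(- weyl_X) ^ n = weyl_const ((- 1) ^ n) * (weyl_X :: 'k weyl) ^ n" for n
  proof (induction n)
    case (Suc n)
    have "weyl_X * (weyl_const ((- 1) ^ n) * weyl_X ^ n) = weyl_const ((- 1) ^ n) * (weyl_X * (weyl_X :: 'k weyl) ^ n)"
      by (metis mult.assoc weyl_const_central)
    then show ?case using Suc by (simp add: weyl_const_minus)
  qed (simp add: weyl_const_hom)
  then have "rot (homogeneous p i) = hp (pcompose p [:1, -1:]) * weyl_const ((- 1) ^ nat (- i)) * weyl_X ^ nat (- i)"
    using False by (simp add: homogeneous_def rot.weyl_img_simps rot_hp mult.assoc)
  also have "\<dots> = homogeneous (smult ((- 1) ^ nat (- i)) (pcompose p [:1, -1:])) (- i)"
    using False by (simp add: homogeneous_def hp_smult weyl_const_central[of "(- 1) ^ nat (- i)"])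
  finally have "rot (homogeneous p i) = homogeneous (smult ((- 1) ^ nat (- i)) (pcompose p [:1, -1:])) (- i)" .
  moreover have "(- 1 :: 'k) ^ nat (- i) \<in> {1, - 1}" by (cases "even (nat (- i))") auto
  ultimately show ?thesis by blast
qed

text \<open>The coefficient of degree \<open>i\<close> is \<open>p\<close> times a product of \<open>max 0 (- i)\<close> linear factors, and the rotation changes
  \<open>p(h)\<close> into \<open>p(1 - h)\<close> up to sign and \<open>i\<close> into \<open>- i\<close>.\<close>

lemma comp_rot:
  obtains "comp (emb P) i = 0" "comp (emb (rot P)) (- i) = 0"
  | "comp (emb P) i \<noteq> 0" "comp (emb (rot P)) (- i) \<noteq> 0"
    "int (degree (comp (emb (rot P)) (- i))) = int (degree (comp (emb P) i)) + i"
proof -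
  obtain p I where P: "finite I" "P = (\<Sum>i\<in>I. homogeneous (p i) i)" using homsum_all[of P] unfolding homsum_def by blast
  define q where "q = (if i \<in> I then p i else 0)"
  have 1: "comp (emb P) i = q * cofactor i"
    using P(1) by (auto simp: P(2) q_def emb.weyl_img_simps emb_homogeneous comp_sum comp_homog)
  have "\<forall>i. \<exists>c. c \<in> {1, - 1} \<and> rot (homogeneous (p i) i) = homogeneous (smult c (pcompose (p i) [:1, -1:])) (- i)"
    using rot_homogeneous by blast
  from choice[OF this] obtain c where c: "\<And>i. c i \<in> {1, - 1}"
    "\<And>i. rot (homogeneous (p i) i) = homogeneous (smult (c i) (pcompose (p i) [:1, -1:])) (- i)"
    by blast
  have "comp (emb (rot P)) (- i) = (\<Sum>j\<in>I. if j = i then smult (c j) (pcompose (p j) [:1, -1:]) * cofactor (- j) else 0)"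
    unfolding P(2) rot.weyl_img_sum emb.weyl_img_sum c(2) emb_homogeneous comp_sum comp_homog
    by (intro sum.cong) auto
  then have 2: "comp (emb (rot P)) (- i) = smult (c i) (pcompose q [:1, -1:]) * cofactor (- i)"
    using P(1) by (auto simp: q_def)
  have ci: "c i \<noteq> 0" using c(1)[of i] by auto
  have pc: "pcompose q [:1, -1:] = 0 \<longleftrightarrow> q = 0" by (simp add: pcompose_eq_0_iff)
  show ?thesis
  proof (cases "q = 0")
    case True
    then show ?thesis using that(1) 1 2 by simp
  next
    case False
    have "degree (comp (emb P) i) = degree q + nat (- i)"
      unfolding 1 using False by (subst degree_mult_eq) (auto simp: degree_cofactor)
    moreover have "degree (comp (emb (rot P)) (- i)) = degree q + nat i"
      unfolding 2 using False ci pc by (subst degree_mult_eq) (auto simp: degree_cofactor degree_pcompose)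
    ultimately show ?thesis using that(2) 1 2 False ci pc by auto
  qed
qed

subsection \<open>Divisibility in negative components\<close>

text \<open>Skew Laurent polynomials act on vectors \<open>e\<^sub>m\<close>, \<open>m\<close> an integer, by \<open>h e\<^sub>m = m e\<^sub>m\<close> and
  \<open>X e\<^sub>m = e\<^sub>m\<^sub>+\<^sub>1\<close>. The condition says that the span of the \<open>e\<^sub>m\<close> with \<open>m \<ge> 1\<close> is preserved. Elements of
  the Weyl algebra have this property, because \<open>Y e\<^sub>1 = 0\<close>.\<close>

definition stable :: "'k::field_char_0 skew \<Rightarrow> bool"
  where "stable f \<longleftrightarrow> (\<forall>i m. m \<le> 0 \<longrightarrow> m - i \<ge> 1 \<longrightarrow> poly (comp f i) (of_int m) = 0)"

lemma stable_add: "stable f \<Longrightarrow> stable g \<Longrightarrow> stable (f + g)"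
  by (simp add: stable_def)

lemma stable_sconst: "stable (sconst c)"
  by (auto simp: stable_def sconst_def comp_homog)

lemma stable_mult:
  assumes "stable f" "stable g"
  shows "stable (f * g)"
  unfolding stable_def
proof (intro allI impI)
  fix n m :: int
  assume m: "m \<le> 0" "m - n \<ge> 1"
  have "poly (comp f i) (of_int m) * poly (comp g (n - i)) (of_int (m - i)) = 0" for i
  proof (cases "m - i \<le> 0")
    case True
    then have "poly (comp g (n - i)) (of_int (m - i)) = 0"
      using assms(2)[unfolded stable_def, rule_format, of "m - i" "n - i"] m by simp
    then show ?thesis by simp
  next
    case False
    then show ?thesis using assms(1) m unfolding stable_def by simp
  qed
  then show "poly (comp (f * g) n) (of_int m) = 0"
    by (simp add: comp_times poly_sum poly_shift del: of_int_diff mult_eq_0_iff flip: of_int_diff)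
qed

lemma stable_sX: "stable sX" and stable_sY: "stable sY"
  by (auto simp: stable_def sX_def sY_def comp_homog)

lemma stable_emb: "stable (emb P)"
  by (induction P rule: weyl_induct)
    (simp_all add: emb.weyl_img_simps stable_add stable_mult stable_sconst stable_sX stable_sY)

text \<open>A component of degree \<open>i < 0\<close> vanishes at the \<open>- i\<close> integers \<open>i + 1, \<dots>, 0\<close>. In terms of monomials
  \<open>X\<^sup>j Y\<^sup>k\<close> this is \<open>j \<ge> 0\<close>.\<close>

lemma stable_degree:
  fixes f :: "'k::field_char_0 skew"
  assumes "stable f" "comp f i \<noteq> 0"
  shows "- i \<le> int (degree (comp f i))"
proof (cases "i < 0")
  case True
  let ?S = "(\<lambda>m. of_int m :: 'k) ` {i + 1..0}"
  have "?S \<subseteq> {x. poly (comp f i) x = 0}"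
    using assms(1) by (auto simp: stable_def)
  then have "card ?S \<le> card {x. poly (comp f i) x = 0}"
    using poly_roots_finite[OF assms(2)] by (intro card_mono)
  also have "\<dots> \<le> degree (comp f i)" using card_poly_roots_bound[OF assms(2)] by simp
  finally have "card ?S \<le> degree (comp f i)" .
  moreover have "card ?S = card {i + 1..0}" by (intro card_image) (auto simp: inj_on_def)
  ultimately show ?thesis using True by simp
qed simp

section \<open>Weights of a pair with commutator one\<close>

lemma symb_finite: "finite {n. symb N A w f $$ n \<noteq> 0}"
proof (rule finite_subset)
  show "{n. symb N A w f $$ n \<noteq> 0} \<subseteq> supp f" by (auto simp: symb_nth in_supp split: if_splits)
qed simp

lemma wle_iff_degree:
  assumes "N > 0"
  shows "wle N A w f \<longleftrightarrow> (\<forall>i. comp f i \<noteq> 0 \<longrightarrow> N * int (degree (comp f i)) + A * i \<le> w)"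
proof
  assume "wle N A w f"
  then show "\<forall>i. comp f i \<noteq> 0 \<longrightarrow> N * int (degree (comp f i)) + A * i \<le> w"
    by (simp add: wle_def)
next
  assume *: "\<forall>i. comp f i \<noteq> 0 \<longrightarrow> N * int (degree (comp f i)) + A * i \<le> w"
  show "wle N A w f" unfolding wle_def
  proof (intro allI impI)
    fix i d assume c: "coeff (comp f i) d \<noteq> 0"
    then have "int d \<le> int (degree (comp f i))" by (simp add: le_degree)
    then have "N * int d \<le> N * int (degree (comp f i))" using assms by simp
    moreover have "comp f i \<noteq> 0" using c by auto
    ultimately show "N * int d + A * i \<le> w" using * by (meson add_right_mono order_trans)
  qed
qed

lemma symb_nth_degree:
  assumes "N > 0" "w = N * int (degree (comp f i)) + A * i" "comp f i \<noteq> 0"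
  shows "symb N A w f $$ i \<noteq> 0"
  using assms(3) symb_nth_coeff[OF assms(1,2), where f = f] by simp

lemma symb_nth_degreeE:
  assumes "N > 0" "wle N A w f" "symb N A w f $$ i \<noteq> 0"
  shows "comp f i \<noteq> 0 \<and> w = N * int (degree (comp f i)) + A * i"
proof -
  obtain d where d: "w = N * int d + A * i" "coeff (comp f i) d \<noteq> 0"
    using assms(1,3) by (elim symb_nth_nonzeroE)
  then have nz: "comp f i \<noteq> 0" by auto
  then have "N * int (degree (comp f i)) \<le> N * int d"
    using assms(1,2) wle_iff_degree[of N A w f] d(1) by fastforce
  then have "degree (comp f i) \<le> d" using assms(1) by simp
  moreover have "d \<le> degree (comp f i)" using d(2) by (rule le_degree)
  ultimately show ?thesis using d nz by simp
qed

lemma weight_exists: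
  assumes "N > 0" "f \<noteq> 0"
  obtains w where "wle N A w f" "symb N A w f \<noteq> 0"
proof -
  define S where "S = (\<lambda>i. N * int (degree (comp f i)) + A * i) ` supp f"
  have "supp f \<noteq> {}" using assms(2) by (metis comp_simps(1) empty_iff in_supp skew_eqI)
  then have S: "finite S" "S \<noteq> {}" by (simp_all add: S_def)
  then obtain i where i: "i \<in> supp f" "Max S = N * int (degree (comp f i)) + A * i"
    using Max_in[OF S] unfolding S_def by blast
  have "wle N A (Max S) f"
    unfolding wle_iff_degree[OF assms(1)] using S(1) by (auto intro!: Max_ge simp: S_def in_supp)
  moreover have "symb N A (Max S) f $$ i \<noteq> 0"
    using symb_nth_degree[OF assms(1) i(2)] i(1) by (simp add: in_supp)
  ultimately show ?thesis using that by (metis fls_zero_nth)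
qed

lemma wle_pred:
  assumes "N > 0" "wle N A w f" "symb N A w f = 0"
  shows "wle N A (w - 1) f"
  unfolding wle_iff_degree[OF assms(1)]
proof (intro allI impI)
  fix i assume "comp f i \<noteq> 0"
  then show "N * int (degree (comp f i)) + A * i \<le> w - 1"
    using assms wle_iff_degree[OF assms(1)] symb_nth_degree[OF assms(1), of w f i A]
    by (metis fls_zero_nth zle_diff1_eq order_le_less)
qed

lemma symb_power:
  assumes "N > 0" "wle N A w f"
  shows "symb N A (int n * w) (f ^ n) = symb N A w f ^ n \<and> wle N A (int n * w) (f ^ n)"
proof (induction n)
  case 0
  have one: "(1 :: 'a skew) = homog (monom 1 0) 0" by (simp add: one_skew_def)
  have "lmono 1 0 = (1 :: 'a fls)" by (simp add: lmono_def)
  then have "symb N A 0 (1 :: 'a skew) = 1" unfolding one symb_monomial[OF assms(1)] by simp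
  moreover have "wle N A 0 (1 :: 'a skew)" by (auto simp: wle_def comp_one)
  ultimately show ?case by simp
next
  case (Suc n)
  then show ?case
    using symb_mult[OF assms(1,2), of "int n * w" "f ^ n"] by (simp add: algebra_simps)
qed

lemma symb_one: "N > 0 \<Longrightarrow> symb N A w 1 = (if w = 0 then 1 else 0)"
proof -
  assume N: "N > 0"
  have one: "(1 :: 'a skew) = homog (monom 1 0) 0" by (simp add: one_skew_def)
  have "lmono 1 0 = (1 :: 'a fls)" by (simp add: lmono_def)
  then show "symb N A w (1 :: 'a skew) = (if w = 0 then 1 else 0)" unfolding one symb_monomial[OF N] by simp
qed

text \<open>The element \<open>1\<close> has weight \<open>0\<close> and symbol \<open>1\<close>.\<close>

lemma weights_commutator_one:
  assumes "N > 0" "f * g - g * f = 1" "wle N A v f" "wle N A w g"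
  shows "v + w \<ge> N"
    and "bracket v w (symb N A v f) (symb N A w g) = (if v + w = N then of_int N else 0)"
proof -
  note * = symb_commutator[OF assms(1,3,4), unfolded assms(2)]
  from * have "wle N A (v + w - N) (1 :: 'a skew)" by simp
  then have "\<And>i d. coeff (comp (1 :: 'a skew) i) d \<noteq> 0 \<Longrightarrow> N * int d + A * i \<le> v + w - N"
    unfolding wle_def by blast
  from this[of 0 0] show "v + w \<ge> N" by (simp add: comp_one)
  show "bracket v w (symb N A v f) (symb N A w g) = (if v + w = N then of_int N else 0)"
    using * by (auto simp: symb_one[OF assms(1)] bracket_def)
qed

lemma bracket_top_zero:
  assumes "bracket v w p q $$ (i + j) = 0" "p $$ i \<noteq> 0" "q $$ j \<noteq> 0"
    "\<And>n. n > i \<Longrightarrow> p $$ n = 0" "\<And>n. n > j \<Longrightarrow> q $$ n = 0"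
  shows "v * j = w * i"
proof -
  have "of_int (v * j - w * i) * (p $$ i * q $$ j) = 0"
    using bracket_top[of i p j q v w] assms by metis
  then have "of_int (v * j - w * i) = (0 :: 'a)" using assms(2,3) by simp
  then show ?thesis by (simp only: of_int_eq_0_iff)
qed

lemma bracket_bottom_zero:
  assumes "bracket v w p q $$ (i + j) = 0" "p $$ i \<noteq> 0" "q $$ j \<noteq> 0"
    "\<And>n. n < i \<Longrightarrow> p $$ n = 0" "\<And>n. n < j \<Longrightarrow> q $$ n = 0"
  shows "v * j = w * i"
proof -
  have "of_int (v * j - w * i) * (p $$ i * q $$ j) = 0"
    using bracket_bottom[of i p j q v w] assms by metis
  then have "of_int (v * j - w * i) = (0 :: 'a)" using assms(2,3) by simp
  then show ?thesis by (simp only: of_int_eq_0_iff)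
qed

lemma top_exponent:
  fixes p :: "'k::field_char_0 fls"
  assumes "p $$ i0 \<noteq> 0" "finite {n. p $$ n \<noteq> 0}"
  obtains i where "i \<ge> i0" "p $$ i \<noteq> 0" "\<And>n. n > i \<Longrightarrow> p $$ n = 0"
proof -
  let ?S = "{n. p $$ n \<noteq> 0}"
  have "Max ?S \<in> ?S" using assms by (intro Max_in) auto
  moreover have "n \<le> Max ?S" if "p $$ n \<noteq> 0" for n using assms(2) that by (intro Max_ge) auto
  ultimately show ?thesis
  proof (intro that[of "Max ?S"])
    fix n assume mem: "Max ?S \<in> ?S" and le: "\<And>n. p $$ n \<noteq> 0 \<Longrightarrow> n \<le> Max ?S" and n: "n > Max ?S"
    show "p $$ n = 0" using le[of n] n by (cases "p $$ n = 0") auto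
  qed (use assms(1) in auto)
qed

lemma bottom_exponent:
  fixes p :: "'k::field_char_0 fls"
  assumes "p $$ i0 \<noteq> 0" "finite {n. p $$ n \<noteq> 0}"
  obtains i where "i \<le> i0" "p $$ i \<noteq> 0" "\<And>n. n < i \<Longrightarrow> p $$ n = 0"
proof -
  let ?S = "{n. p $$ n \<noteq> 0}"
  have "Min ?S \<in> ?S" using assms by (intro Min_in) auto
  moreover have "n \<ge> Min ?S" if "p $$ n \<noteq> 0" for n using assms(2) that by (intro Min_le) auto
  ultimately show ?thesis
  proof (intro that[of "Min ?S"])
    fix n assume mem: "Min ?S \<in> ?S" and le: "\<And>n. p $$ n \<noteq> 0 \<Longrightarrow> Min ?S \<le> n" and n: "n < Min ?S"
    show "p $$ n = 0" using le[of n] n by (cases "p $$ n = 0") auto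
  qed (use assms(1) in auto)
qed

text \<open>Pairs \<open>(n, a)\<close> stand for the slopes \<open>a / n\<close>; the minimal one belongs to an edge of a Newton polygon.\<close>

lemma minimal_slope:
  fixes S :: "(int \<times> int) set"
  assumes "finite S" "S \<noteq> {}" "\<And>n a. (n, a) \<in> S \<Longrightarrow> n > 0"
  obtains n a where "(n, a) \<in> S" "\<And>n' a'. (n', a') \<in> S \<Longrightarrow> a * n' \<le> a' * n"
proof -
  define \<theta> where "\<theta> = (\<lambda>(n, a). of_int a / of_int n :: rat)"
  obtain x where x: "x \<in> S" "\<And>y. y \<in> S \<Longrightarrow> \<theta> x \<le> \<theta> y"
    using assms(1,2) by (metis arg_min_if_finite(1) arg_min_least)
  obtain n a where na: "x = (n, a)" by force
  have "a * n' \<le> a' * n" if "(n', a') \<in> S" for n' a'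
  proof -
    have "n > 0" "n' > 0" using assms(3) that x(1) na by auto
    moreover have "of_int a / of_int n \<le> (of_int a' / of_int n' :: rat)"
      using x(2)[OF that] na by (simp add: \<theta>_def)
    ultimately have "(of_int (a * n') :: rat) \<le> of_int (a' * n)" by (simp add: field_simps)
    then show ?thesis by (simp only: of_int_le_iff)
  qed
  then show ?thesis using that x(1) na by blast
qed

section \<open>Criteria for generation\<close>

lemma subalgebra_uminus: "p \<in> weyl_subalgebra S \<Longrightarrow> - p \<in> weyl_subalgebra S"
  using weyl_subalgebra.mult[OF weyl_subalgebra.const[of "- 1"], of p S]
  by (simp add: weyl_const_minus weyl_const_hom)

lemma subalgebra_diff: "p \<in> weyl_subalgebra S \<Longrightarrow> q \<in> weyl_subalgebra S \<Longrightarrow> p - q \<in> weyl_subalgebra S"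
  using weyl_subalgebra.add[of p S "- q"] subalgebra_uminus[of q S] by simp

lemma subalgebra_power: "p \<in> weyl_subalgebra S \<Longrightarrow> p ^ n \<in> weyl_subalgebra S"
  by (induction n) (use weyl_subalgebra.const[of 1 S] in \<open>simp_all add: weyl_const_hom weyl_subalgebra.mult\<close>)

lemma subalgebra_sum: "(\<And>i. i \<in> I \<Longrightarrow> p i \<in> weyl_subalgebra S) \<Longrightarrow> sum p I \<in> weyl_subalgebra S"
  by (induction I rule: infinite_finite_induct)
    (use weyl_subalgebra.const[of 0 S] in \<open>simp_all add: weyl_const_hom weyl_subalgebra.add\<close>)

lemma subalgebra_subset:
  assumes "S \<subseteq> weyl_subalgebra T"
  shows "weyl_subalgebra S \<subseteq> weyl_subalgebra T"
proof
  fix p assume "p \<in> weyl_subalgebra S"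
  then show "p \<in> weyl_subalgebra T"
    by induction (use assms in \<open>auto intro: weyl_subalgebra.intros\<close>)
qed

lemma subalgebra_UNIV_if:
  fixes S :: "'k::field_char_0 weyl set"
  assumes "weyl_X \<in> weyl_subalgebra S" "weyl_Y \<in> weyl_subalgebra S"
  shows "weyl_subalgebra S = UNIV"
proof -
  have "P \<in> weyl_subalgebra S" for P
    by (induction P rule: weyl_induct) (use assms in \<open>auto intro: weyl_subalgebra.intros\<close>)
  then show ?thesis by auto
qed

lemma generate_swap:
  "weyl_subalgebra {Q, - P} = UNIV \<Longrightarrow> weyl_subalgebra {P, Q} = UNIV"
  using subalgebra_subset[of "{Q, - P}" "{P, Q}"]
  by (auto intro: weyl_subalgebra.gen subalgebra_uminus)

lemma generate_rot:
  assumes "weyl_subalgebra {rot P, rot Q} = UNIV"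
  shows "weyl_subalgebra {P, Q} = UNIV"
proof -
  have "rot' R \<in> weyl_subalgebra {P, Q}" if "R \<in> weyl_subalgebra {rot P, rot Q}" for R
    using that by induction (auto simp: rot'.weyl_img_simps rot'_rot intro: weyl_subalgebra.intros)
  then have "rot' (rot Z) \<in> weyl_subalgebra {P, Q}" for Z using assms by blast
  then show ?thesis by (auto simp: rot'_rot)
qed

lemma commutator_rot: "commutator P Q = 1 \<Longrightarrow> commutator (rot P) (rot Q) = 1"
  unfolding commutator_def by (metis rot.weyl_img_diff rot.weyl_img_mult rot.weyl_img_one)

text \<open>Images of elements of the Weyl algebra satisfy this exactly if they come from \<open>c Y + g(X)\<close> with \<open>c \<noteq> 0\<close>.\<close>

definition affine :: "'k::field_char_0 skew \<Rightarrow> bool" where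
  "affine f \<longleftrightarrow> comp f (- 1) \<noteq> 0 \<and>
     (\<forall>i. comp f i \<noteq> 0 \<longrightarrow> i = - 1 \<and> degree (comp f i) = 1 \<or> i \<ge> 0 \<and> degree (comp f i) = 0)"

text \<open>Induction on the degree in \<open>h\<close>, which is the weight with \<open>N = 1\<close> and \<open>A = 0\<close>: commuting makes the symbol of \<open>Z\<close>
  proportional to a power of that of \<open>Q\<close>, and the corresponding multiple of a power of \<open>Q\<close> can be subtracted.\<close>

lemma centralizer_affine:
  assumes "affine (emb Q)" "Z * Q = Q * Z"
  shows "Z \<in> weyl_subalgebra {Q}"
proof -
  have wleQ: "wle 1 0 1 (emb Q)"
    using assms(1) by (auto simp: wle_iff_degree affine_def)
  have "symb 1 0 1 (emb Q) $$ (- 1) \<noteq> 0"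
    using assms(1) by (intro symb_nth_degree) (auto simp: affine_def)
  then have q0: "symb 1 0 1 (emb Q) \<noteq> 0" by (metis fls_zero_nth)
  have "Z \<in> weyl_subalgebra {Q}" if "wle 1 0 (int m - 1) (emb Z)" "Z * Q = Q * Z" for m Z
    using that
  proof (induction m arbitrary: Z)
    case 0
    have "comp (emb Z) i = 0" for i
      using 0 by (force simp: wle_iff_degree)
    then have "emb Z = 0" by (auto intro: skew_eqI)
    then show ?case using emb_zero_imp weyl_subalgebra.const[of 0 "{Q}"] by (auto simp: weyl_const_hom)
  next
    case (Suc m)
    let ?p = "symb 1 0 (int m) (emb Z)" and ?q = "symb 1 0 1 (emb Q)"
    have wleZ: "wle 1 0 (int m) (emb Z)" using Suc.prems by simp
    have "emb Z * emb Q - emb Q * emb Z = 0"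
      using Suc.prems(2) by (metis diff_self emb.weyl_img_mult)
    then have "bracket (int m) 1 ?p ?q = 0"
      using symb_commutator[OF _ wleZ wleQ] by (simp add: bracket_def)
    then have 1: "bracket 1 (int m) ?q ?p = 0" by (simp add: bracket_def)
    have "bracket 1 (int m * 1) ?q (?q ^ m) = 0"
      by (rule bracket_power) (simp add: bracket_def)
    then obtain c where c: "?p = fls_const c * ?q ^ m"
      using bracket_proportional[OF 1, of "?q ^ m"] q0 by auto
    define Z' where "Z' = Z - weyl_const c * Q ^ m"
    have embZ': "emb Z' = emb Z - sconst c * emb Q ^ m"
      by (simp add: Z'_def emb.weyl_img_simps)
    note pw = symb_power[OF _ wleQ, of m, simplified]
    have "wle 1 0 (int m) (sconst c * emb Q ^ m)"
      using pw by (auto simp: wle_def comp_sconst_times)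
    then have "wle 1 0 (int m) (emb Z')" unfolding embZ' using wleZ by (intro wle_diff)
    moreover have "symb 1 0 (int m) (emb Z') = 0"
      unfolding embZ' using pw c by (simp add: symb_sconst_times)
    ultimately have "wle 1 0 (int m - 1) (emb Z')" by (intro wle_pred) auto
    moreover have "Z' * Q = Q * Z'"
    proof -
      have "weyl_const c * Q ^ m * Q = Q * (weyl_const c * Q ^ m)"
        by (metis mult.assoc power_commutes weyl_const_central)
      then show ?thesis using Suc.prems(2) by (simp add: Z'_def algebra_simps)
    qed
    ultimately have "Z' \<in> weyl_subalgebra {Q}" by (rule Suc.IH)
    then have "Z' + weyl_const c * Q ^ m \<in> weyl_subalgebra {Q}"
      by (intro weyl_subalgebra.add weyl_subalgebra.mult weyl_subalgebra.const subalgebra_power)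
        (auto intro: weyl_subalgebra.gen)
    then show ?case by (simp add: Z'_def)
  qed
  moreover obtain w where w: "wle 1 0 w (emb Z)"
  proof (cases "emb Z = 0")
    case True then show ?thesis using that[of 0] by simp
  next
    case False then show ?thesis using weight_exists[of 1 "emb Z" 0] that by auto
  qed
  moreover have "wle 1 0 (int (nat (w + 1)) - 1) (emb Z)"
    using w by (rule wle_mono) simp
  ultimately show ?thesis using assms(2) by blast
qed

lemma affine_explicit:
  assumes "affine (emb Q)"
  obtains c r n where "c \<noteq> 0" "Q = weyl_const c * weyl_Y + (\<Sum>k<n. weyl_const (r k) * weyl_X ^ k)"
proof -
  let ?g = "emb Q"
  define c where "c = coeff (comp ?g (- 1)) 1"
  define r where "r k = coeff (comp ?g (int k)) 0" for k
  obtain n where n: "\<forall>i\<in>supp ?g. i < int n"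
  proof -
    obtain b where "\<forall>i\<in>supp ?g. i \<le> b" using finite_supp by (metis Max_ge)
    then show ?thesis using that[of "nat (b + 1)"] by force
  qed
  have deg1: "comp ?g (- 1) \<noteq> 0" "degree (comp ?g (- 1)) = 1" using assms by (auto simp: affine_def)
  then have c: "c \<noteq> 0" unfolding c_def by (metis leading_coeff_0_iff)
  have "poly (comp ?g (- 1)) (of_int 0) = 0" using stable_emb[of Q, unfolded stable_def, rule_format, of 0 "- 1"] by simp
  then have "coeff (comp ?g (- 1)) 0 = 0" by (simp add: poly_0_coeff_0)
  then have cm1: "comp ?g (- 1) = [:0, c:]"
    using deg1 by (intro poly_eqI) (auto simp: c_def coeff_pCons coeff_eq_0 split: nat.split)
  define Q' where "Q' = weyl_const c * weyl_Y + (\<Sum>k<n. weyl_const (r k) * weyl_X ^ k)"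
  have embQ': "emb Q' = homog [:0, c:] (- 1) + (\<Sum>k<n. homog [:r k:] (int k))"
    by (simp add: Q'_def emb.weyl_img_simps sX_power) (simp add: sconst_def sY_def)
  have "comp (emb Q') i = comp ?g i" for i
  proof -
    have sum: "comp (emb Q') i = (if i = - 1 then [:0, c:] else 0) + (\<Sum>k<n. if int k = i then [:r k:] else 0)"
      unfolding embQ' by (auto simp: comp_sum comp_homog)
    consider "i = - 1" | "i < - 1" | k where "i = int k" "k < n" | k where "i = int k" "k \<ge> n"
    proof (cases "i \<ge> 0")
      case True
      then have "i = int (nat i)" by simp
      then show ?thesis using that(3,4) by (meson not_le)
    next
      case False
      then show ?thesis using that(1,2) by linarith
    qed
    then show ?thesis
    proof cases
      case 1
      then show ?thesis unfolding sum using cm1 by (auto intro!: sum.neutral)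
    next
      case 2
      then have "comp ?g i = 0" using assms by (auto simp: affine_def)
      then show ?thesis unfolding sum using 2 by (auto intro!: sum.neutral)
    next
      case 3
      have "(\<Sum>k'<n. if int k' = i then [:r k':] else 0) = [:r k:]" using 3 by simp
      moreover have "degree (comp ?g i) = 0" using assms 3 by (cases "comp ?g i = 0") (auto simp: affine_def)
      ultimately show ?thesis unfolding sum using 3 by (auto simp: r_def elim!: degree_eq_zeroE)
    next
      case 4
      then have "i \<notin> supp ?g" using n by auto
      then have "comp ?g i = 0" by (simp add: in_supp)
      then show ?thesis unfolding sum using 4 by (auto intro!: sum.neutral)
    qed
  qed
  then have "emb Q' = ?g" by (intro skew_eqI)
  then have "Q = Q'" using emb_inject by metis
  then show ?thesis using that c Q'_def by blast
qed

text \<open>If \<open>Q = c Y + g(X)\<close>, then \<open>P + X / c\<close> commutes with \<open>Q\<close>, so it is a polynomial in \<open>Q\<close>.\<close>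

lemma generate_affine:
  assumes "commutator P Q = 1" "affine (emb Q)"
  shows "weyl_subalgebra {P, Q} = UNIV"
proof -
  let ?S = "weyl_subalgebra {P, Q}"
  obtain c r n where c: "c \<noteq> 0" and Q: "Q = weyl_const c * weyl_Y + (\<Sum>k<n. weyl_const (r k) * weyl_X ^ k)"
    using affine_explicit[OF assms(2)] by blast
  define G where "G = (\<Sum>k<n. weyl_const (r k) * weyl_X ^ k)"
  define X' where "X' = weyl_const (inverse c) * weyl_X"
  have ci: "weyl_const (inverse c) * weyl_const c = 1" using c by (simp add: weyl_const_hom flip: weyl_const_hom(4))
  have XG: "weyl_X * G = G * weyl_X"
    unfolding G_def sum_distrib_left sum_distrib_right
    by (intro sum.cong refl) (metis mult.assoc power_commutes weyl_const_central)
  have XQ: "weyl_X * Q - Q * weyl_X = - weyl_const c"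
  proof -
    have "weyl_X * Q - Q * weyl_X = weyl_const c * (weyl_X * weyl_Y - weyl_Y * weyl_X)"
    proof -
      have "weyl_X * (weyl_const c * weyl_Y) = weyl_const c * (weyl_X * weyl_Y)"
        by (metis mult.assoc weyl_const_central)
      then show ?thesis unfolding Q G_def[symmetric] using XG by (simp add: algebra_simps)
    qed
    also have "weyl_X * weyl_Y - weyl_Y * weyl_X = (- 1 :: 'a weyl)"
      using weyl_commutation_relation[where 'k = 'a] by (metis minus_diff_eq)
    finally show ?thesis by simp
  qed
  have "X' * Q - Q * X' = weyl_const (inverse c) * (weyl_X * Q - Q * weyl_X)"
  proof -
    have "Q * (weyl_const (inverse c) * weyl_X) = weyl_const (inverse c) * (Q * weyl_X)"
      by (metis mult.assoc weyl_const_central)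
    then show ?thesis unfolding X'_def by (simp add: right_diff_distrib mult.assoc)
  qed
  then have "X' * Q - Q * X' = - 1" unfolding XQ using ci by simp
  moreover have "(P + X') * Q - Q * (P + X') = (P * Q - Q * P) + (X' * Q - Q * X')"
    by (simp add: algebra_simps)
  ultimately have "(P + X') * Q - Q * (P + X') = 0"
    using assms(1) by (simp add: commutator_def)
  then have "(P + X') * Q = Q * (P + X')" by simp
  then have "P + X' \<in> weyl_subalgebra {Q}" by (rule centralizer_affine[OF assms(2)])
  then have "P + X' \<in> ?S" using subalgebra_subset[of "{Q}" "{P, Q}"] by (auto intro: weyl_subalgebra.gen)
  then have "(P + X') - P \<in> ?S" by (rule subalgebra_diff) (simp add: weyl_subalgebra.gen)
  then have "weyl_const c * X' \<in> ?S" by (auto intro: weyl_subalgebra.intros)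
  moreover have "weyl_const c * X' = weyl_X"
    unfolding X'_def using ci weyl_const_central[of c "weyl_const (inverse c)"] by (simp flip: mult.assoc)
  ultimately have X: "weyl_X \<in> ?S" by simp
  then have "G \<in> ?S" unfolding G_def by (intro subalgebra_sum weyl_subalgebra.mult weyl_subalgebra.const subalgebra_power)
  then have "weyl_const (inverse c) * (Q - G) \<in> ?S"
    by (intro subalgebra_diff weyl_subalgebra.mult weyl_subalgebra.const) (auto intro: weyl_subalgebra.gen)
  moreover have "weyl_const (inverse c) * (Q - G) = weyl_Y"
    unfolding Q G_def[symmetric] by (simp add: ci flip: mult.assoc)
  ultimately show ?thesis using X subalgebra_UNIV_if by simp
qed

lemma generate_affine':
  assumes "commutator P Q = 1" "affine (emb P)"
  shows "weyl_subalgebra {P, Q} = UNIV"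
proof -
  have "commutator (- Q) P = 1" using assms(1) by (simp add: commutator_def)
  then have "weyl_subalgebra {- Q, P} = UNIV" using assms(2) by (rule generate_affine)
  moreover have "weyl_subalgebra {- Q, P} \<subseteq> weyl_subalgebra {P, Q}"
    by (intro subalgebra_subset) (auto intro: weyl_subalgebra.gen subalgebra_uminus)
  ultimately show ?thesis by auto
qed

section \<open>One-sided pairs\<close>

lemma lowest_component:
  assumes "f \<noteq> 0"
  obtains m where "comp f m \<noteq> 0" "\<And>i. i < m \<Longrightarrow> comp f i = 0"
proof -
  have ne: "supp f \<noteq> {}" using assms by (metis comp_simps(1) empty_iff in_supp skew_eqI)
  show ?thesis
  proof (rule that[of "Min (supp f)"])
    show "comp f (Min (supp f)) \<noteq> 0" using Min_in[OF finite_supp ne] by (simp add: in_supp)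
    fix i assume "i < Min (supp f)"
    moreover have "Min (supp f) \<le> i" if "i \<in> supp f" using that by (intro Min_le) simp_all
    ultimately have "i \<notin> supp f" by linarith
    then show "comp f i = 0" by (simp add: in_supp)
  qed
qed

text \<open>For very negative \<open>A\<close> the symbols of \<open>f\<close> and \<open>g\<close> are their lowest components, of degrees \<open>m\<close> and \<open>j\<close>. The weight
  inequality gives \<open>m + j \<le> 0\<close>, so that \<open>m \<ge> 1\<close> implies \<open>j < 0\<close>, a nonvanishing bracket, and
  thereby \<open>m = - j = 1\<close>. For \<open>m = 0\<close> both elements have no negative components, and their components of
  degree zero commute.\<close>

lemma lowest_component_one:
  fixes f g :: "'k::field_char_0 skew"
  assumes comm: "f * g - g * f = 1" and pos: "\<And>i. i < 0 \<Longrightarrow> comp f i = 0"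
    and stable: "stable g" and zero: "comp f 0 = 0 \<or> degree (comp f 0) > 0"
  shows "comp f 0 = 0" "comp f 1 \<noteq> 0" "degree (comp f 1) = 0"
    "\<And>j. j < - 1 \<Longrightarrow> comp g j = 0" "comp g (- 1) \<noteq> 0" "degree (comp g (- 1)) = 1"
proof -
  have fg: "f \<noteq> 0" "g \<noteq> 0" using comm by auto
  obtain m where m: "comp f m \<noteq> 0" "\<And>i. i < m \<Longrightarrow> comp f i = 0"
    using lowest_component[OF fg(1)] by blast
  obtain j where j: "comp g j \<noteq> 0" "\<And>i. i < j \<Longrightarrow> comp g i = 0"
    using lowest_component[OF fg(2)] by blast
  have m0: "m \<ge> 0" using pos m(1) by (meson not_le)
  define d where "d = int (degree (comp f m))"
  define e where "e = int (degree (comp g j))"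
  \<comment> \<open>\<open>A = - M\<close> is so negative that the degree in \<open>h\<close> matters within a component only.\<close>
  define M where "M = 1 + (\<Sum>i\<in>supp f. int (degree (comp f i))) + (\<Sum>i\<in>supp g. int (degree (comp g i)))"
  have nonneg: "0 \<le> (\<Sum>i\<in>supp f. int (degree (comp f i)))" "0 \<le> (\<Sum>i\<in>supp g. int (degree (comp g i)))"
    by (intro sum_nonneg; simp)+
  have Mf: "int (degree (comp f i)) < M" for i
  proof (cases "comp f i = 0")
    case False
    then have "int (degree (comp f i)) \<le> (\<Sum>i\<in>supp f. int (degree (comp f i)))"
      by (intro member_le_sum) (auto simp: in_supp)
    then show ?thesis using nonneg by (simp add: M_def)
  qed (use nonneg in \<open>simp add: M_def\<close>)
  have Mg: "int (degree (comp g i)) < M" for i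
  proof (cases "comp g i = 0")
    case False
    then have "int (degree (comp g i)) \<le> (\<Sum>i\<in>supp g. int (degree (comp g i)))"
      by (intro member_le_sum) (auto simp: in_supp)
    then show ?thesis using nonneg by (simp add: M_def)
  qed (use nonneg in \<open>simp add: M_def\<close>)
  have Mde: "d + e < M"
  proof -
    have "d \<le> (\<Sum>i\<in>supp f. int (degree (comp f i)))" "e \<le> (\<Sum>i\<in>supp g. int (degree (comp g i)))"
      unfolding d_def e_def using m(1) j(1) by (auto intro!: member_le_sum simp: in_supp)
    then show ?thesis by (simp add: M_def)
  qed
  have steep: "a + - M * i \<le> b + - M * k" if "a < M" "0 \<le> b" "i > k" for a b i k
  proof -
    have "M * (i - k) \<ge> M * 1" using that Mf[of 0] by (intro mult_left_mono) auto
    then show ?thesis using that by (simp add: algebra_simps)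
  qed
  define v where "v = d - M * m"
  define w where "w = e - M * j"
  have wlef: "wle 1 (- M) v f" unfolding wle_iff_degree[OF zero_less_one]
  proof (intro allI impI)
    fix i assume "comp f i \<noteq> 0"
    then consider "i = m" | "i > m" using m(2) by (meson linorder_neqE)
    then show "1 * int (degree (comp f i)) + - M * i \<le> v"
      using steep[OF Mf[of i], of d m i] by cases (auto simp: v_def d_def)
  qed
  have wleg: "wle 1 (- M) w g" unfolding wle_iff_degree[OF zero_less_one]
  proof (intro allI impI)
    fix i assume "comp g i \<noteq> 0"
    then consider "i = j" | "i > j" using j(2) by (meson linorder_neqE)
    then show "1 * int (degree (comp g i)) + - M * i \<le> w"
      using steep[OF Mg[of i], of e j i] by cases (auto simp: w_def e_def)
  qed
  let ?p = "symb 1 (- M) v f" and ?q = "symb 1 (- M) w g"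
  have pm: "?p $$ m \<noteq> 0" by (rule symb_nth_degree) (use m in \<open>auto simp: v_def d_def\<close>)
  have qj: "?q $$ j \<noteq> 0" by (rule symb_nth_degree) (use j in \<open>auto simp: w_def e_def\<close>)
  have pl: "?p $$ n = 0" if "n < m" for n using m(2)[OF that] by (simp add: symb_nth)
  have ql: "?q $$ n = 0" if "n < j" for n using j(2)[OF that] by (simp add: symb_nth)
  note cw = weights_commutator_one[OF zero_less_one comm wlef wleg]
  have vw: "v * j - w * m = d * j - e * m" by (simp add: v_def w_def algebra_simps)
  have br: "bracket v w ?p ?q $$ (m + j) = 0 \<Longrightarrow> d * j = e * m"
    using bracket_bottom_zero[OF _ pm qj pl ql] vw by simp
  have mj: "m + j \<le> 0"
  proof (rule ccontr)
    assume "\<not> m + j \<le> 0"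
    then have "M * (m + j) \<ge> M * 1" using Mf[of 0] by (intro mult_left_mono) auto
    then show False using cw(1) Mde by (simp add: v_def w_def algebra_simps)
  qed
  have e: "e \<ge> - j" using stable_degree[OF stable j(1)] by (simp add: e_def)
  have d0: "d \<ge> 0" by (simp add: d_def)
  have "m \<noteq> 0"
  proof
    assume m0: "m = 0"
    then have d: "d > 0" using zero m(1) by (auto simp: d_def)
    have "j = 0"
    proof (rule ccontr)
      assume "j \<noteq> 0"
      then have "bracket v w ?p ?q $$ (m + j) = 0"
        unfolding cw(2) using m0 by (auto simp: fls_of_int)
      from br[OF this] show False using m0 d \<open>j \<noteq> 0\<close> by simp
    qed
    have prod: "comp (p * q) 0 = comp p 0 * comp q 0"
      if "\<And>i. i < 0 \<Longrightarrow> comp p i = 0" "\<And>i. i < 0 \<Longrightarrow> comp q i = 0" for p q :: "'k skew"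
    proof -
      have "comp p i * shift i (comp q (0 - i)) = (if i = 0 then comp p 0 * comp q 0 else 0)" for i
        using that(1)[of i] that(2)[of "- i"] by (cases "i < 0"; cases "i > 0") auto
      then have "comp (p * q) 0 = (\<Sum>i\<in>supp p. if i = 0 then comp p 0 * comp q 0 else 0)"
        unfolding comp_times by (intro sum.cong) simp_all
      then show ?thesis by (auto simp: in_supp)
    qed
    have "comp (f * g) 0 = comp (g * f) 0"
      using prod[of f g] prod[of g f] pos j(2) \<open>j = 0\<close> by (simp add: mult.commute)
    then have "comp (f * g - g * f) 0 = 0" by simp
    then show False using comm by (simp add: comp_one)
  qed
  then have m1: "m \<ge> 1" "j \<le> - 1" using m0 mj by auto
  have lt: "d * j - e * m < 0"
  proof -
    have "d * j \<le> 0" using d0 m1 by (simp add: mult_nonneg_nonpos)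
    moreover have "e * m > 0" using e m1 by simp
    ultimately show ?thesis by simp
  qed
  then have nz: "bracket v w ?p ?q $$ (m + j) \<noteq> 0" using br by auto
  then have "v + w = 1" "m + j = 0"
    unfolding cw(2) by (auto simp: fls_of_int split: if_splits)
  then have jm: "j = - m" by simp
  with \<open>v + w = 1\<close> have "d + e = 1" by (simp add: v_def w_def)
  with jm have md: "m = 1" "d = 0" "e = 1" "j = - 1" using e d0 m1 by auto
  show "comp f 0 = 0" "comp f 1 \<noteq> 0" "degree (comp f 1) = 0"
    "\<And>j. j < - 1 \<Longrightarrow> comp g j = 0" "comp g (- 1) \<noteq> 0" "degree (comp g (- 1)) = 1"
    using m j md by (auto simp: d_def e_def)
qed

text \<open>The edges of both Newton polygons next to the lowest components \<open>c X\<close> of \<open>f\<close> and \<open>c' Y\<close> of \<open>g\<close> have weights \<open>v = A\<close> and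
  \<open>w = N - A\<close>. If \<open>g\<close> had another term of positive degree in \<open>h\<close>, the first edge to be met would have
  \<open>A \<le> 0\<close>, and the highest exponents \<open>i\<close>, \<open>j\<close> of the symbols would satisfy \<open>i + j > 0\<close>, whence
  \<open>A j = (N - A) i\<close>; but \<open>A j < (N - A) i\<close>, as \<open>i \<ge> 1\<close>, \<open>j \<ge> - 1\<close> and \<open>A \<le> 0\<close>.\<close>

lemma affine_if_nonnegative:
  fixes f g :: "'k::field_char_0 skew"
  assumes comm: "f * g - g * f = 1" and pos: "\<And>i. i < 0 \<Longrightarrow> comp f i = 0"
    and stable: "stable g" and zero: "comp f 0 = 0 \<or> degree (comp f 0) > 0"
  shows "affine g"
proof (rule ccontr)
  note low = lowest_component_one[OF assms]
  assume na: "\<not> affine g"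
  obtain j0 where j0: "j0 \<ge> 0" "comp g j0 \<noteq> 0" "degree (comp g j0) > 0"
  proof -
    obtain j where j: "comp g j \<noteq> 0" "\<not> (j = - 1 \<and> degree (comp g j) = 1)" "\<not> (j \<ge> 0 \<and> degree (comp g j) = 0)"
      using na low(5) unfolding affine_def by blast
    then have "j \<noteq> - 1" using low(6) by auto
    moreover have "\<not> j < - 1" using low(4) j(1) by auto
    ultimately show ?thesis using that[of j] j by force
  qed
  define Sf where "Sf = (\<lambda>i. (i - 1, - int (degree (comp f i)))) ` {i \<in> supp f. i \<ge> 2}"
  define Sg where "Sg = (\<lambda>j. (j + 1, 1 - int (degree (comp g j)))) ` {j \<in> supp g. j \<ge> 0}"
  have "finite (Sf \<union> Sg)" by (simp add: Sf_def Sg_def)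
  moreover have j0S: "(j0 + 1, 1 - int (degree (comp g j0))) \<in> Sg"
    unfolding Sg_def using j0 by (auto simp: in_supp)
  moreover have "n > 0" if "(n, a) \<in> Sf \<union> Sg" for n a using that by (auto simp: Sf_def Sg_def)
  ultimately obtain N A where NA: "(N, A) \<in> Sf \<union> Sg" "\<And>n a. (n, a) \<in> Sf \<union> Sg \<Longrightarrow> A * n \<le> a * N"
    using minimal_slope[of "Sf \<union> Sg"] by blast
  have N: "N > 0" using NA(1) by (auto simp: Sf_def Sg_def)
  have A: "A \<le> 0"
  proof -
    have "A * (j0 + 1) \<le> (1 - int (degree (comp g j0))) * N" using NA(2) j0S by blast
    also have "\<dots> \<le> 0" using j0 N by (simp add: mult_nonpos_nonneg)
    finally show ?thesis using j0 by (simp add: mult_le_0_iff)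
  qed
  have wlef: "wle N A A f" unfolding wle_iff_degree[OF N]
  proof (intro allI impI)
    fix i assume i: "comp f i \<noteq> 0"
    then have "i > 0" using pos low(1) by (metis linorder_neqE)
    then consider "i = 1" | "i \<ge> 2" by linarith
    then show "N * int (degree (comp f i)) + A * i \<le> A"
    proof cases
      case 1
      then show ?thesis using low by simp
    next
      case 2
      then have "A * (i - 1) \<le> - int (degree (comp f i)) * N"
        using NA(2)[of "i - 1" "- int (degree (comp f i))"] i by (auto simp: Sf_def in_supp)
      then show ?thesis by (simp add: algebra_simps)
    qed
  qed
  have wleg: "wle N A (N - A) g" unfolding wle_iff_degree[OF N]
  proof (intro allI impI)
    fix i assume i: "comp g i \<noteq> 0"
    then have "i \<ge> - 1" using low(4) by (meson not_le)
    then consider "i = - 1" | "i \<ge> 0" by linarith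
    then show "N * int (degree (comp g i)) + A * i \<le> N - A"
    proof cases
      case 1
      then show ?thesis using low by simp
    next
      case 2
      then have "A * (i + 1) \<le> (1 - int (degree (comp g i))) * N"
        using NA(2)[of "i + 1" "1 - int (degree (comp g i))"] i by (auto simp: Sg_def in_supp)
      then show ?thesis by (simp add: algebra_simps)
    qed
  qed
  let ?p = "symb N A A f" and ?q = "symb N A (N - A) g"
  have p1: "?p $$ 1 \<noteq> 0" by (rule symb_nth_degree[OF N]) (use low in auto)
  have q1: "?q $$ (- 1) \<noteq> 0" by (rule symb_nth_degree[OF N]) (use low in auto)
  obtain ip where ip: "ip \<ge> 1" "?p $$ ip \<noteq> 0" "\<And>n. n > ip \<Longrightarrow> ?p $$ n = 0"
    using top_exponent[OF p1 symb_finite] by blast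
  obtain jq where jq: "jq \<ge> - 1" "?q $$ jq \<noteq> 0" "\<And>n. n > jq \<Longrightarrow> ?q $$ n = 0"
    using top_exponent[OF q1 symb_finite] by blast
  have pos: "ip + jq > 0"
    using NA(1)
  proof
    assume "(N, A) \<in> Sf"
    then obtain i where i: "comp f i \<noteq> 0" "i \<ge> 2" "N = i - 1" "A = - int (degree (comp f i))"
      by (auto simp: Sf_def in_supp)
    have "?p $$ i \<noteq> 0" by (rule symb_nth_degree[OF N]) (use i(1) in \<open>simp_all add: i(3,4) algebra_simps\<close>)
    then have "ip \<ge> i" using ip(3) by (meson not_le)
    then show ?thesis using i jq by simp
  next
    assume "(N, A) \<in> Sg"
    then obtain i where i: "comp g i \<noteq> 0" "i \<ge> 0" "N = i + 1" "A = 1 - int (degree (comp g i))"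
      by (auto simp: Sg_def in_supp)
    have "?q $$ i \<noteq> 0" by (rule symb_nth_degree[OF N]) (use i(1) in \<open>simp_all add: i(3,4) algebra_simps\<close>)
    then have "jq \<ge> i" using jq(3) by (meson not_le)
    then show ?thesis using i ip by simp
  qed
  have "bracket A (N - A) ?p ?q $$ (ip + jq) = 0"
    unfolding weights_commutator_one(2)[OF N comm wlef wleg] using pos by (simp add: fls_of_int)
  then have eq: "A * jq = (N - A) * ip"
    using bracket_top_zero[OF _ ip(2) jq(2) ip(3) jq(3)] by blast
  have gt: "(N - A) * ip \<ge> (N - A) * 1" using N A ip by (intro mult_left_mono) auto
  consider "jq = - 1" | "jq \<ge> 0" using jq(1) by linarith
  then show False
  proof cases
    case 1
    then show ?thesis using eq gt N by simp
  next
    case 2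
    then have "A * jq \<le> 0" using A by (simp add: mult_nonpos_nonneg)
    moreover have "A * jq \<ge> N - A" using eq gt by simp
    ultimately show ?thesis using N A by linarith
  qed
qed

text \<open>A constant component of degree \<open>0\<close> can be subtracted from \<open>P\<close>.\<close>

lemma generate_nonnegative:
  assumes "commutator P Q = 1" "\<And>i. i < 0 \<Longrightarrow> comp (emb P) i = 0"
  shows "weyl_subalgebra {P, Q} = UNIV"
proof (rule generate_affine[OF assms(1)])
  define c where "c = (if degree (comp (emb P) 0) = 0 then coeff (comp (emb P) 0) 0 else 0)"
  define f where "f = emb P - sconst c"
  have "f * emb Q - emb Q * f = emb P * emb Q - emb Q * emb P"
    by (simp add: f_def algebra_simps sconst_central[of c "emb Q"])
  then have comm: "f * emb Q - emb Q * f = 1" using emb.weyl_img_commutator[OF assms(1)] by simp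
  show "affine (emb Q)"
  proof (rule affine_if_nonnegative[OF comm _ stable_emb])
    show "comp f i = 0" if "i < 0" for i using assms(2)[OF that] that by (simp add: f_def sconst_def comp_homog)
    show "comp f 0 = 0 \<or> degree (comp f 0) > 0"
      by (auto simp: f_def sconst_def comp_homog c_def elim!: degree_eq_zeroE)
  qed
qed

lemma comp_rot_zero: "comp (emb (rot P)) i = 0 \<longleftrightarrow> comp (emb P) (- i) = 0"
  using comp_rot[of P "- i"] by auto

lemma generate_one_sided:
  assumes comm: "commutator P Q = 1"
    and "(\<forall>i<0. comp (emb P) i = 0) \<or> (\<forall>i>0. comp (emb P) i = 0)
       \<or> (\<forall>i<0. comp (emb Q) i = 0) \<or> (\<forall>i>0. comp (emb Q) i = 0)"
  shows "weyl_subalgebra {P, Q} = UNIV"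
proof -
  have both: "weyl_subalgebra {P, Q} = UNIV"
    if c: "commutator P Q = 1" and "(\<forall>i<0. comp (emb P) i = 0) \<or> (\<forall>i>0. comp (emb P) i = 0)" for P Q :: "'a weyl"
    using that(2)
  proof
    assume "\<forall>i<0. comp (emb P) i = 0"
    then show ?thesis using generate_nonnegative[OF c] by blast
  next
    assume "\<forall>i>0. comp (emb P) i = 0"
    then have "weyl_subalgebra {rot P, rot Q} = UNIV"
      by (intro generate_nonnegative commutator_rot c) (simp add: comp_rot_zero)
    then show ?thesis by (rule generate_rot)
  qed
  have "commutator Q (- P) = 1" using comm by (simp add: commutator_def)
  then show ?thesis using assms both[of P Q] both[of Q "- P"] generate_swap by blast
qed

section \<open>Two-sided pairs of minimal weight\<close>

definition two_sided :: "'k::field_char_0 skew \<Rightarrow> bool"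
  where "two_sided f \<longleftrightarrow> (\<exists>i>0. comp f i \<noteq> 0) \<and> (\<exists>i<0. comp f i \<noteq> 0)"

text \<open>A component of positive degree contributes at least \<open>A\<close> to the weight, and one of negative degree, which is a multiple
  of a power of \<open>Y\<close>, at least \<open>N - A\<close>.\<close>

lemma two_sided_weight:
  assumes "two_sided f" "stable f" "N > 0" "wle N A v f"
  shows "v > 0" "v \<ge> A" "v \<ge> N - A"
proof -
  obtain i j where i: "i > 0" "comp f i \<noteq> 0" and j: "j < 0" "comp f j \<noteq> 0"
    using assms(1) two_sided_def by blast
  have 1: "N * int (degree (comp f i)) + A * i \<le> v" "N * int (degree (comp f j)) + A * j \<le> v"
    using assms(4) i j wle_iff_degree[OF assms(3)] by auto
  have "N * int (degree (comp f i)) \<ge> 0" using assms(3) by simp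
  then have a: "A * i \<le> v" using 1 by linarith
  have "N * int (degree (comp f j)) \<ge> N * (- j)" using stable_degree[OF assms(2) j(2)] assms(3) by (intro mult_left_mono) auto
  then have b: "(N - A) * (- j) \<le> v" using 1 by (simp add: algebra_simps)
  show v: "v > 0"
  proof (cases "A > 0")
    case True
    then have "A * i > 0" using i by simp
    then show ?thesis using a by linarith
  next
    case False
    then have "(N - A) * (- j) > 0" using j assms(3) by (intro mult_pos_pos) auto
    then show ?thesis using b by linarith
  qed
  show "v \<ge> A"
  proof (cases "A > 0")
    case True
    then have "A * 1 \<le> A * i" using i by (intro mult_left_mono) auto
    then show ?thesis using a by linarith
  qed (use v in linarith)
  show "v \<ge> N - A"
  proof (cases "N - A > 0")
    case True
    then have "(N - A) * 1 \<le> (N - A) * (- j)" using j by (intro mult_left_mono) auto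
    then have "(N - A) * 1 \<le> v" using b by (rule order_trans)
    then show ?thesis by simp
  qed (use v in linarith)
qed

text \<open>Both weights are at least \<open>A\<close> and \<open>N - A\<close>, so \<open>v + w \<le> N\<close> leaves only \<open>v = w = A = N - A\<close>: all monomials
  of \<open>P\<close> have degree at most one in \<open>X\<close> and \<open>Y\<close>.\<close>

lemma generate_minimal_weight:
  assumes comm: "commutator P Q = 1" and "two_sided (emb P)" "two_sided (emb Q)"
    and N: "N > 0" and v: "wle N A v (emb P)" and w: "wle N A w (emb Q)" and vw: "v + w \<le> N"
  shows "weyl_subalgebra {P, Q} = UNIV"
proof (rule generate_affine'[OF comm])
  note V = two_sided_weight[OF assms(2) stable_emb N v] and W = two_sided_weight[OF assms(3) stable_emb N w]
  have eq: "v = A" "N = 2 * A" using V W vw by linarith+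
  then have A: "A > 0" using V by simp
  have le: "2 * int (degree (comp (emb P) i)) + i \<le> 1" if "comp (emb P) i \<noteq> 0" for i
  proof -
    have "N * int (degree (comp (emb P) i)) + A * i \<le> v"
      using v that wle_iff_degree[OF N] by blast
    then have "A * (2 * int (degree (comp (emb P) i)) + i) \<le> A * 1" using eq by (simp add: algebra_simps)
    then show ?thesis using A by (simp only: mult_le_cancel_left_pos)
  qed
  have key: "i = - 1 \<and> degree (comp (emb P) i) = 1 \<or> i \<ge> 0 \<and> degree (comp (emb P) i) = 0"
    if "comp (emb P) i \<noteq> 0" for i
    using le[OF that] stable_degree[OF stable_emb that] by linarith
  obtain i where "i < 0" "comp (emb P) i \<noteq> 0" using assms(2) two_sided_def by blast
  then have "comp (emb P) (- 1) \<noteq> 0" using key[of i] by auto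
  then show "affine (emb P)" unfolding affine_def using key by blast
qed

section \<open>An element whose symbol does not commute\<close>

lemma symb_above:
  assumes "N > 0" "wle N A w f" "w < z"
  shows "symb N A z f = 0"
proof (rule fls_eqI)
  fix n show "symb N A z f $$ n = (0 :: 'a fls) $$ n"
  proof (rule ccontr)
    assume "symb N A z f $$ n \<noteq> (0 :: 'a fls) $$ n"
    then have "symb N A z f $$ n \<noteq> 0" by simp
    then obtain d where "z = N * int d + A * n" "coeff (comp f n) d \<noteq> 0"
      using assms(1) by (elim symb_nth_nonzeroE)
    then show False using assms(2,3) unfolding wle_def by fastforce
  qed
qed

lemma commutator_power_symb:
  fixes f h :: "'k::field_char_0 skew"
  assumes "N > 0" "wle N A t h" "wle N A c (f * h - h * f)"
  shows "wle N A (int n * t + c) (f * h ^ Suc n - h ^ Suc n * f)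
    \<and> symb N A (int n * t + c) (f * h ^ Suc n - h ^ Suc n * f)
      = of_nat (Suc n) * symb N A t h ^ n * symb N A c (f * h - h * f)"
proof (induction n)
  case (Suc n)
  let ?z = "int (Suc n) * t + c"
  have split: "f * h ^ Suc (Suc n) - h ^ Suc (Suc n) * f
      = (f * h - h * f) * h ^ Suc n + h * (f * h ^ Suc n - h ^ Suc n * f)"
    by (simp add: algebra_simps)
  note pw = symb_power[OF assms(1,2), of "Suc n"]
  have 1: "symb N A ?z ((f * h - h * f) * h ^ Suc n) = symb N A c (f * h - h * f) * symb N A t h ^ Suc n
      \<and> wle N A ?z ((f * h - h * f) * h ^ Suc n)"
    using symb_mult[OF assms(1,3), of "int (Suc n) * t" "h ^ Suc n"] pw by (simp add: add.commute del: power_Suc)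
  define E where "E = f * h ^ Suc n - h ^ Suc n * f"
  have 2: "symb N A ?z (h * (f * h ^ Suc n - h ^ Suc n * f))
        = symb N A t h * (of_nat (Suc n) * symb N A t h ^ n * symb N A c (f * h - h * f))
      \<and> wle N A ?z (h * (f * h ^ Suc n - h ^ Suc n * f))"
  proof -
    have E: "symb N A (int n * t + c) E = of_nat (Suc n) * symb N A t h ^ n * symb N A c (f * h - h * f)"
      "wle N A (int n * t + c) E"
      using Suc unfolding E_def by blast+
    have z: "t + (int n * t + c) = ?z" by (simp add: algebra_simps)
    show ?thesis using symb_mult[OF assms(1,2) E(2)] unfolding E(1) E_def[symmetric] z .
  qed
  have "symb N A ?z (f * h ^ Suc (Suc n) - h ^ Suc (Suc n) * f)
      = of_nat (Suc (Suc n)) * symb N A t h ^ Suc n * symb N A c (f * h - h * f)"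
  proof -
    define y where "y = symb N A c (f * h - h * f)"
    show ?thesis
      unfolding split symb_simps(2) conjunct1[OF 1] conjunct1[OF 2] y_def[symmetric] by (simp add: algebra_simps)
  qed
  then show ?case using wle_add[OF conjunct2[OF 1] conjunct2[OF 2]] unfolding split by blast
qed (use assms(3) in simp)

text \<open>An improvement process on \<open>h\<close>: as long as the symbol \<open>T\<close> of \<open>h\<close>, of weight \<open>t\<close>, has bracket zero with \<open>p\<close>, the powers \<open>T\<^sup>v\<close> and \<open>p\<^sup>t\<close>
  are proportional, and \<open>h\<close> is replaced by the difference of \<open>h\<^sup>v\<close> and a multiple of \<open>f\<^sup>t\<close> with the same
  symbol. The symbol of the commutator with \<open>f\<close> is then multiplied by \<open>v T\<^sup>v\<^sup>-\<^sup>1\<close>, while the gap \<open>v + t - N - c\<close>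
  between the expected weight of the commutator and its weight \<open>c\<close> becomes smaller. The exponent \<open>t\<close>
  cannot be negative, because \<open>p\<close> has two terms.\<close>

lemma noncommuting_symbol_exists:
  fixes f h :: "'k::field_char_0 skew"
  assumes N: "N > 0" and v: "v > 0" and wf: "wle N A v f"
    and i: "symb N A v f $$ i \<noteq> 0" "symb N A v f $$ i' \<noteq> 0" "i < i'"
    and "wle N A t h" "symb N A t h \<noteq> 0" "wle N A c (f * h - h * f)" "symb N A c (f * h - h * f) \<noteq> 0"
    and "bracket v c (symb N A v f) (symb N A c (f * h - h * f)) = 0"
  shows "\<exists>t T G. T \<noteq> 0 \<and> finite {n. T $$ n \<noteq> 0} \<and> G \<noteq> 0 \<and> bracket v t (symb N A v f) T = of_int N * G
    \<and> bracket v (v + t - N) (symb N A v f) G = 0"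
  using assms(7-)
proof (induction "nat (v + t - N - c)" arbitrary: h t c rule: less_induct)
  case less
  let ?p = "symb N A v f" and ?T = "symb N A t h" and ?C = "f * h - h * f"
  let ?G = "symb N A c ?C"
  note cm = symb_commutator[OF N wf less.prems(1)]
  have p0: "?p \<noteq> 0" using i(1) by auto
  have cle: "c \<le> v + t - N"
    using symb_above[OF N conjunct2[OF cm], of c] less.prems(4) by force
  show ?case
  proof (cases "c = v + t - N")
    case True
    then show ?thesis using cm less.prems symb_finite unfolding bracket_def by metis
  next
    case False
    then have "symb N A (v + t - N) ?C = 0"
      using symb_above[OF N less.prems(3)] cle by simp
    then have br: "bracket v t ?p ?T = 0" using cm by (simp add: bracket_def)
    have t: "t \<ge> 0"
    proof (rule ccontr)
      assume neg: "\<not> t \<ge> 0"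
      obtain n where n: "?T $$ n \<noteq> 0" using less.prems(2) by (metis fls_eqI fls_zero_nth)
      obtain it where it: "it \<ge> i'" "?p $$ it \<noteq> 0" "\<And>n. n > it \<Longrightarrow> ?p $$ n = 0"
        using top_exponent[OF i(2) symb_finite] by blast
      obtain ib where ib: "ib \<le> i" "?p $$ ib \<noteq> 0" "\<And>n. n < ib \<Longrightarrow> ?p $$ n = 0"
        using bottom_exponent[OF i(1) symb_finite] by blast
      obtain jt where jt: "jt \<ge> n" "?T $$ jt \<noteq> 0" "\<And>n. n > jt \<Longrightarrow> ?T $$ n = 0"
        using top_exponent[OF n symb_finite] by blast
      obtain jb where jb: "jb \<le> n" "?T $$ jb \<noteq> 0" "\<And>n. n < jb \<Longrightarrow> ?T $$ n = 0"
        using bottom_exponent[OF n symb_finite] by blast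
      have "v * jt = t * it" using bracket_top_zero[OF _ it(2) jt(2) it(3) jt(3)] br by simp
      moreover have "v * jb = t * ib" using bracket_bottom_zero[OF _ ib(2) jb(2) ib(3) jb(3)] br by simp
      moreover have "t * it < t * ib" using neg it ib i(3) by (intro mult_strict_left_mono_neg) auto
      ultimately have "v * jt < v * jb" by simp
      then show False using v jt jb by simp
    qed
    define n where "n = nat v - 1"
    have vn: "int (Suc n) = v" using v by (simp add: n_def)
    have "bracket v (int (Suc n) * t) ?p (?T ^ Suc n) = 0" using bracket_power[OF br] .
    moreover have "bracket v (int (nat t) * v) ?p (?p ^ nat t) = 0"
      by (rule bracket_power) (simp add: bracket_def)
    moreover have "int (Suc n) * t = int (nat t) * v" using t vn by simp
    ultimately obtain \<alpha> where \<alpha>: "?T ^ Suc n = fls_const \<alpha> * ?p ^ nat t"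
      using bracket_proportional[of v "int (Suc n) * t" ?p "?T ^ Suc n" "?p ^ nat t"] v p0 by auto
    define h' where "h' = h ^ Suc n - sconst \<alpha> * f ^ nat t"
    define t0 where "t0 = int (Suc n) * t"
    note pwh = symb_power[OF N less.prems(1), of "Suc n"] and pwf = symb_power[OF N wf, of "nat t"]
    have t0: "t0 = int (nat t) * v" using t vn by (simp add: t0_def)
    have "wle N A t0 (sconst \<alpha> * f ^ nat t)"
      using pwf unfolding t0 by (auto simp: wle_def comp_sconst_times)
    then have "wle N A t0 h'" unfolding h'_def using pwh by (intro wle_diff) (simp_all add: t0_def)
    moreover have "symb N A t0 h' = 0"
    proof -
      have "symb N A t0 (h ^ Suc n) = ?T ^ Suc n" using pwh unfolding t0_def by blast
      moreover have "symb N A t0 (f ^ nat t) = ?p ^ nat t" using pwf unfolding t0 by blast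
      ultimately show ?thesis unfolding h'_def symb_simps(3) symb_sconst_times using \<alpha> by simp
    qed
    ultimately have wh': "wle N A (t0 - 1) h'" using wle_pred[OF N] by blast
    have "f * (sconst \<alpha> * f ^ nat t) = sconst \<alpha> * f ^ nat t * f"
      by (metis mult.assoc power_commutes sconst_central)
    then have C': "f * h' - h' * f = f * h ^ Suc n - h ^ Suc n * f"
      unfolding h'_def by (simp add: algebra_simps del: power_Suc)
    define c' where "c' = int n * t + c"
    note cp = commutator_power_symb[OF N less.prems(1,3), of n, folded c'_def C']
    have G': "symb N A c' (f * h' - h' * f) = of_nat (Suc n) * ?T ^ n * ?G" using cp by blast
    then have G'0: "symb N A c' (f * h' - h' * f) \<noteq> 0" using less.prems by (simp del: of_nat_Suc)
    have brG': "bracket v c' ?p (symb N A c' (f * h' - h' * f)) = 0"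
    proof -
      have "euler (of_nat (Suc n) :: 'k fls) = 0"
        by (metis euler_simps(5) fls_of_nat)
      then have "bracket v 0 ?p (of_nat (Suc n)) = 0" by (simp add: bracket_def del: of_nat_Suc)
      from bracket_mult[OF bracket_mult[OF this bracket_power[OF br, of n]] less.prems(5)]
      show ?thesis unfolding G' by (simp only: add_0 c'_def)
    qed
    have "h' \<noteq> 0" using G'0 by auto
    then obtain t' where t': "wle N A t' h'" "symb N A t' h' \<noteq> 0" using weight_exists[OF N] by metis
    have "t' \<le> t0 - 1" using symb_above[OF N wh', of t'] t'(2) by force
    then have "v + t' - N - c' < v + t - N - c" by (simp add: c'_def t0_def algebra_simps)
    moreover have "0 \<le> v + t' - N - c'"
    proof -
      have "wle N A (v + t' - N) (f * h' - h' * f)" using symb_commutator[OF N wf t'(1)] by blast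
      then show ?thesis using symb_above[OF N, of A "v + t' - N" _ c'] G'0 by force
    qed
    ultimately have "nat (v + t' - N - c') < nat (v + t - N - c)" by linarith
    from less.hyps[OF this t' _ G'0 brG'] cp show ?thesis by blast
  qed
qed

section \<open>Pairs that are monic in Y\<close>

text \<open>Let \<open>D\<close> be the degree. There are at most \<open>D / a\<close> distinct roots, so the derivative has at least \<open>D - D / a\<close>
  nonzero roots, counted with multiplicity, and by the gap at least \<open>2 D / a - 1\<close> zeros at the origin. That is
  more than its degree \<open>D - 1\<close>. Raising everything to the power \<open>a\<close> avoids fractions.\<close>

lemma no_gap:
  fixes p :: "'k::{alg_closed_field,field_char_0} poly"
  assumes p0: "coeff p 0 \<noteq> 0" and D: "degree p > 0" and a: "a > 0"
    and roots: "\<And>x. poly p x = 0 \<Longrightarrow> a \<le> order x p"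
    and gap: "\<And>l. l > 0 \<Longrightarrow> coeff p l \<noteq> 0 \<Longrightarrow> 2 * degree p \<le> a * l"
  shows False
proof -
  define D where "D = degree p"
  have nz: "p \<noteq> 0" "pderiv p \<noteq> 0" using p0 assms(2) by (auto simp: pderiv_eq_0_iff)
  obtain x0 where "poly p x0 = 0" using alg_closed_imp_poly_has_root[of p] D by auto
  then have Da: "a \<le> D" using roots[of x0] order_degree[OF nz(1), of x0] by (simp add: D_def)
  have ord0: "order 0 p = 0" using p0 by (intro order_0I) (simp add: poly_0_coeff_0)
  define u where "u = [:0, 1 :: 'k:]"
  have u: "u \<noteq> 0" "degree u = 1" by (simp_all add: u_def)
  have ordu: "order x (u ^ n) = (if x = 0 then n else 0)" for x n
    using order_power_n_n[of 0 n] by (auto simp: u_def intro: order_0I)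
  \<comment> \<open>The left-hand side collects the zeros that the \<open>a\<close>-th power of the derivative must have.\<close>
  have "degree (p ^ (a - 1) * u ^ (2 * D - a)) \<le> degree (pderiv p ^ a)"
  proof (rule degree_le_if_orders_le)
    fix x :: 'k
    have lhs: "order x (p ^ (a - 1) * u ^ (2 * D - a))
        = (a - 1) * order x p + (if x = 0 then 2 * D - a else 0)"
      using nz u by (subst order_mult) (simp_all add: order_power ordu)
    have rhs: "order x (pderiv p ^ a) = a * order x (pderiv p)"
      using nz by (simp add: order_power)
    show "order x (p ^ (a - 1) * u ^ (2 * D - a)) \<le> order x (pderiv p ^ a)"
    proof (cases "x = 0")
      case True
      define m where "m = order 0 (pderiv p)"
      have "2 * D \<le> a * Suc m"
      proof -
        obtain l where l: "coeff (pderiv p) l \<noteq> 0" "l \<le> m"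
        proof -
          have "\<not> monom 1 (Suc m) dvd pderiv p"
            using monom_1_dvd_iff[OF nz(2), of "Suc m"] by (simp add: m_def)
          then show ?thesis using that by (auto simp: monom_1_dvd_iff' less_Suc_eq_le)
        qed
        then have "coeff p (Suc l) \<noteq> 0" by (auto simp: coeff_pderiv)
        then have "2 * D \<le> a * Suc l" using gap[of "Suc l"] by (simp add: D_def)
        also have "\<dots> \<le> a * Suc m" using l by simp
        finally show ?thesis .
      qed
      then show ?thesis using True lhs rhs ord0 by (simp add: m_def)
    next
      case False
      have "(a - 1) * order x p \<le> a * order x (pderiv p)"
      proof (cases "poly p x = 0")
        case True
        then have o: "order x p = Suc (order x (pderiv p))"
          using nz by (intro order_pderiv)
        have "a \<le> order x p" using roots[OF True] .
        then show ?thesis using a unfolding o by (cases a) (simp_all add: algebra_simps)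
      next
        case False
        then show ?thesis by (simp add: order_0I)
      qed
      then show ?thesis using False lhs rhs by simp
    qed
  qed (use nz u in auto)
  then have "(a - 1) * D + (2 * D - a) \<le> a * (D - 1)"
    using nz u by (simp add: degree_mult_eq degree_power_eq degree_pderiv D_def)
  moreover obtain a' where "a = Suc a'" using a by (cases a) auto
  moreover obtain D' where "D = Suc D'" using D gr0_implies_Suc unfolding D_def by blast
  ultimately show False using Da by (simp add: algebra_simps)
qed

text \<open>The term \<open>Y\<^sup>a\<close> is a vertex of the Newton polygon of \<open>f\<close>. The edge that starts there has weights \<open>v = a (N - A)\<close> and
  \<open>w = b (N - A)\<close>, so all multiplicities of its symbol are divisible by \<open>a\<close>, and so is the degree in \<open>h\<close> at its
  other end; this degree is less than \<open>a\<close>, hence zero. On such an edge the absence of terms of degree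
  \<open>a - 1\<close> in \<open>h\<close> is a gap, which the preceding lemma excludes.\<close>

lemma reduced_pair_impossible:
  fixes f g :: "'k::field_char_0 skew" and a b :: nat
  assumes comm: "f * g - g * f = 1" and stable: "stable f" "stable g"
    and ab: "a \<ge> 2" "b \<ge> 2" "coprime a b"
    and fa: "comp f (- int a) \<noteq> 0" "degree (comp f (- int a)) = a"
    and f: "\<And>i. comp f i \<noteq> 0 \<Longrightarrow> i \<noteq> - int a \<Longrightarrow> degree (comp f i) + 2 \<le> a"
    and gb: "comp g (- int b) \<noteq> 0" "degree (comp g (- int b)) = b"
    and g: "\<And>i. comp g i \<noteq> 0 \<Longrightarrow> i \<noteq> - int b \<Longrightarrow> degree (comp g i) < b"
  shows False
proof -
  let ?df = "\<lambda>i. int (degree (comp f i))" and ?dg = "\<lambda>i. int (degree (comp g i))"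
  have fi: "i > - int a \<and> ?df i \<ge> - i \<and> ?df i + 2 \<le> int a" if "comp f i \<noteq> 0" "i \<noteq> - int a" for i
    using f[OF that] stable_degree[OF stable(1) that(1)] by linarith
  \<comment> \<open>Slope 1 belongs to the edge along powers of \<open>Y\<close>; including it covers the case that \<open>f\<close> is a polynomial in \<open>Y\<close>.\<close>
  define S where "S = insert (1, 1) ((\<lambda>i. (i + int a, int a - ?df i)) ` {i \<in> supp f. i \<noteq> - int a})"
  have "finite S" "S \<noteq> {}" by (simp_all add: S_def)
  moreover have "n > 0" if "(n, s) \<in> S" for n s
    using that unfolding S_def
  proof
    assume "(n, s) \<in> (\<lambda>i. (i + int a, int a - ?df i)) ` {i \<in> supp f. i \<noteq> - int a}"
    then obtain i where "comp f i \<noteq> 0" "i \<noteq> - int a" "n = i + int a" by (auto simp: in_supp)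
    then show ?thesis using fi[of i] by linarith
  qed simp
  ultimately obtain N A where NA: "(N, A) \<in> S" "\<And>n s. (n, s) \<in> S \<Longrightarrow> A * n \<le> s * N"
    using minimal_slope[of S] by blast
  have "N > 0 \<and> A > 0"
    using NA(1) unfolding S_def
  proof
    assume "(N, A) \<in> (\<lambda>i. (i + int a, int a - ?df i)) ` {i \<in> supp f. i \<noteq> - int a}"
    then obtain i where "comp f i \<noteq> 0" "i \<noteq> - int a" "N = i + int a" "A = int a - ?df i"
      by (auto simp: in_supp)
    then show ?thesis using fi[of i] by linarith
  qed simp
  then have N: "N > 0" and A: "A > 0" by auto
  have AN: "A \<le> N" using NA(2)[of 1 1] by (simp add: S_def)
  define v where "v = int a * (N - A)"
  have wf: "wle N A v f" unfolding wle_iff_degree[OF N]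
  proof (intro allI impI)
    fix i assume i: "comp f i \<noteq> 0"
    show "N * ?df i + A * i \<le> v"
    proof (cases "i = - int a")
      case True
      then show ?thesis using fa by (simp add: v_def algebra_simps)
    next
      case False
      then have "A * (i + int a) \<le> (int a - ?df i) * N"
        using i by (intro NA(2)) (auto simp: S_def in_supp)
      then show ?thesis by (simp add: v_def algebra_simps)
    qed
  qed
  have "g \<noteq> 0" using gb by auto
  then obtain w where w: "wle N A w g" "symb N A w g \<noteq> 0" using weight_exists[OF N] by metis
  have wb: "w \<ge> int b * (N - A)"
    using w(1)[unfolded wle_iff_degree[OF N], rule_format, OF gb(1)] gb by (simp add: algebra_simps)
  let ?p = "symb N A v f" and ?q = "symb N A w g"
  note cw = weights_commutator_one[OF N comm wf w(1)]
  have pa: "?p $$ (- int a) \<noteq> 0"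
    by (rule symb_nth_degree[OF N]) (use fa in \<open>simp_all add: v_def algebra_simps\<close>)
  have pl: "?p $$ n = 0" if "n < - int a" for n
  proof -
    have "comp f n = 0" using fi[of n] that by force
    then show ?thesis by (simp add: symb_nth)
  qed
  obtain n0 where n0: "?q $$ n0 \<noteq> 0" using w(2) by (metis fls_eqI fls_zero_nth)
  obtain j where j: "?q $$ j \<noteq> 0" "\<And>n. n < j \<Longrightarrow> ?q $$ n = 0"
    using bottom_exponent[OF n0 symb_finite] by blast
  have je: "comp g j \<noteq> 0" "w = N * ?dg j + A * j" using symb_nth_degreeE[OF N w(1) j(1)] by auto
  have botz: "bracket v w ?p ?q $$ (- int a + j) = 0 \<Longrightarrow> v * j = w * (- int a)"
    using bracket_bottom_zero[OF _ pa j(1) pl j(2)] by blast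
  show False
  proof (cases "A = N")
    case True
    then have v0: "v = 0" by (simp add: v_def)
    then have wN: "w \<ge> N" using cw(1) by simp
    then have "bracket v w ?p ?q $$ (- int a + j) \<noteq> 0" using botz v0 ab N by auto
    then have "j = int a" "w = N" unfolding cw(2) using v0 by (auto simp: fls_of_int split: if_splits)
    then have "N * (?dg j + int a) = N * 1" using je(2) True by (simp add: algebra_simps)
    then have "?dg j + int a = 1" using N by simp
    then show ?thesis using ab by simp
  next
    case False
    then have lt: "A < N" using AN by simp
    then have v0: "v > 0" using ab by (simp add: v_def)
    obtain i0 where i0: "comp f i0 \<noteq> 0" "i0 \<noteq> - int a" "N = i0 + int a" "A = int a - ?df i0"
      using NA(1) False by (auto simp: S_def in_supp)
    have pi0: "?p $$ i0 \<noteq> 0"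
      by (rule symb_nth_degree[OF N]) (use i0(1) in \<open>simp_all add: v_def i0(3,4) algebra_simps\<close>)
    have vw: "v + w > N"
    proof -
      define k where "k = N - A"
      have k: "k \<ge> 1" "k \<ge> i0" using lt i0 by (simp_all add: k_def)
      have "v \<ge> int a * 1" unfolding v_def k_def[symmetric] using k by (intro mult_left_mono) auto
      moreover have "w \<ge> 2 * k"
      proof -
        have "int b * k \<ge> 2 * k" using k ab by (intro mult_right_mono) auto
        then show ?thesis using wb by (simp add: k_def)
      qed
      ultimately show ?thesis using k i0(3) by linarith
    qed
    then have br: "bracket v w ?p ?q = 0" using cw(2) by simp
    have "v * j = w * (- int a)" using botz br by simp
    then have "int a * (j * (N - A)) = int a * (- w)" by (simp add: v_def algebra_simps)
    moreover have "int a \<noteq> 0" using ab by simp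
    ultimately have "j * (N - A) = - w" by (metis mult_left_cancel)
    then have wj: "w = - j * (N - A)" by simp
    then have "N * ?dg j = N * (- j)" using je(2) by (simp add: algebra_simps)
    moreover have "N \<noteq> 0" using N by simp
    ultimately have dj: "?dg j = - j" by (metis mult_left_cancel)
    have "int b * (N - A) \<le> - j * (N - A)" using wb wj by simp
    then have "int b \<le> - j" using lt by (subst (asm) mult_le_cancel_right) simp
    then have "int b \<le> ?dg j" using dj by simp
    then have "j = - int b" using g[OF je(1)] by force
    then have w: "w = int b * (N - A)" "j = - int b" using wj by auto
    have "?p \<noteq> 0" "?q \<noteq> 0" using pa j by auto
    then obtain i1 p1 j1 q1 where pq: "?p = lau i1 p1" "coeff p1 0 \<noteq> 0" "?q = lau j1 q1" "coeff q1 0 \<noteq> 0"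
      using lau_exists[OF _ symb_finite] by metis
    have i1: "i1 = - int a"
    proof (rule antisym)
      show "i1 \<le> - int a" using pa unfolding pq(1) lau_nth by (metis not_le)
      show "- int a \<le> i1" using pl[of i1] pq(2) unfolding pq(1) lau_nth by force
    qed
    define D where "D = degree p1"
    have p1n: "coeff p1 n = ?p $$ (int n - int a)" for n
      unfolding pq(1) lau_nth i1 by simp
    have orders: "int a * int (order x (acp q1)) = int b * int (order x (acp p1))"
      if "x \<noteq> 0" for x
    proof -
      have "v * int (order x (acp q1)) = w * int (order x (acp p1))"
      proof (rule root_orders_proportional)
        show "bracket v w (lau i1 p1) (lau j1 q1) = 0" using br unfolding pq(1,3) .
      qed (use pq(2,4) that in auto)
      then have "(N - A) * (int a * int (order x (acp q1))) = (N - A) * (int b * int (order x (acp p1)))"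
        by (simp add: v_def w algebra_simps)
      then show ?thesis using lt by simp
    qed
    have Dpos: "D > 0"
    proof -
      have "coeff p1 (nat (i0 + int a)) \<noteq> 0" using pi0 N i0(3) unfolding p1n by simp
      then show ?thesis using N i0(3) le_degree[of p1 "nat (i0 + int a)"] by (simp add: D_def)
    qed
    define it where "it = int D - int a"
    have pit: "?p $$ it \<noteq> 0" using p1n[of D] pq(2) by (auto simp: it_def D_def)
    have ptop: "?p $$ n = 0" if "n > it" for n
      using that unfolding pq(1) lau_nth i1 by (auto simp: it_def D_def intro!: coeff_eq_0)
    have itne: "it \<noteq> - int a" using Dpos by (simp add: it_def)
    note te = symb_nth_degreeE[OF N wf pit]
    obtain jt where jt: "?q $$ jt \<noteq> 0" "\<And>n. n > jt \<Longrightarrow> ?q $$ n = 0"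
      using top_exponent[OF n0 symb_finite] by blast
    note je' = symb_nth_degreeE[OF N \<open>wle N A w g\<close> jt(1)]
    have "v * jt = w * it" using bracket_top_zero[OF _ pit jt(1) ptop jt(2)] br by simp
    then have "(N - A) * (int a * jt) = (N - A) * (int b * it)" by (simp add: v_def w algebra_simps)
    then have abt: "int a * jt = int b * it" using lt by simp
    have "N * (int a * ?dg jt) = int a * w - A * (int a * jt)" using je' by (simp add: algebra_simps)
    also have "\<dots> = int b * v - A * (int b * it)" unfolding abt by (simp add: v_def w algebra_simps)
    also have "\<dots> = N * (int b * ?df it)" using te by (simp add: algebra_simps)
    finally have "int a * ?dg jt = int b * ?df it" using N by simp
    then have "a * degree (comp g jt) = b * degree (comp f it)" by (metis of_nat_eq_iff of_nat_mult)
    then have "a dvd degree (comp f it)" using ab(3) by (metis coprime_dvd_mult_right_iff dvd_triv_left)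
    moreover have "degree (comp f it) < a" using f[of it] te itne by simp
    ultimately have dt: "degree (comp f it) = 0" by (meson nat_dvd_not_less not_gr0)
    have AD: "A * int D = N * int a" using te dt by (simp add: v_def it_def algebra_simps)
    have gap: "2 * D \<le> a * l" if "l > 0" "coeff p1 l \<noteq> 0" for l
    proof -
      define i where "i = int l - int a"
      have "?p $$ i \<noteq> 0" using that(2) by (simp add: p1n i_def)
      note e = symb_nth_degreeE[OF N wf this]
      have "?df i + 2 \<le> int a" using fi[of i] e that(1) by (simp add: i_def)
      then have "N * 2 \<le> N * (int a - ?df i)" using N by (intro mult_left_mono) auto
      also have "\<dots> = A * int l" using e by (simp add: v_def i_def algebra_simps)
      finally have "int a * (N * 2) \<le> int a * (A * int l)" by (intro mult_left_mono) auto
      then have "A * (2 * int D) \<le> A * (int a * int l)" using AD by (simp add: algebra_simps)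
      then have "2 * int D \<le> int a * int l" using A by simp
      then show ?thesis by (metis of_nat_le_iff of_nat_mult of_nat_numeral)
    qed
    have p1nz: "p1 \<noteq> 0" using pq(2) by auto
    show False
    proof (rule no_gap[of "acp p1" a])
      fix x assume x: "poly (acp p1) x = 0"
      have x0: "x \<noteq> 0"
      proof
        assume "x = 0"
        then have "to_ac (coeff p1 0) = 0" using x by (simp add: poly_0_coeff_0 acp_simps)
        then show False using pq(2) by simp
      qed
      have "a * order x (acp q1) = b * order x (acp p1)"
        using orders[OF x0] by (metis of_nat_eq_iff of_nat_mult)
      then have "a dvd order x (acp p1)" using ab(3) by (metis coprime_dvd_mult_right_iff dvd_triv_left)
      moreover have "order x (acp p1) \<noteq> 0" using x p1nz by (simp add: order_root acp_simps)
      ultimately show "a \<le> order x (acp p1)" by (simp add: dvd_imp_le)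
    next
      fix l assume "l > 0" "coeff (acp p1) l \<noteq> 0"
      then show "2 * degree (acp p1) \<le> a * l" using gap[of l] by (simp add: acp_simps D_def)
    qed (use pq(2) Dpos ab in \<open>auto simp: acp_simps D_def\<close>)
  qed
qed

section \<open>Removing the subleading term in Y\<close>

definition Xpoly :: "(nat \<Rightarrow> 'k::field_char_0) \<Rightarrow> nat \<Rightarrow> 'k skew"
  where "Xpoly r n = (\<Sum>k<n. homog [:r k:] (int k))"

lemma comp_Xpoly: "comp (Xpoly r n) i = (if 0 \<le> i \<and> i < int n then [:r (nat i):] else 0)"
proof -
  have "comp (Xpoly r n) i = (\<Sum>k<n. if k = nat i then (if 0 \<le> i then [:r (nat i):] else 0) else 0)"
    unfolding Xpoly_def comp_sum comp_homog by (intro sum.cong) auto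
  then show ?thesis by (auto simp: nat_less_iff)
qed

lemma Xpoly_sX: "Xpoly r n * sX = sX * Xpoly r n"
  unfolding Xpoly_def sX_def sum_distrib_left sum_distrib_right
  by (intro sum.cong) (simp_all add: add.commute)

text \<open>The substitution \<open>Y \<mapsto> Y - g(X)\<close>, with \<open>g\<close> given by its coefficients \<open>r\<close>, followed by the embedding.\<close>

locale y_shift =
  fixes r :: "nat \<Rightarrow> 'k::field_char_0" and n :: nat
begin

sublocale weyl_target "sconst :: 'k \<Rightarrow> 'k skew" sX "sY - Xpoly r n"
proof
  show "(sY - Xpoly r n) * sX - sX * (sY - Xpoly r n) = 1"
    using skew_relation Xpoly_sX[of r n] by (simp add: algebra_simps)
qed (rule sconst_simps sconst_central)+

text \<open>For the degree in \<open>h\<close>, that is for \<open>N = 1\<close> and \<open>A = 0\<close>, the substitution changes terms of lower degree only.\<close>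

definition close :: "int \<Rightarrow> 'k weyl \<Rightarrow> bool"
  where "close m P \<longleftrightarrow> wle 1 0 m (emb P) \<and> wle 1 0 (m - 1) (weyl_img P - emb P)"

lemma wle_weyl_img:
  assumes "close m P" shows "wle 1 0 m (weyl_img P)"
proof -
  have "wle 1 0 m (weyl_img P - emb P)" using assms wle_mono[of 1 0 "m - 1" "weyl_img P - emb P" m] by (simp add: close_def)
  from wle_add[OF this, of "emb P"] show ?thesis using assms by (simp add: close_def)
qed

lemma close_mono: "close m P \<Longrightarrow> m \<le> m' \<Longrightarrow> close m' P"
  unfolding close_def by (meson wle_mono diff_right_mono)

lemma close_zero: "close m 0"
  by (simp add: close_def emb.weyl_img_zero weyl_img_zero)

lemma close_add: "close m P \<Longrightarrow> close m Q \<Longrightarrow> close m (P + Q)"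
proof -
  assume "close m P" "close m Q"
  moreover have "weyl_img (P + Q) - emb (P + Q) = (weyl_img P - emb P) + (weyl_img Q - emb Q)"
    by (simp add: emb.weyl_img_add weyl_img_add)
  ultimately show ?thesis unfolding close_def by (simp only: emb.weyl_img_add wle_add)
qed

lemma close_mult:
  assumes "close m P" "close k Q"
  shows "close (m + k) (P * Q)"
proof -
  have diff: "weyl_img (P * Q) - emb (P * Q)
      = (weyl_img P - emb P) * weyl_img Q + emb P * (weyl_img Q - emb Q)"
    by (simp add: emb.weyl_img_mult weyl_img_mult algebra_simps)
  have 1: "wle 1 0 (m - 1 + k) ((weyl_img P - emb P) * weyl_img Q)"
    using symb_mult[of 1 0 "m - 1" "weyl_img P - emb P" k "weyl_img Q"] assms(1) wle_weyl_img[OF assms(2)] unfolding close_def by simp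
  have 2: "wle 1 0 (m + (k - 1)) (emb P * (weyl_img Q - emb Q))"
    using symb_mult[of 1 0 m "emb P" "k - 1" "weyl_img Q - emb Q"] assms unfolding close_def by simp
  have 3: "wle 1 0 (m + k) (emb P * emb Q)"
    using symb_mult[of 1 0 m "emb P" k "emb Q"] assms unfolding close_def by simp
  have "m - 1 + k = m + k - 1" "m + (k - 1) = m + k - 1" by simp_all
  with 1 2 have "wle 1 0 (m + k - 1) (weyl_img (P * Q) - emb (P * Q))"
    unfolding diff by (intro wle_add) simp_all
  with 3 show ?thesis unfolding close_def by (simp add: emb.weyl_img_mult)
qed

lemma wle_sconst: "wle 1 0 0 (sconst c)"
  by (auto simp: wle_iff_degree sconst_def comp_homog)

lemma wle_Xpoly: "wle 1 0 0 (Xpoly s m)"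
  by (auto simp: wle_iff_degree comp_Xpoly)

lemma close_const: "close 0 (weyl_const c)"
  by (simp add: close_def emb.weyl_img_const weyl_img_const wle_sconst)

lemma close_X: "close 0 weyl_X"
proof -
  have "wle 1 0 0 sX" by (auto simp: wle_iff_degree sX_def comp_homog)
  then show ?thesis by (simp add: close_def emb.weyl_img_X weyl_img_X)
qed

lemma close_Y: "close 1 weyl_Y"
proof -
  have "wle 1 0 1 sY" by (auto simp: wle_iff_degree sY_def comp_homog)
  then show ?thesis using wle_uminus[OF wle_Xpoly[of r n]]
    by (simp add: close_def emb.weyl_img_Y weyl_img_Y)
qed

lemma close_power: "close m P \<Longrightarrow> close (int k * m) (P ^ k)"
proof (induction k)
  case 0
  then show ?case using close_const[of 1] by (simp add: weyl_const_hom)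
next
  case (Suc k)
  then show ?case using close_mult[of m P "int k * m" "P ^ k"] by (simp add: algebra_simps)
qed

lemma close_hp: "close (int (degree p)) (hp p)"
proof (induction p)
  case (pCons c p)
  show ?case
  proof (cases "p = 0")
    case True
    then show ?thesis using close_const by (simp add: hp_pCons)
  next
    case False
    have "close 1 wH" unfolding wH_def using close_mult[OF close_Y close_X] by simp
    then have "close (1 + int (degree p)) (wH * hp p)" using pCons by (intro close_mult)
    moreover have "close (1 + int (degree p)) (weyl_const c)"
      using close_const by (rule close_mono) simp
    ultimately show ?thesis using False by (simp add: hp_pCons close_add)
  qed
qed (simp add: close_zero)

lemma close_homogeneous: "p \<noteq> 0 \<Longrightarrow> close (int (degree (p * cofactor i))) (homogeneous p i)"
proof -
  assume p: "p \<noteq> 0"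
  have d: "degree (p * cofactor i) = degree p + nat (- i)"
    using p by (simp add: degree_mult_eq degree_cofactor)
  show ?thesis
  proof (cases "i \<ge> 0")
    case True
    then show ?thesis using close_mult[OF close_hp[of p] close_power[OF close_X, of "nat i"]] d
      by (simp add: homogeneous_def)
  next
    case False
    then show ?thesis using close_mult[OF close_hp[of p] close_power[OF close_Y, of "nat (- i)"]] d
      by (simp add: homogeneous_def)
  qed
qed

lemma close_if_wle:
  assumes "wle 1 0 m (emb P)"
  shows "close m P"
proof -
  obtain p I where P: "finite I" "P = (\<Sum>i\<in>I. homogeneous (p i) i)"
    using homsum_all[of P] unfolding homsum_def by blast
  have c: "comp (emb P) i = p i * cofactor i" if "i \<in> I" for i
    using P(1) that by (simp add: P(2) emb.weyl_img_simps emb_homogeneous comp_sum comp_homog)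
  have h: "close m (homogeneous (p i) i)" if "i \<in> I" for i
  proof (cases "p i = 0")
    case False
    then have "comp (emb P) i \<noteq> 0" using c[OF that] by simp
    then have "1 * int (degree (comp (emb P) i)) + 0 * i \<le> m"
      using assms unfolding wle_iff_degree[OF zero_less_one] by blast
    then show ?thesis using close_mono[OF close_homogeneous[OF False, of i]] c[OF that] by simp
  qed (simp add: close_zero)
  have "close m (\<Sum>i\<in>J. homogeneous (p i) i)" if "finite J" "J \<subseteq> I" for J
    using that by (induction J) (simp_all add: close_zero close_add h)
  then show ?thesis using P by simp
qed

text \<open>Binomial expansion to first order: \<open>(Y - g)\<^sup>a\<^sup>+\<^sup>1 = Y\<^sup>a\<^sup>+\<^sup>1 - (a + 1) g Y\<^sup>a + \<dots>\<close>.\<close>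

lemma shifted_Y_power:
  "symb 1 0 (int a) ((sY - Xpoly r n) ^ Suc a - sY ^ Suc a)
    = - (of_nat (Suc a) * symb 1 0 0 (Xpoly r n) * lmono 1 (- int a))
   \<and> wle 1 0 (int a) ((sY - Xpoly r n) ^ Suc a - sY ^ Suc a)"
proof (induction a)
  case 0
  show ?case using wle_uminus[OF wle_Xpoly[of r n]] by (simp add: lmono_def)
next
  case (Suc a)
  let ?Z = "sY - Xpoly r n"
  let ?E = "?Z ^ Suc a - sY ^ Suc a"
  have split: "?Z ^ Suc (Suc a) - sY ^ Suc (Suc a) = ?Z * ?E - Xpoly r n * sY ^ Suc a"
    by (simp add: algebra_simps)
  have wZ: "wle 1 0 1 ?Z" using wle_weyl_img[OF close_Y] by (simp add: weyl_img_Y)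
  have wY: "wle 1 0 1 (sY :: 'k skew)" by (auto simp: wle_iff_degree sY_def comp_homog)
  have var: "[:0, 1 :: 'k:] = monom 1 1" by (simp add: monom_altdef)
  have sY1: "symb 1 0 1 (sY :: 'k skew) = lmono 1 (- 1)"
    unfolding sY_def var by (subst symb_monomial) simp_all
  have "symb 1 0 1 (Xpoly r n) = 0" by (rule symb_above[OF _ wle_Xpoly]) simp_all
  then have sZ1: "symb 1 0 1 ?Z = lmono 1 (- 1)" using sY1 by simp
  have pw: "lmono 1 (- 1) ^ k = (lmono 1 (- int k) :: 'k fls)" for k
    by (induction k) (simp_all add: lmono_mult lmono_def[of 1 0])
  have 1: "symb 1 0 (1 + int a) (?Z * ?E) = lmono 1 (- 1) * - (of_nat (Suc a) * symb 1 0 0 (Xpoly r n) * lmono 1 (- int a))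
      \<and> wle 1 0 (1 + int a) (?Z * ?E)"
    using symb_mult[OF _ wZ conjunct2[OF Suc]] unfolding conjunct1[OF Suc] sZ1 by simp
  have 2: "symb 1 0 (0 + int (Suc a) * 1) (Xpoly r n * sY ^ Suc a) = symb 1 0 0 (Xpoly r n) * lmono 1 (- int (Suc a))
      \<and> wle 1 0 (0 + int (Suc a) * 1) (Xpoly r n * sY ^ Suc a)"
  proof -
    have sp: "symb 1 0 (int (Suc a) * 1) ((sY :: 'k skew) ^ Suc a) = lmono 1 (- int (Suc a))"
      using symb_power[OF zero_less_one wY, of "Suc a"] unfolding sY1 pw by blast
    show ?thesis
      using symb_mult[OF zero_less_one wle_Xpoly[of r n] conjunct2[OF symb_power[OF zero_less_one wY, of "Suc a"]]]
      unfolding sp .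
  qed
  have lm: "lmono 1 (- 1) * lmono 1 (- int a) = (lmono 1 (- int (Suc a)) :: 'k fls)" by (simp add: lmono_mult)
  define g where "g = symb 1 0 0 (Xpoly r n)"
  have "symb 1 0 (int (Suc a)) (?Z ^ Suc (Suc a) - sY ^ Suc (Suc a))
      = lmono 1 (- 1) * - (of_nat (Suc a) * g * lmono 1 (- int a)) - g * lmono 1 (- int (Suc a))"
    unfolding split using 1 2 by (simp add: g_def del: power_Suc)
  also have "\<dots> = - (of_nat (Suc (Suc a)) * g * (lmono 1 (- 1) * lmono 1 (- int a)))"
    unfolding lm[symmetric] by (simp add: algebra_simps)
  finally have "symb 1 0 (int (Suc a)) (?Z ^ Suc (Suc a) - sY ^ Suc (Suc a))
      = - (of_nat (Suc (Suc a)) * g * lmono 1 (- int (Suc a)))" unfolding lm .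
  moreover have "wle 1 0 (int (Suc a)) (?Z ^ Suc (Suc a) - sY ^ Suc (Suc a))"
    unfolding split using 1 2 by (intro wle_diff) (simp_all del: power_Suc)
  ultimately show ?case by (simp add: g_def)
qed

end

lemma lead_coeff_cofactor: "coeff (cofactor i :: 'k::field_char_0 poly) (nat (- i)) = 1"
proof -
  have "lead_coeff (cofactor i :: 'k poly) = 1"
    unfolding cofactor_def lead_coeff_prod by simp
  then show ?thesis by (simp add: degree_cofactor)
qed

text \<open>With \<open>P = c Y\<^sup>a + p(X) Y\<^sup>a\<^sup>-\<^sup>1 + \<dots>\<close> and \<open>g = p / (c a)\<close>, substituting \<open>Y - g(X)\<close> for \<open>Y\<close> reduces the pair to
  the preceding case.\<close>

lemma coprime_monic_pair_impossible:
  fixes P Q :: "'k::field_char_0 weyl" and a b :: nat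
  assumes comm: "commutator P Q = 1" and ab: "a \<ge> 2" "b \<ge> 2" "coprime a b"
    and Pa: "comp (emb P) (- int a) \<noteq> 0" "degree (comp (emb P) (- int a)) = a"
    and P: "\<And>i. comp (emb P) i \<noteq> 0 \<Longrightarrow> i \<noteq> - int a \<Longrightarrow> degree (comp (emb P) i) < a"
    and Qb: "comp (emb Q) (- int b) \<noteq> 0" "degree (comp (emb Q) (- int b)) = b"
    and Q: "\<And>i. comp (emb Q) i \<noteq> 0 \<Longrightarrow> i \<noteq> - int b \<Longrightarrow> degree (comp (emb Q) i) < b"
  shows False
proof -
  obtain a' where a': "a = Suc a'" using ab by (cases a) auto
  define c where "c = coeff (comp (emb P) (- int a)) a"
  have c: "c \<noteq> 0" using Pa by (metis c_def leading_coeff_0_iff)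
  \<comment> \<open>In degree \<open>a' = a - 1\<close> the monomial \<open>X\<^sup>k Y\<^sup>a\<^sup>-\<^sup>1\<close> lies in the component of degree \<open>k - a'\<close>.\<close>
  define r where "r k = coeff (comp (emb P) (int k - int a')) a' / (c * of_nat a)" for k
  obtain n where n: "\<And>i. i \<in> supp (emb P) \<Longrightarrow> i + int a' < int n"
  proof -
    have "i + int a' < int (nat (Max (supp (emb P)) + int a' + 1))" if "i \<in> supp (emb P)" for i
      using Max_ge[OF finite_supp that] by linarith
    then show ?thesis using that by blast
  qed
  interpret sh: y_shift r n .
  define f where "f = sh.weyl_img P"
  define g where "g = sh.weyl_img Q"
  have comm': "f * g - g * f = 1" unfolding f_def g_def using sh.weyl_img_commutator[OF comm] .
  have stableX: "stable (Xpoly r n)" by (auto simp: stable_def comp_Xpoly)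
  have "stable (sY - Xpoly r n)"
    using stable_sY stableX by (simp add: stable_def)
  then have stable_img: "stable (sh.weyl_img Z)" for Z
    by (induction Z rule: weyl_induct) (simp_all add: sh.weyl_img_simps stable_add stable_mult stable_sconst stable_sX)
  have wP: "wle 1 0 (int a) (emb P)" unfolding wle_iff_degree[OF zero_less_one]
    using P Pa by (metis add.right_neutral mult_1 mult_zero_left of_nat_le_iff order.order_iff_strict)
  have wQ: "wle 1 0 (int b) (emb Q)" unfolding wle_iff_degree[OF zero_less_one]
    using Q Qb by (metis add.right_neutral mult_1 mult_zero_left of_nat_le_iff order.order_iff_strict)
  have same_top: "degree (comp (sh.weyl_img Z) i) \<le> m \<and> coeff (comp (sh.weyl_img Z) i) m = coeff (comp (emb Z) i) m"
    if "wle 1 0 (int m) (emb Z)" for Z m i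
  proof -
    have cl: "sh.close (int m) Z" using that by (rule sh.close_if_wle)
    have "coeff (comp (sh.weyl_img Z - emb Z) i) m = 0"
      using cl unfolding sh.close_def wle_def by force
    moreover have "degree (comp (sh.weyl_img Z) i) \<le> m"
      using sh.wle_weyl_img[OF cl] unfolding wle_iff_degree[OF zero_less_one]
      by (cases "comp (sh.weyl_img Z) i = 0") auto
    ultimately show ?thesis by simp
  qed
  have exact: "comp (sh.weyl_img Z) (- int m) \<noteq> 0 \<and> degree (comp (sh.weyl_img Z) (- int m)) = m"
    if "wle 1 0 (int m) (emb Z)" "comp (emb Z) (- int m) \<noteq> 0" "degree (comp (emb Z) (- int m)) = m" for Z m
  proof -
    have "coeff (comp (emb Z) (- int m)) m \<noteq> 0" using that(2,3) by (metis leading_coeff_0_iff)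
    then show ?thesis using same_top[OF that(1), of "- int m"] by (metis coeff_0 le_antisym le_degree)
  qed
  have less: "degree (comp (sh.weyl_img Z) i) < m"
    if "wle 1 0 (int m) (emb Z)" "comp (emb Z) i \<noteq> 0 \<Longrightarrow> degree (comp (emb Z) i) < m" "m > 0" for Z m i
  proof -
    have "coeff (comp (emb Z) i) m = 0"
      using that(2) by (cases "comp (emb Z) i = 0") (auto simp: coeff_eq_0)
    then have "coeff (comp (sh.weyl_img Z) i) m = 0" "degree (comp (sh.weyl_img Z) i) \<le> m"
      using same_top[OF that(1), of i] by auto
    then show ?thesis using that(3)
      by (metis le_neq_implies_less leading_coeff_0_iff degree_0)
  qed
  have second: "coeff (comp f i) a' = 0" if ne: "i \<noteq> - int a" for i
  proof -
    define P' where "P' = P - weyl_const c * weyl_Y ^ a"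
    have embP': "comp (emb P') k = comp (emb P) k - (if k = - int a then smult c (cofactor (- int a)) else 0)" for k
      by (simp add: P'_def emb.weyl_img_simps sY_power comp_sconst_times comp_homog)
    have lowdeg: "degree (comp (emb P') k) < a \<or> comp (emb P') k = 0" for k
    proof (cases "k = - int a")
      case True
      have "coeff (comp (emb P') k) a = 0"
        unfolding embP' using True lead_coeff_cofactor[of "- int a", where 'k = 'k] by (simp add: c_def)
      moreover have "degree (comp (emb P') k) \<le> a"
        unfolding embP' using True Pa degree_cofactor[of "- int a", where 'k = 'k]
        by (intro degree_diff_le) (auto intro: order_trans[OF degree_smult_le])
      ultimately show ?thesis by (metis leading_coeff_0_iff le_neq_implies_less)
    next
      case False
      then show ?thesis using P[of k] embP' by auto
    qed
    have wP': "wle 1 0 (int a') (emb P')" unfolding wle_iff_degree[OF zero_less_one]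
      using lowdeg by (auto simp: a' less_Suc_eq_le)
    have cl: "sh.close (int a') P'" using wP' by (rule sh.close_if_wle)
    define E where "E = (sY - Xpoly r n) ^ a - sY ^ a"
    have f: "f = emb P + (sconst c * E + (sh.weyl_img P' - emb P'))"
      unfolding f_def E_def P'_def
      by (simp add: sh.weyl_img_simps emb.weyl_img_simps algebra_simps)
    have "coeff (comp (sh.weyl_img P' - emb P') i) a' = 0"
      using cl unfolding sh.close_def wle_def by force
    then have fc: "coeff (comp f i) a' = coeff (comp (emb P) i) a' + c * coeff (comp E i) a'"
      unfolding f by (simp add: comp_sconst_times)
    have sE: "symb 1 0 (int a') E = - (of_nat a * symb 1 0 0 (Xpoly r n) * lmono 1 (- int a'))"
      using sh.shifted_Y_power[of a'] unfolding E_def a' by blast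
    have "coeff (comp E i) a' = symb 1 0 (int a') E $$ i" by (simp add: symb_nth)
    also have "\<dots> = - (of_nat a * (symb 1 0 0 (Xpoly r n) * lmono 1 (- int a')) $$ i)"
      unfolding sE by (simp add: mult.assoc fls_of_nat)
    also have "(symb 1 0 0 (Xpoly r n) * lmono 1 (- int a')) $$ i = symb 1 0 0 (Xpoly r n) $$ (i + int a')"
      by (subst fls_times_nth_single[where i = "i + int a'"]) (auto simp: lmono_nth split: if_splits)
    also have "\<dots> = coeff (comp (Xpoly r n) (i + int a')) 0" by (simp add: symb_nth)
    finally have Ei: "coeff (comp E i) a' = - (of_nat a * coeff (comp (Xpoly r n) (i + int a')) 0)" .
    consider "i < - int a" | "- int a' \<le> i" "i + int a' < int n" | "- int a' \<le> i" "i + int a' \<ge> int n"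
      using ne a' by linarith
    then show ?thesis
    proof cases
      case 1
      have "comp f i = 0"
      proof (rule ccontr)
        assume "comp f i \<noteq> 0"
        then have "- i \<le> int (degree (comp f i))" using stable_degree[of f i] stable_img f_def by simp
        moreover have "degree (comp f i) \<le> a" using same_top[OF wP] by (simp add: f_def)
        ultimately show False using 1 by simp
      qed
      then show ?thesis by simp
    next
      case 2
      then have "coeff (comp (Xpoly r n) (i + int a')) 0 = coeff (comp (emb P) i) a' / (c * of_nat a)"
        by (simp add: comp_Xpoly r_def)
      then show ?thesis unfolding fc Ei using c ab by simp
    next
      case 3
      then have "i \<notin> supp (emb P)" using n[of i] by auto
      then show ?thesis unfolding fc Ei using 3 by (simp add: in_supp comp_Xpoly)
    qed
  qed
  show False
  proof (rule reduced_pair_impossible[OF comm' _ _ ab])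
    show "stable f" "stable g" using stable_img by (simp_all add: f_def g_def)
    show "comp f (- int a) \<noteq> 0" "degree (comp f (- int a)) = a"
      using exact[OF wP Pa] by (simp_all add: f_def)
    show "comp g (- int b) \<noteq> 0" "degree (comp g (- int b)) = b"
      using exact[OF wQ Qb] by (simp_all add: g_def)
    show "degree (comp g i) < b" if "i \<noteq> - int b" for i
      unfolding g_def using less[OF wQ, of i] Q[OF _ that] ab by auto
    fix i assume i: "comp f i \<noteq> 0" "i \<noteq> - int a"
    have "degree (comp f i) < a"
      unfolding f_def using less[OF wP, of i] P[OF _ i(2)] ab by auto
    moreover have "degree (comp f i) \<noteq> a'" using second[OF i(2)] i(1) by (metis leading_coeff_0_iff)
    ultimately show "degree (comp f i) + 2 \<le> a" using a' by linarith
  qed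
qed

section \<open>Comparing the Newton polygons of P and Q\<close>

text \<open>The end points of the edges of \<open>f\<close> and \<open>g\<close> correspond, scaled by \<open>w / v\<close>.\<close>

lemma matching_vertex:
  assumes N: "N > 0" and v: "v > 0" and f: "wle N A v f" and g: "wle N A w g" "symb N A w g \<noteq> 0"
    and br: "bracket v w (symb N A v f) (symb N A w g) = 0"
    and i: "symb N A v f $$ i \<noteq> 0"
      "(\<forall>n>i. symb N A v f $$ n = 0) \<or> (\<forall>n<i. symb N A v f $$ n = 0)"
  obtains j where "comp g j \<noteq> 0" "v * j = w * i" "v * int (degree (comp g j)) = w * int (degree (comp f i))"
proof -
  let ?p = "symb N A v f" and ?q = "symb N A w g"
  obtain n0 where n0: "?q $$ n0 \<noteq> 0" using g(2) by (metis fls_eqI fls_zero_nth)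
  have "\<exists>j. ?q $$ j \<noteq> 0 \<and> v * j = w * i"
    using i(2)
  proof
    assume top: "\<forall>n>i. ?p $$ n = 0"
    obtain j where "?q $$ j \<noteq> 0" "\<And>n. n > j \<Longrightarrow> ?q $$ n = 0"
      using top_exponent[OF n0 symb_finite] by blast
    then show ?thesis using bracket_top_zero[of v w ?p ?q i j] i(1) top br by auto
  next
    assume bottom: "\<forall>n<i. ?p $$ n = 0"
    obtain j where "?q $$ j \<noteq> 0" "\<And>n. n < j \<Longrightarrow> ?q $$ n = 0"
      using bottom_exponent[OF n0 symb_finite] by blast
    then show ?thesis using bracket_bottom_zero[of v w ?p ?q i j] i(1) bottom br by auto
  qed
  then obtain j where j: "?q $$ j \<noteq> 0" "v * j = w * i" by blast
  note gj = symb_nth_degreeE[OF N g(1) j(1)] and fi = symb_nth_degreeE[OF N f i(1)]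
  define d e where "d = int (degree (comp f i))" and "e = int (degree (comp g j))"
  have d: "v = N * d + A * i" and e: "w = N * e + A * j" using fi gj by (simp_all add: d_def e_def)
  have "v * w = v * (N * e + A * j)" using e by simp
  then have "N * (v * e) = v * w - A * (v * j)" by (simp add: algebra_simps)
  also have "\<dots> = w * (v - A * i)" unfolding j(2) by (simp add: algebra_simps)
  also have "v - A * i = N * d" using d by simp
  finally have "N * (v * e) = N * (w * d)" by simp
  then have "v * e = w * d" using N by simp
  then show ?thesis using that gj j(2) by (auto simp: d_def e_def)
qed

text \<open>At either weight \<open>g\<close> has a monomial on the ray through the common vertex of the two edges of \<open>f\<close>. The one found at the
  first weight bounds the weight of \<open>g\<close> at the second, and conversely.\<close>

lemma common_vertex_ratio:
  assumes N: "N1 > 0" "N2 > 0" and v: "v1 > 0" "v2 > 0"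
    and f: "wle N1 A1 v1 f" "wle N2 A2 v2 f"
    and g: "wle N1 A1 w1 g" "symb N1 A1 w1 g \<noteq> 0" "wle N2 A2 w2 g" "symb N2 A2 w2 g \<noteq> 0"
    and br: "bracket v1 w1 (symb N1 A1 v1 f) (symb N1 A1 w1 g) = 0"
      "bracket v2 w2 (symb N2 A2 v2 f) (symb N2 A2 w2 g) = 0"
    and i1: "symb N1 A1 v1 f $$ i \<noteq> 0" "\<forall>n>i. symb N1 A1 v1 f $$ n = 0"
    and i2: "symb N2 A2 v2 f $$ i \<noteq> 0" "\<forall>n<i. symb N2 A2 v2 f $$ n = 0"
  shows "v1 * w2 = v2 * w1"
proof (rule antisym)
  let ?d = "int (degree (comp f i))"
  have d: "v1 = N1 * ?d + A1 * i" "v2 = N2 * ?d + A2 * i"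
    using symb_nth_degreeE[OF N(1) f(1) i1(1)] symb_nth_degreeE[OF N(2) f(2) i2(1)] by auto
  obtain j where j: "comp g j \<noteq> 0" "v1 * j = w1 * i" "v1 * int (degree (comp g j)) = w1 * ?d"
    using matching_vertex[OF N(1) v(1) f(1) g(1,2) br(1) i1(1)] i1(2) by blast
  have "N2 * int (degree (comp g j)) + A2 * j \<le> w2"
    using g(3) j(1) wle_iff_degree[OF N(2)] by blast
  then have "v1 * (N2 * int (degree (comp g j)) + A2 * j) \<le> v1 * w2" using v by simp
  moreover have "v1 * (N2 * int (degree (comp g j)) + A2 * j)
      = N2 * (v1 * int (degree (comp g j))) + A2 * (v1 * j)" by (simp add: algebra_simps)
  moreover have "\<dots> = w1 * v2" unfolding j d(2) by (simp add: algebra_simps)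
  ultimately show "v2 * w1 \<le> v1 * w2" by (simp add: mult.commute)
  obtain k where k: "comp g k \<noteq> 0" "v2 * k = w2 * i" "v2 * int (degree (comp g k)) = w2 * ?d"
    using matching_vertex[OF N(2) v(2) f(2) g(3,4) br(2) i2(1)] i2(2) by blast
  have "N1 * int (degree (comp g k)) + A1 * k \<le> w1"
    using g(1) k(1) wle_iff_degree[OF N(1)] by blast
  then have "v2 * (N1 * int (degree (comp g k)) + A1 * k) \<le> v2 * w1" using v by simp
  moreover have "v2 * (N1 * int (degree (comp g k)) + A1 * k)
      = N1 * (v2 * int (degree (comp g k))) + A1 * (v2 * k)" by (simp add: algebra_simps)
  moreover have "\<dots> = w2 * v1" unfolding k d(1) by (simp add: algebra_simps)
  ultimately show "v1 * w2 \<le> v2 * w1" by (simp add: mult.commute)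
qed

text \<open>From \<open>v : w = a : b\<close> one gets \<open>a ord q = b ord p\<close> at every nonzero root.\<close>

lemma root_of_symbol:
  fixes p q :: "'k::field_char_0 fls" and a b :: nat
  assumes fin: "finite {n. p $$ n \<noteq> 0}" "finite {n. q $$ n \<noteq> 0}" and q: "q \<noteq> 0"
    and br: "bracket v w p q = 0" and vw: "v * int b = w * int a" and v: "v > 0" and ab: "coprime a b"
    and i: "p $$ i \<noteq> 0" "p $$ i' \<noteq> 0" "i < i'"
  obtains f b1 x where "p = lau f b1" "coeff b1 0 \<noteq> 0" "degree b1 > 0" "poly (acp b1) x = 0"
    "\<And>x. poly (acp b1) x = 0 \<Longrightarrow> a dvd order x (acp b1) \<and> order x (acp b1) > 0
       \<and> order x (acp b1) < card {n. p $$ n \<noteq> 0}"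
proof -
  have "p \<noteq> 0" using i by auto
  then obtain f p1 where p1: "p = lau f p1" "coeff p1 0 \<noteq> 0" using lau_exists fin(1) by metis
  obtain j q1 where q1: "q = lau j q1" "coeff q1 0 \<noteq> 0" using lau_exists[OF q fin(2)] by metis
  have nz: "p1 \<noteq> 0" "q1 \<noteq> 0" using p1 q1 by auto
  have "degree p1 > 0"
  proof -
    have "f \<le> i" "coeff p1 (nat (i' - f)) \<noteq> 0"
      using i unfolding p1(1) lau_nth by (auto split: if_splits)
    then show ?thesis using i(3) le_degree[of p1 "nat (i' - f)"] by linarith
  qed
  moreover then have "degree (acp p1) > 0" by (simp add: acp_simps)
  then obtain x0 where "poly (acp p1) x0 = 0" using alg_closed_imp_poly_has_root[of "acp p1"] by auto
  moreover have "a dvd order x (acp p1) \<and> order x (acp p1) > 0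
       \<and> order x (acp p1) < card {n. p $$ n \<noteq> 0}" if x: "poly (acp p1) x = 0" for x
  proof -
    have x0: "x \<noteq> 0"
    proof
      assume "x = 0"
      then have "to_ac (coeff p1 0) = 0" using x by (simp add: poly_0_coeff_0 acp_simps)
      then show False using p1(2) by simp
    qed
    let ?m = "order x (acp p1)" and ?n = "order x (acp q1)"
    have "v * int ?n = w * int ?m"
      by (rule root_orders_proportional[OF br[unfolded p1(1) q1(1)] nz x0])
    then have "v * (int a * int ?n) = (w * int a) * int ?m" by (simp add: algebra_simps)
    then have "v * (int a * int ?n) = v * (int b * int ?m)" unfolding vw[symmetric] by (simp add: algebra_simps)
    then have "int a * int ?n = int b * int ?m" using v by simp
    then have "a * ?n = b * ?m" by (metis of_nat_eq_iff of_nat_mult)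
    then have "a dvd ?m" using ab by (metis coprime_dvd_mult_right_iff dvd_triv_left)
    moreover have "?m > 0" using x nz by (simp add: order_root acp_simps)
    moreover have "?m < card {n. coeff (acp p1) n \<noteq> 0}"
      by (rule order_less_terms) (use nz x0 in \<open>simp_all add: acp_simps\<close>)
    moreover have "card {n. coeff (acp p1) n \<noteq> 0} = card {n. p $$ n \<noteq> 0}"
      unfolding p1(1) lau_support_card by (simp add: acp_simps)
    ultimately show ?thesis by simp
  qed
  ultimately show ?thesis using that p1 by blast
qed

lemma wle_rot:
  assumes N: "N > 0" and "wle N A v (emb P)"
  shows "wle N (N - A) v (emb (rot P))"
  unfolding wle_iff_degree[OF N]
proof (intro allI impI)
  fix i assume "comp (emb (rot P)) i \<noteq> 0"
  with comp_rot[of P "- i"] have nz: "comp (emb P) (- i) \<noteq> 0"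
    and d: "int (degree (comp (emb (rot P)) i)) = int (degree (comp (emb P) (- i))) - i"
    by auto
  have "N * int (degree (comp (emb P) (- i))) + A * (- i) \<le> v"
    using assms(2) nz wle_iff_degree[OF N] by blast
  then show "N * int (degree (comp (emb (rot P)) i)) + (N - A) * i \<le> v"
    unfolding d by (simp add: algebra_simps)
qed

text \<open>Since the exponents of \<open>X\<close> are nonnegative, the bound on the weight confines \<open>P\<close> to the triangle below the edge
  that starts at \<open>Y\<^sup>a\<close>, so \<open>Y\<^sup>a\<close> is its only term of degree \<open>a\<close> in \<open>Y\<close>.\<close>

lemma generate_triangle:
  fixes P Q :: "'k::field_char_0 weyl" and a b :: nat
  assumes comm: "commutator P Q = 1" and NA: "A > 0" "A < N"
    and P: "wle N A (int a * (N - A)) (emb P)" "comp (emb P) (- int a) \<noteq> 0" "degree (comp (emb P) (- int a)) = a"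
    and Q: "wle N A (int b * (N - A)) (emb Q)" "comp (emb Q) (- int b) \<noteq> 0" "degree (comp (emb Q) (- int b)) = b"
    and ab: "coprime a b" "a \<ge> 2" "b \<ge> 1"
  shows "weyl_subalgebra {P, Q} = UNIV"
proof -
  have N: "N > 0" using NA by simp
  have bound: "degree (comp (emb Z) i) < m \<or> degree (comp (emb Z) i) = m \<and> i = - int m"
    if Z: "wle N A (int m * (N - A)) (emb Z)" "comp (emb Z) i \<noteq> 0" for Z i m
  proof -
    define d where "d = int (degree (comp (emb Z) i))"
    have di: "d + i \<ge> 0" using stable_degree[OF stable_emb Z(2)] by (simp add: d_def)
    have "N * d + A * i \<le> int m * (N - A)" using Z wle_iff_degree[OF N] unfolding d_def by blast
    then have le: "(N - A) * d + A * (d + i) \<le> (N - A) * int m" by (simp add: algebra_simps)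
    have nn: "A * (d + i) \<ge> 0" using NA di by simp
    then have "(N - A) * d \<le> (N - A) * int m" using le by linarith
    then have dm: "d \<le> int m" using NA by simp
    show ?thesis
    proof (cases "d = int m")
      case True
      then have "A * (d + i) \<le> 0" using le by simp
      then have "d + i = 0" using NA di by (simp add: mult_le_0_iff)
      then show ?thesis using True by (simp add: d_def)
    next
      case False
      then show ?thesis using dm by (simp add: d_def)
    qed
  qed
  show ?thesis
  proof (cases "b = 1")
    case True
    have "affine (emb Q)" unfolding affine_def
    proof (intro conjI allI impI)
      show "comp (emb Q) (- 1) \<noteq> 0" using Q True by simp
      fix i assume i: "comp (emb Q) i \<noteq> 0"
      show "i = - 1 \<and> degree (comp (emb Q) i) = 1 \<or> 0 \<le> i \<and> degree (comp (emb Q) i) = 0"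
        using bound[OF Q(1) i] True stable_degree[OF stable_emb i] by auto
    qed
    then show ?thesis by (rule generate_affine[OF comm])
  next
    case False
    then have "b \<ge> 2" using ab by simp
    then have False
      using coprime_monic_pair_impossible[OF comm ab(2) _ ab(1) P(2,3) _ Q(2,3)] bound[OF P(1)] bound[OF Q(1)]
      by blast
    then show ?thesis ..
  qed
qed

section \<open>Sums of at most four homogeneous elements\<close>

text \<open>Here the weight of \<open>P\<close> does not divide that of \<open>Q\<close>. In the coordinates of the lattice points \<open>(i, d)\<close> for \<open>h\<^sup>d X\<^sup>i\<close>,
  the edge runs from \<open>a (- r', dr)\<close> to \<open>a (s', ds)\<close> with \<open>dr \<ge> r'\<close>, and \<open>v < a N\<close> becomes
  \<open>ds r' + dr s' < r' + s'\<close>. This leaves \<open>ds = 0\<close> together with \<open>r' = dr = 1\<close> or \<open>s' = 1\<close>, \<open>dr = r'\<close>.\<close>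

lemma generate_unless_divisible:
  fixes P Q :: "'k::field_char_0 weyl" and a b :: nat
  assumes comm: "commutator P Q = 1" and two: "two_sided (emb P)" "two_sided (emb Q)"
    and N: "N > 0" and f: "wle N A v (emb P)" and g: "wle N A w (emb Q)" "symb N A w (emb Q) \<noteq> 0"
    and vw: "v + w > N" "v = int a * m" "w = int b * m" "m > 0" and ab: "coprime a b" "a \<ge> 2"
    and i0: "symb N A v (emb P) $$ i0 \<noteq> 0" "\<And>i. i < i0 \<Longrightarrow> comp (emb P) i = 0"
    and i1: "symb N A v (emb P) $$ i1 \<noteq> 0" "i0 < i1"
    and four: "card (supp (emb P)) \<le> 4"
  shows "weyl_subalgebra {P, Q} = UNIV"
proof -
  let ?f = "emb P" and ?g = "emb Q"
  let ?p = "symb N A v ?f" and ?q = "symb N A w ?g"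
  let ?d = "\<lambda>i. int (degree (comp ?f i))"
  have comm': "?f * ?g - ?g * ?f = 1" by (rule emb.weyl_img_commutator[OF comm])
  have v: "v > 0" using two_sided_weight(1)[OF two(1) stable_emb N f] .
  have w: "w > 0" using two_sided_weight(1)[OF two(2) stable_emb N g(1)] .
  then have b: "b \<ge> 1" using vw(3) by (cases b) auto
  have br: "bracket v w ?p ?q = 0" using weights_commutator_one(2)[OF N comm' f g(1)] vw(1) by simp
  have vb: "v * int b = w * int a" by (simp add: vw)
  obtain e0 p1 x0 where p1: "?p = lau e0 p1" "coeff p1 0 \<noteq> 0" "degree p1 > 0" "poly (acp p1) x0 = 0"
    and ord: "\<And>x. poly (acp p1) x = 0 \<Longrightarrow> a dvd order x (acp p1) \<and> order x (acp p1) > 0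
       \<and> order x (acp p1) < card {n. ?p $$ n \<noteq> 0}"
    using root_of_symbol[OF symb_finite symb_finite g(2) br vb v ab(1) i0(1) i1(1,2)] by blast
  have sub: "{n. ?p $$ n \<noteq> 0} \<subseteq> supp ?f" using symb_nth_degreeE[OF N f] by (auto simp: in_supp)
  have cle: "card {n. ?p $$ n \<noteq> 0} \<le> card (supp ?f)" using sub by (intro card_mono) simp_all
  have ord_a: "order x (acp p1) = a" if x: "poly (acp p1) x = 0" for x
  proof -
    obtain k where k: "order x (acp p1) = a * k" using ord[OF x] by (auto elim: dvdE)
    have "a * k \<le> 3" "k > 0" using ord[OF x] cle four k by auto
    moreover have "k < 2"
    proof (rule ccontr)
      assume "\<not> k < 2"
      then have "2 * 2 \<le> a * k" using ab(2) by (intro mult_le_mono) auto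
      then show False using \<open>a * k \<le> 3\<close> by simp
    qed
    ultimately show ?thesis using k by (cases k) auto
  qed
  have three: "card {n. ?p $$ n \<noteq> 0} \<ge> 3" using ord[OF p1(4)] ord_a[OF p1(4)] ab(2) by simp
  have e0: "e0 = i0"
  proof (rule antisym)
    show "e0 \<le> i0" using i0(1) unfolding p1(1) lau_nth by (metis not_le)
    show "i0 \<le> e0"
    proof (rule ccontr)
      assume "\<not> i0 \<le> e0"
      then have "comp ?f e0 = 0" using i0(2) by simp
      then have "?p $$ e0 = 0" by (simp add: symb_nth)
      then show False using p1(2) unfolding p1(1) lau_nth by simp
    qed
  qed
  have i0neg: "i0 < 0"
  proof -
    obtain k where "k < 0" "comp ?f k \<noteq> 0" using two(1) two_sided_def by blast
    then show ?thesis using i0(2)[of k] by force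
  qed
  define it where "it = i0 + int (degree p1)"
  have pit: "?p $$ it \<noteq> 0" using p1(2) unfolding p1(1) lau_nth it_def e0 by auto
  have ptop: "?p $$ n = 0" if "n > it" for n
    using that unfolding p1(1) lau_nth e0 it_def by (auto intro!: coeff_eq_0)
  have pbot: "?p $$ n = 0" if "n < i0" for n using i0(2)[OF that] by (simp add: symb_nth)
  note fit = symb_nth_degreeE[OF N f pit] and fi0 = symb_nth_degreeE[OF N f i0(1)]
  show ?thesis
  proof (cases "\<exists>s\<in>supp ?f. s > it")
    case True
    then obtain s where s: "comp ?f s \<noteq> 0" "s > it" by (auto simp: in_supp)
    have "s \<notin> {n. ?p $$ n \<noteq> 0}" using ptop[OF s(2)] by simp
    then have "card (insert s {n. ?p $$ n \<noteq> 0}) \<ge> 4" using three symb_finite[of N A v ?f] by simp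
    moreover have "insert s {n. ?p $$ n \<noteq> 0} \<subseteq> supp ?f" using sub s by (simp add: in_supp)
    ultimately have supp: "insert s {n. ?p $$ n \<noteq> 0} = supp ?f"
      using four by (intro card_seteq) simp_all
    \<comment> \<open>The weight \<open>(N2, A2)\<close> belongs to the segment from the end of the first edge to the component of degree \<open>s\<close>.\<close>
    define N2 where "N2 = s - it"
    define A2 where "A2 = ?d it - ?d s"
    define v2 where "v2 = N2 * ?d it + A2 * it"
    have N2: "N2 > 0" using s by (simp add: N2_def)
    have v2s: "v2 = N2 * ?d s + A2 * s" by (simp add: v2_def N2_def A2_def algebra_simps)
    have steeper: "A * N2 < N * A2"
    proof -
      have "N * ?d s + A * s \<le> v" using f s wle_iff_degree[OF N] by blast
      moreover have "N * ?d s + A * s \<noteq> v"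
        using symb_nth_degree[OF N _ s(1), of v A] ptop[OF s(2)] by auto
      ultimately have "N * ?d s + A * s < N * ?d it + A * it" using fit by simp
      then show ?thesis by (simp add: N2_def A2_def algebra_simps)
    qed
    have below: "N2 * ?d k + A2 * k < v2" if "k \<in> supp ?f" "k \<noteq> s" "k \<noteq> it" for k
    proof -
      have pk: "?p $$ k \<noteq> 0" using that supp by auto
      then have kt: "k < it" using ptop[of k] that(3) by force
      have "N * ?d k + A * k = N * ?d it + A * it" using symb_nth_degreeE[OF N f pk] fit by simp
      then have *: "N * (?d k - ?d it) = A * (it - k)" by (simp add: algebra_simps)
      have "N * (N2 * ?d k + A2 * k - v2) = N2 * (N * (?d k - ?d it)) - (N * A2) * (it - k)"
        by (simp add: v2_def algebra_simps)
      also have "\<dots> = (it - k) * (A * N2 - N * A2)" unfolding * by (simp add: algebra_simps)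
      also have "\<dots> < 0" using kt steeper by (intro mult_pos_neg) auto
      finally show ?thesis using N by (simp add: mult_less_0_iff)
    qed
    have f2: "wle N2 A2 v2 ?f" unfolding wle_iff_degree[OF N2]
    proof (intro allI impI)
      fix k assume "comp ?f k \<noteq> 0"
      then show "N2 * ?d k + A2 * k \<le> v2"
        using below[of k] v2s v2_def by (cases "k = s"; cases "k = it") (auto simp: in_supp)
    qed
    let ?p2 = "symb N2 A2 v2 ?f"
    have p2: "?p2 $$ it \<noteq> 0" "?p2 $$ s \<noteq> 0"
      using symb_nth_degree[OF N2 v2_def] symb_nth_degree[OF N2 v2s] fit s by auto
    have p2only: "{n. ?p2 $$ n \<noteq> 0} \<subseteq> {it, s}"
    proof
      fix n assume "n \<in> {n. ?p2 $$ n \<noteq> 0}"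
      then have "comp ?f n \<noteq> 0" "v2 = N2 * ?d n + A2 * n" using symb_nth_degreeE[OF N2 f2, of n] by auto
      then show "n \<in> {it, s}" using below[of n] by (auto simp: in_supp)
    qed
    have v2: "v2 > 0" using two_sided_weight(1)[OF two(1) stable_emb N2 f2] .
    have "?g \<noteq> 0" using g(2) by auto
    then obtain w2 where w2: "wle N2 A2 w2 ?g" "symb N2 A2 w2 ?g \<noteq> 0" using weight_exists[OF N2] by metis
    show ?thesis
    proof (cases "v2 + w2 \<le> N2")
      case True
      then show ?thesis using generate_minimal_weight[OF comm two N2 f2 w2(1)] by simp
    next
      case False
      then have br2: "bracket v2 w2 ?p2 (symb N2 A2 w2 ?g) = 0"
        using weights_commutator_one(2)[OF N2 comm' f2 w2(1)] by simp
      have "\<forall>n>it. ?p $$ n = 0" using ptop by blast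
      moreover have "\<forall>n<it. ?p2 $$ n = 0" using p2only s(2) by force
      ultimately have "v * w2 = v2 * w"
        by (intro common_vertex_ratio[OF N N2 v v2 f f2 g w2 br br2 pit _ p2(1)])
      moreover have "m * (v2 * int b) = v2 * w" "m * (w2 * int a) = v * w2"
        unfolding vw(2,3) by (simp_all only: ac_simps)
      ultimately have "m * (v2 * int b) = m * (w2 * int a)" by simp
      then have "v2 * int b = w2 * int a" using vw(4) by (metis mult_left_cancel less_irrefl)
      from root_of_symbol[OF symb_finite symb_finite w2(2) br2 this v2 ab(1) p2 s(2)]
      obtain k where k: "a dvd k" "k > 0" "k < card {n. ?p2 $$ n \<noteq> 0}" by blast
      have "card {n. ?p2 $$ n \<noteq> 0} \<le> 2"
        using card_mono[OF _ p2only] s(2) by simp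
      then have "k = 1" using k by simp
      then show ?thesis using ab(2) k(1) by simp
    qed
  next
    case False
    then have above: "comp ?f n = 0" if "n > it" for n using that by (auto simp: in_supp)
    have itpos: "it > 0"
    proof -
      obtain k where "k > 0" "comp ?f k \<noteq> 0" using two(1) two_sided_def by blast
      then show ?thesis using above[of k] by force
    qed
    have div: "\<exists>k l. i = int a * k \<and> ?d i = int a * l \<and> comp ?g (int b * k) \<noteq> 0
        \<and> int (degree (comp ?g (int b * k))) = int b * l"
      if i: "?p $$ i \<noteq> 0" "(\<forall>n>i. ?p $$ n = 0) \<or> (\<forall>n<i. ?p $$ n = 0)" for i
    proof -
      obtain j where j: "comp ?g j \<noteq> 0" "v * j = w * i" "v * int (degree (comp ?g j)) = w * ?d i"
        using matching_vertex[OF N v f g br i] by blast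
      let ?e = "int (degree (comp ?g j))"
      have ji: "int a * j = int b * i" "int a * ?e = int b * ?d i" using j vw by auto
      have cop: "coprime (int a) (int b)" using ab(1) by simp
      have "int a dvd int b * i" "int a dvd int b * ?d i" unfolding ji[symmetric] by simp_all
      then have "int a dvd i" "int a dvd ?d i" using cop by (simp_all add: coprime_dvd_mult_right_iff)
      then obtain k l where kl: "i = int a * k" "?d i = int a * l" unfolding dvd_def by blast
      have "int a * j = int a * (int b * k)" "int a * ?e = int a * (int b * l)"
        using ji kl by (simp_all add: algebra_simps)
      then have "j = int b * k" "?e = int b * l" using ab(2) by simp_all
      then show ?thesis using kl j(1) by blast
    qed
    obtain kr dr where r0: "i0 = int a * kr" "?d i0 = int a * dr" "comp ?g (int b * kr) \<noteq> 0"
      "int (degree (comp ?g (int b * kr))) = int b * dr" using div[OF i0(1)] pbot by blast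
    obtain s' ds where s: "it = int a * s'" "?d it = int a * ds" "comp ?g (int b * s') \<noteq> 0"
      "int (degree (comp ?g (int b * s'))) = int b * ds" using div[OF pit] ptop by blast
    define r' where "r' = - kr"
    have a0: "int a > 0" using ab(2) by simp
    have r': "r' > 0" using i0neg r0(1) a0 by (simp add: r'_def mult_less_0_iff)
    have s': "s' > 0" using itpos s(1) a0 by (simp add: zero_less_mult_iff)
    have "int a * r' \<le> int a * dr" using stable_degree[OF stable_emb, of P i0] fi0 r0 by (simp add: r'_def)
    then have dr: "r' \<le> dr" using a0 by simp
    have "0 \<le> int a * ds" using s(2) by (metis of_nat_0_le_iff)
    then have ds: "0 \<le> ds" using a0 by (simp add: zero_le_mult_iff)
    have "int a * m = int a * (N * ds + A * s')" using fit vw(2) s by (simp add: algebra_simps)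
    then have m1: "m = N * ds + A * s'" using a0 by simp
    have "int a * m = int a * (N * dr - A * r')" using fi0 vw(2) r0 by (simp add: r'_def algebra_simps)
    then have m2: "m = N * dr - A * r'" using a0 by simp
    have "m < N"
    proof -
      have "wle N A 0 (1 :: 'k skew)" by (auto simp: wle_def comp_one)
      moreover have "symb N A 0 (1 :: 'k skew) = 1" by (simp add: symb_one[OF N])
      moreover have "bracket v 0 ?p 1 = 0" by (simp add: bracket_def euler_simps)
      ultimately obtain t T G where T: "T \<noteq> 0" "finite {n. T $$ n \<noteq> 0}" "G \<noteq> 0"
        "bracket v t ?p T = of_int N * G" "bracket v (v + t - N) ?p G = 0"
        using noncommuting_symbol_exists[OF N v f i0(1) i1, of w ?g 0] g comm' by auto
      obtain e T1 where T1: "T = lau e T1" "coeff T1 0 \<noteq> 0" using lau_exists[OF T(1,2)] by metis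
      have "v < int a * N"
      proof (rule weight_bound[OF N v _ _ T(3) p1(2) T1(2)])
        show "bracket v t (lau i0 p1) (lau e T1) = of_int N * G" using T(4) unfolding p1(1) T1(1) e0 .
        show "bracket v (v + t - N) (lau i0 p1) G = 0" using T(5) unfolding p1(1) e0 .
      qed (use i0neg itpos ord_a in \<open>auto simp: it_def\<close>)
      then show ?thesis using vw(2) a0 by simp
    qed
    then have "(r' + s') * m < (r' + s') * N" using r' s' by simp
    moreover have "(r' + s') * m = r' * (N * ds + A * s') + s' * (N * dr - A * r')"
      using m1 m2 by (simp add: distrib_right)
    ultimately have "N * (ds * r' + dr * s') < N * (r' + s')" by (simp add: algebra_simps)
    then have lattice: "ds * r' + dr * s' < r' + s'" using N by simp
    have drs: "dr * s' \<ge> r' * s'" using dr s' by simp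
    have ds0: "ds = 0"
    proof (rule ccontr)
      assume "ds \<noteq> 0"
      then have "ds * r' \<ge> 1 * r'" using ds r' by (intro mult_right_mono) auto
      moreover have "dr * s' \<ge> 1 * s'" using dr r' s' by (intro mult_right_mono) auto
      ultimately show False using lattice by simp
    qed
    have rs: "r' = 1 \<or> s' = 1"
    proof (rule ccontr)
      assume "\<not> (r' = 1 \<or> s' = 1)"
      then have "(r' - 1) * (s' - 1) \<ge> 1 * 1" using r' s' by (intro mult_mono) auto
      then show False using lattice drs ds0 by (simp add: algebra_simps)
    qed
    have mA: "m = A * s'" using m1 ds0 by simp
    then have A: "A > 0" using vw(4) s' by (simp add: zero_less_mult_iff)
    show ?thesis
    proof (cases "r' = 1")
      case True
      have dr1: "dr = 1"
      proof (rule ccontr)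
        assume "dr \<noteq> 1"
        then have "2 * s' \<le> dr * s'" using dr True s' by (intro mult_right_mono) auto
        moreover have "dr * s' < 1 + s'" using lattice ds0 True by simp
        ultimately show False using s' by linarith
      qed
      then have mNA: "m = N - A" using m2 True by simp
      have kr: "kr = - 1" using True r'_def by simp
      show ?thesis
      proof (rule generate_triangle[OF comm A])
        show "A < N" using mNA vw(4) by simp
        show "wle N A (int a * (N - A)) ?f" "wle N A (int b * (N - A)) ?g" using f g vw mNA by auto
        show "comp ?f (- int a) \<noteq> 0" "degree (comp ?f (- int a)) = a" using fi0 r0 kr dr1 by auto
        show "comp ?g (- int b) \<noteq> 0" "degree (comp ?g (- int b)) = b" using r0 kr dr1 by auto
      qed (use ab b in auto)
    next
      case False
      then have s1: "s' = 1" using rs by simp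
      then have "dr = r'" using lattice ds0 dr by simp
      then have ANr: "A = (N - A) * r'" using m1 m2 s1 ds0 by (simp add: algebra_simps)
      then have "0 < (N - A) * r'" using A by simp
      then have NA: "N - A > 0" using r' zero_less_mult_pos2 by blast
      have ma: "m = A" using mA s1 by simp
      show ?thesis
      proof (rule generate_rot, rule generate_triangle[OF commutator_rot[OF comm] NA])
        show "N - A < N" using A by simp
        show "wle N (N - A) (int a * (N - (N - A))) (emb (rot P))" using wle_rot[OF N f] vw ma by simp
        show "wle N (N - A) (int b * (N - (N - A))) (emb (rot Q))" using wle_rot[OF N g(1)] vw ma by simp
        have "comp ?f (int a) \<noteq> 0" "degree (comp ?f (int a)) = 0" using fit s s1 ds0 by auto
        then show "comp (emb (rot P)) (- int a) \<noteq> 0" "degree (comp (emb (rot P)) (- int a)) = a"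
          using comp_rot[of P "int a"] by auto
        have "comp ?g (int b) \<noteq> 0" "degree (comp ?g (int b)) = 0" using s s1 ds0 by auto
        then show "comp (emb (rot Q)) (- int b) \<noteq> 0" "degree (comp (emb (rot Q)) (- int b)) = b"
          using comp_rot[of Q "int b"] by auto
      qed (use ab b in auto)
    qed
  qed
qed

text \<open>Induction on the excess \<open>v + w - N\<close> of the weights, for a fixed weight that belongs to the edge of \<open>P\<close> at its lowest
  component.\<close>

lemma generate_four_terms:
  fixes P Q :: "'k::field_char_0 weyl"
  assumes comm: "commutator P Q = 1" and four: "card (supp (emb P)) \<le> 4"
  shows "weyl_subalgebra {P, Q} = UNIV"
proof (cases "two_sided (emb P)")
  case False
  then have "(\<forall>i<0. comp (emb P) i = 0) \<or> (\<forall>i>0. comp (emb P) i = 0)" by (auto simp: two_sided_def)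
  then show ?thesis using generate_one_sided[OF comm] by blast
next
  case two: True
  let ?f = "emb P"
  let ?d = "\<lambda>i. int (degree (comp ?f i))"
  have "?f \<noteq> 0" using two by (auto simp: two_sided_def)
  then obtain i0 where i0: "comp ?f i0 \<noteq> 0" "\<And>i. i < i0 \<Longrightarrow> comp ?f i = 0"
    using lowest_component by blast
  define S where "S = (\<lambda>i. (i - i0, ?d i0 - ?d i)) ` {i \<in> supp ?f. i \<noteq> i0}"
  have gt: "i > i0" if "i \<in> supp ?f" "i \<noteq> i0" for i
    using i0(2)[of i] that by (force simp: in_supp)
  have "finite S" by (simp add: S_def)
  moreover have "S \<noteq> {}"
  proof -
    obtain i j where "i > 0" "comp ?f i \<noteq> 0" "j < 0" "comp ?f j \<noteq> 0" using two two_sided_def by blast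
    then have "i \<in> supp ?f" "i \<noteq> i0" using i0(2)[of j] by (auto simp: in_supp)
    then show ?thesis by (auto simp: S_def)
  qed
  moreover have "n > 0" if "(n, s) \<in> S" for n s using that gt by (auto simp: S_def)
  ultimately obtain N A where NA: "(N, A) \<in> S" "\<And>n s. (n, s) \<in> S \<Longrightarrow> A * n \<le> s * N"
    using minimal_slope[of S] by blast
  obtain i1 where i1: "comp ?f i1 \<noteq> 0" "i1 > i0" "N = i1 - i0" "A = ?d i0 - ?d i1"
    using NA(1) gt by (auto simp: S_def in_supp)
  have N: "N > 0" using i1 by simp
  define v where "v = N * ?d i0 + A * i0"
  have f: "wle N A v ?f" unfolding wle_iff_degree[OF N]
  proof (intro allI impI)
    fix i assume i: "comp ?f i \<noteq> 0"
    show "N * ?d i + A * i \<le> v"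
    proof (cases "i = i0")
      case False
      then have "A * (i - i0) \<le> (?d i0 - ?d i) * N" using i by (intro NA(2)) (auto simp: S_def in_supp)
      then show ?thesis by (simp add: v_def algebra_simps)
    qed (simp add: v_def)
  qed
  let ?p = "symb N A v ?f"
  have p0: "?p $$ i0 \<noteq> 0" by (rule symb_nth_degree[OF N v_def i0(1)])
  have p1: "?p $$ i1 \<noteq> 0"
    by (rule symb_nth_degree[OF N _ i1(1)]) (simp add: v_def i1(3,4) algebra_simps)
  have v: "v > 0" using two_sided_weight(1)[OF two stable_emb N f] .
  have "weyl_subalgebra {P, Q} = UNIV"
    if "commutator P Q = 1" "wle N A w (emb Q)" "symb N A w (emb Q) \<noteq> 0" for Q w
    using that
  proof (induction "nat (v + w - N)" arbitrary: Q w rule: less_induct)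
    case less
    let ?g = "emb Q" and ?q = "symb N A w (emb Q)"
    have comm': "?f * ?g - ?g * ?f = 1" by (rule emb.weyl_img_commutator[OF less.prems(1)])
    consider "\<not> two_sided ?g" | "two_sided ?g" "v + w \<le> N" | "two_sided ?g" "v + w > N" by linarith
    then show ?case
    proof cases
      case 1
      then have "(\<forall>i<0. comp ?g i = 0) \<or> (\<forall>i>0. comp ?g i = 0)" by (auto simp: two_sided_def)
      then show ?thesis using generate_one_sided[OF less.prems(1)] by blast
    next
      case 2
      then show ?thesis using generate_minimal_weight[OF less.prems(1) two _ N f less.prems(2)] by blast
    next
      case 3
      have w: "w > 0" using two_sided_weight(1)[OF 3(1) stable_emb N less.prems(2)] .
      have br: "bracket v w ?p ?q = 0"
        using weights_commutator_one(2)[OF N comm' f less.prems(2)] 3 by simp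
      define m where "m = gcd v w"
      have m: "m > 0" using v by (simp add: m_def)
      define a b where "a = nat (v div m)" and "b = nat (w div m)"
      have va: "v = int a * m" "w = int b * m"
        using v w m by (simp_all add: a_def b_def m_def pos_imp_zdiv_nonneg_iff)
      have "coprime (v div m) (w div m)" unfolding m_def using v by (intro div_gcd_coprime) auto
      moreover have "v div m = int a" "w div m = int b" using va m by auto
      ultimately have ab: "coprime a b" by simp
      have "a \<noteq> 0" by (rule ccontr) (use va(1) v in simp)
      show ?thesis
      proof (cases "a = 1")
        case False
        then have "a \<ge> 2" using \<open>a \<noteq> 0\<close> by simp
        then show ?thesis
          using generate_unless_divisible[OF less.prems(1) two 3(1) N f less.prems(2,3) 3(2) va m ab _ p0 i0(2) p1 i1(2) four]
          by blast
      next
        case True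
        then have wb: "w = int b * v" using va by simp
        have "bracket v (int b * v) ?p (?p ^ b) = 0" by (rule bracket_power) (simp add: bracket_def)
        moreover have "?p \<noteq> 0" using p0 by auto
        ultimately obtain c where c: "?q = fls_const c * ?p ^ b"
          using bracket_proportional[OF br, of "?p ^ b"] v wb by auto
        define Q' where "Q' = Q - weyl_const c * P ^ b"
        have embQ': "emb Q' = ?g - sconst c * ?f ^ b" by (simp add: Q'_def emb.weyl_img_simps)
        note pw = symb_power[OF N f, of b, folded wb]
        have "wle N A w (sconst c * ?f ^ b)" using pw by (auto simp: wle_def comp_sconst_times)
        then have "wle N A w (emb Q')" unfolding embQ' using less.prems(2) by (intro wle_diff)
        moreover have "symb N A w (emb Q') = 0"
          unfolding embQ' symb_simps(3) symb_sconst_times using pw c by simp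
        ultimately have wQ': "wle N A (w - 1) (emb Q')" using wle_pred[OF N] by blast
        have "P * (weyl_const c * P ^ b) = weyl_const c * P ^ b * P"
          by (metis mult.assoc power_commutes weyl_const_central)
        then have commQ': "commutator P Q' = 1"
          using less.prems(1) by (simp add: commutator_def Q'_def algebra_simps)
        note comm'' = emb.weyl_img_commutator[OF commQ']
        have "emb Q' \<noteq> 0" using comm'' by auto
        then obtain w' where w': "wle N A w' (emb Q')" "symb N A w' (emb Q') \<noteq> 0"
          using weight_exists[OF N] by metis
        have "w' \<le> w - 1" using symb_above[OF N wQ', of w'] w'(2) by force
        moreover have "v + w' \<ge> N" by (rule weights_commutator_one(1)[OF N comm'' f w'(1)])
        ultimately have "weyl_subalgebra {P, Q'} = UNIV"
          by (intro less.hyps[OF _ commQ' w']) linarith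
        moreover have "weyl_subalgebra {P, Q'} \<subseteq> weyl_subalgebra {P, Q}"
        proof (rule subalgebra_subset)
          have "Q' \<in> weyl_subalgebra {P, Q}" unfolding Q'_def
            by (intro subalgebra_diff weyl_subalgebra.mult weyl_subalgebra.const subalgebra_power)
              (auto intro: weyl_subalgebra.gen)
          then show "{P, Q'} \<subseteq> weyl_subalgebra {P, Q}" by (auto intro: weyl_subalgebra.gen)
        qed
        ultimately show ?thesis by auto
      qed
    qed
  qed
  moreover have "emb Q \<noteq> 0" using emb.weyl_img_commutator[OF comm] by auto
  then obtain w where "wle N A w (emb Q)" "symb N A w (emb Q) \<noteq> 0" using weight_exists[OF N] by metis
  ultimately show ?thesis using comm by blast
qed

theorem corollary4p3:
  fixes P Q :: "'k::field_char_0 weyl"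
  assumes "commutator P Q = 1"
    and "\<exists>n \<le> (4::nat). \<exists>h :: nat \<Rightarrow> 'k weyl.
           (\<forall>i<n. weyl_homogeneous (h i)) \<and> P = (\<Sum>i<n. h i)"
  shows "weyl_subalgebra {P, Q} = UNIV"
proof (rule generate_four_terms[OF assms(1)])
  obtain n :: nat and h :: "nat \<Rightarrow> 'k weyl" where n: "n \<le> 4" and h: "\<forall>i<n. weyl_homogeneous (h i)" and P: "P = (\<Sum>i<n. h i)"
    using assms(2) by blast
  from h obtain k where k: "\<forall>i<n. h i \<in> weyl_component (k i)" unfolding weyl_homogeneous_def by metis
  have "supp (emb P) \<subseteq> k ` {..<n}"
  proof
    fix j assume "j \<in> supp (emb P)"
    then have "(\<Sum>i<n. comp (emb (h i)) j) \<noteq> 0" by (simp add: P emb.weyl_img_sum in_supp comp_sum)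
    then obtain i where "i < n" "comp (emb (h i)) j \<noteq> 0" by (auto elim: sum.not_neutral_contains_not_neutral)
    then show "j \<in> k ` {..<n}" using emb_component[of "h i" "k i"] k by (auto simp: in_supp)
  qed
  then have "card (supp (emb P)) \<le> card (k ` {..<n})" by (intro card_mono) auto
  also have "\<dots> \<le> n" using card_image_le[of "{..<n}" k] by simp
  finally show "card (supp (emb P)) \<le> 4" using n by simp
qed

end
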